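(* Let $n\geq 1$ be an integer and $k>0$ a real number, and let $\phi_\lambda(e^X)$ denote the Weyl-invariant hypergeometric function for the root system $A_n$ with root multiplicity $k$. Then there exist constants $C_1,C_2>0$ (depending only on $n$ and $k$) such that for all $X,\lambda\in\overline{\mathfrak{a}^+}$, $$C_1\,B(\lambda,X)\leq \phi_\lambda(e^X)\leq C_2\,B(\lambda,X),$$ where $$B(\lambda,X)=e^{(\lambda-\rho)(X)}\prod_{\alpha\in\Sigma^+}\frac{1+\alpha(X)}{(1+\alpha(\lambda)\,\alpha(X))^{k}}\left(\frac{1+\alpha(\lambda)\,(1+\alpha(X))}{1+\alpha(\lambda)}\right)^{k-1}.$$
   Context: Root system $A_n$: $\mathfrak{a}^+=\{X=(x_1,\dots,x_{n+1})\in\mathbf{R}^{n+1}: x_1>x_2>\dots>x_{n+1}\}$ and $\overline{\mathfrak{a}^+}$ is its closure. $\Sigma^+$ is the set of positive roots $\alpha=\alpha_{ij}$, $1\leq i<j\leq n+1$, with $\alpha_{ij}(X)=x_i-x_j$ and $\alpha_{ij}(\lambda)=\lambda_i-\lambda_j$ for $X,\lambda\in\mathbf{R}^{n+1}$. We write $\lambda(X)=\sum_{j=1}^{n+1}\lambda_j x_j$ and $\rho(X)=k\sum_{1\leq i<j\leq n+1}(x_i-x_j)$, and $(\lambda-\rho)(X)=\lambda(X)-\rho(X)$. The hypergeometric function of type $A_n$ with multiplicity $k>0$ (which extends to arbitrary multiplicities the spherical functions of symmetric spaces of noncompact type with root system $A_n$) is given recursively as follows; the notation $\phi_\lambda(e^X)$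 just means a function of $(\lambda,X)$. For $n=0$, $\phi_\lambda(e^X)=e^{\lambda_1 x_1}$. For $n\geq1$, $\lambda\in\mathbf{R}^{n+1}$ and $X\in\mathfrak{a}^+$, $$\phi_\lambda(e^X)=\frac{\Gamma(k(n+1))}{\Gamma(k)^{n+1}}\,e^{\lambda_{n+1}\sum_{j=1}^{n+1}x_j}\int_{E(X)}\phi_{\lambda_0}(e^Y)\,S^{(k)}(Y,X)\,d(Y)^{2k}\,dY,$$ where $E(X)=\{Y=(y_1,\dots,y_n): x_{j+1}\leq y_j\leq x_j,\ 1\leq j\leq n\}$, $\lambda_0=(\lambda_1-\lambda_{n+1},\dots,\lambda_n-\lambda_{n+1})\in\mathbf{R}^n$, $\phi_{\lambda_0}(e^Y)$ is the function of type $A_{n-1}$ with the same $k$, $d(X)=\prod_{1\leq r<s\leq n+1}\sinh(x_r-x_s)$, $d(Y)=\prod_{1\leq r<s\leq n}\sinh(y_r-y_s)$, and $$S^{(k)}(Y,X)=d(X)^{1-2k}d(Y)^{1-2k}\left[\prod_{r=1}^n\left(\prod_{s=1}^r\sinh(x_s-y_r)\prod_{s=r+1}^{n+1}\sinh(y_r-x_s)\right)\right]^{k-1}.$$ For $X\in\overline{\mathfrak{a}^+}$ the function is extended by continuity. The function $\phi_\lambda(e^X)$ is symmetric (permutation invariant) in $(\lambda_1,\dots,\lambda_{n+1})$. *)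

theory Defs
  imports "HOL-Analysis.Analysis"
begin

text \<open>
  The rank \<open>n\<close> varies in the recursion, so a vector \<open>(x\<^sub>1, \<dots>, x\<^sub>N)\<close> is a function
  \<open>nat \<Rightarrow> real\<close> of which only the values at \<open>1, \<dots>, N\<close> matter. On sets and functions that do not
  look at the other values, closures and limits in the product topology on \<open>nat \<Rightarrow> real\<close> are
  those of the first \<open>N\<close> coordinates.
\<close>

definition chamber :: "nat \<Rightarrow> (nat \<Rightarrow> real) set" where
  "chamber N = {X. \<forall>i j. 1 \<le> i \<and> i < j \<and> j \<le> N \<longrightarrow> X i > X j}"

text \<open>The pair \<open>(i, j)\<close> stands for the root \<open>\<alpha>\<^sub>i\<^sub>j\<close>; for type \<open>A\<^sub>n\<close> take \<open>N = n + 1\<close>.\<close>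

definition pos_roots :: "nat \<Rightarrow> (nat \<times> nat) set" where
  "pos_roots N = {(i, j). 1 \<le> i \<and> i < j \<and> j \<le> N}"

definition root_val :: "nat \<times> nat \<Rightarrow> (nat \<Rightarrow> real) \<Rightarrow> real" where
  "root_val \<alpha> X = X (fst \<alpha>) - X (snd \<alpha>)"

definition pairing :: "nat \<Rightarrow> (nat \<Rightarrow> real) \<Rightarrow> (nat \<Rightarrow> real) \<Rightarrow> real" where
  "pairing N l X = (\<Sum>j=1..N. l j * X j)"

definition rho :: "real \<Rightarrow> nat \<Rightarrow> (nat \<Rightarrow> real) \<Rightarrow> real" where
  "rho k N X = k * (\<Sum>\<alpha>\<in>pos_roots N. root_val \<alpha> X)"

definition dprod :: "nat \<Rightarrow> (nat \<Rightarrow> real) \<Rightarrow> real" where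
  "dprod N X = (\<Prod>\<alpha>\<in>pos_roots N. sinh (root_val \<alpha> X))"

definition interlacing :: "nat \<Rightarrow> (nat \<Rightarrow> real) \<Rightarrow> (nat \<Rightarrow> real) set" where
  "interlacing n X = (\<Pi>\<^sub>E j\<in>{1..n}. {X (j + 1)..X j})"

definition kernel_S :: "real \<Rightarrow> nat \<Rightarrow> (nat \<Rightarrow> real) \<Rightarrow> (nat \<Rightarrow> real) \<Rightarrow> real" where
  "kernel_S k n Y X =
     dprod (n + 1) X powr (1 - 2 * k) * dprod n Y powr (1 - 2 * k) *
     (\<Prod>r=1..n. (\<Prod>s=1..r. sinh (X s - Y r)) * (\<Prod>s=r+1..n+1. sinh (Y r - X s))) powr (k - 1)"

text \<open>
  The right-hand side of the recursion in rank \<open>n\<close>, for \<open>X\<close> in the open chamber; \<open>\<phi>\<close> is the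
  function of rank \<open>n - 1\<close>, with arguments \<open>\<lambda>\<^sub>0\<close> and \<open>Y\<close>.
\<close>

definition hypergeom_step ::
    "real \<Rightarrow> nat \<Rightarrow> ((nat \<Rightarrow> real) \<Rightarrow> (nat \<Rightarrow> real) \<Rightarrow> real) \<Rightarrow>
     (nat \<Rightarrow> real) \<Rightarrow> (nat \<Rightarrow> real) \<Rightarrow> real" where
  "hypergeom_step k n \<phi> l X =
     Gamma (k * real (n + 1)) / Gamma k ^ (n + 1) * exp (l (n + 1) * (\<Sum>j=1..n+1. X j)) *
     (LINT Y:interlacing n X|Pi\<^sub>M {1..n} (\<lambda>_. lborel).
        \<phi> (\<lambda>j. l j - l (n + 1)) Y * kernel_S k n Y X * dprod n Y powr (2 * k))"

text \<open>
  \<open>hypergeom k n l X\<close> is the function of type \<open>A\<^sub>n\<close> at \<open>\<lambda> = l\<close>. Outside the open chamber it is the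
  limit from inside the open chamber, which is the extension by continuity to the closed chamber;
  its values outside the closed chamber have no meaning.
\<close>

fun hypergeom :: "real \<Rightarrow> nat \<Rightarrow> (nat \<Rightarrow> real) \<Rightarrow> (nat \<Rightarrow> real) \<Rightarrow> real" where
  "hypergeom k 0 l X = exp (l 1 * X 1)"
| "hypergeom k (Suc n) l X =
     (if X \<in> chamber (Suc n + 1) then hypergeom_step k (Suc n) (hypergeom k n) l X
      else Lim (at X within chamber (Suc n + 1)) (hypergeom_step k (Suc n) (hypergeom k n) l))"

definition bound_B :: "real \<Rightarrow> nat \<Rightarrow> (nat \<Rightarrow> real) \<Rightarrow> (nat \<Rightarrow> real) \<Rightarrow> real" where
  "bound_B k n l X =
     exp (pairing (n + 1) l X - rho k (n + 1) X) *
     (\<Prod>\<alpha>\<in>pos_roots (n + 1).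
        (1 + root_val \<alpha> X) / (1 + root_val \<alpha> l * root_val \<alpha> X) powr k *
        ((1 + root_val \<alpha> l * (1 + root_val \<alpha> X)) / (1 + root_val \<alpha> l)) powr (k - 1))"

lemma closure_chamber:
  "closure (chamber N) = {X. \<forall>i j. 1 \<le> i \<and> i < j \<and> j \<le> N \<longrightarrow> X i \<ge> X j}" (is "_ = ?C")
proof
  have ev: "continuous_on UNIV (\<lambda>X::nat \<Rightarrow> real. X i)" for i
    by (rule continuous_on_product_coordinates)
  have "?C = (\<Inter>i. \<Inter>j\<in>{j. 1 \<le> i \<and> i < j \<and> j \<le> N}. {X. X j \<le> X i})"
    by auto
  moreover have "closed \<dots>"
    by (intro closed_INT ballI closed_Collect_le ev)
  ultimately have "closed ?C" by simp
  then show "closure (chamber N) \<subseteq> ?C"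
    by (intro closure_minimal) (auto simp: chamber_def less_imp_le)
  show "?C \<subseteq> closure (chamber N)"
  proof
    fix X assume X: "X \<in> ?C"
    define Z where "Z m i = X i - real i / real (Suc m)" for m i
    have "Z m \<in> chamber N" for m
      unfolding chamber_def
    proof (intro CollectI allI impI)
      fix i j assume ij: "1 \<le> i \<and> i < j \<and> j \<le> N"
      with X have "X j \<le> X i" by blast
      moreover have "real i / real (Suc m) < real j / real (Suc m)"
        using ij by (intro divide_strict_right_mono) auto
      ultimately show "Z m j < Z m i" by (simp add: Z_def)
    qed
    moreover have "Z \<longlonglongrightarrow> X"
    proof -
      have "continuous_on UNIV (\<lambda>t i. X i - real i * t)"
        by (intro continuous_on_coordinatewise_then_product continuous_intros)
      then have "isCont (\<lambda>t i. X i - real i * t) 0"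
        by (simp add: continuous_on_eq_continuous_at)
      then have "(\<lambda>m. (\<lambda>t i. X i - real i * t) (1 / real (Suc m))) \<longlonglongrightarrow> (\<lambda>i. X i - real i * 0)"
        by (rule isCont_tendsto_compose[OF _ LIMSEQ_Suc[OF lim_const_over_n]])
      then show ?thesis by (simp add: Z_def[abs_def])
    qed
    ultimately show "X \<in> closure (chamber N)"
      by (auto simp: closure_sequential)
  qed
qed

end

theory Submission
  imports Defs
begin

text \<open>
  Induction on the rank. Writing \<open>sinh t = exp t * s t\<close> with \<open>s t\<close> comparable to \<open>t / (1 + t)\<close>, the
  exponentials in the recursion collect to \<open>exp ((\<lambda> - \<rho>)(X))\<close> times
  \<open>exp (- (\<Sum>j. (\<lambda>\<^sub>j - \<lambda>\<^sub>n\<^sub>+\<^sub>1) * (x\<^sub>j - y\<^sub>j)))\<close>, and the factor of \<open>B\<close> at a root with values \<open>l\<close>, \<open>x\<close>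
  is comparable to \<open>\<psi> (1 / (l + 1 / x)) / s x powr k\<close> with \<open>\<psi> t = t powr k * (1 + t) powr (1 - k)\<close>.
  Ptolemy's inequality for \<open>sinh\<close> bounds the remaining cross-ratios by functions of the single
  variables \<open>u\<^sub>j = x\<^sub>j - y\<^sub>j\<close>, so the integral is dominated by a product of one-dimensional integrals
  in which \<open>u\<^sub>j\<close> is confined to the scale \<open>m\<^sub>j = 1 / ((\<lambda>\<^sub>j - \<lambda>\<^sub>n\<^sub>+\<^sub>1) + 1 / (x\<^sub>j - x\<^sub>j\<^sub>+\<^sub>1))\<close>; the box
  \<open>m\<^sub>j / 4 \<le> u\<^sub>j \<le> m\<^sub>j / 2\<close> gives the matching lower bound. The resulting product over the roots of
  rank \<open>n - 1\<close> telescopes, row by row, to the one of rank \<open>n\<close>.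

  The values on the walls are limits from the open chamber, so these must be shown to exist. In the
  coordinates \<open>v = exp (2 x)\<close>, \<open>u = exp (2 y)\<close> the recursion integrates against the density of the
  Dixon--Anderson integral, for which the weights \<open>w\<^sub>s\<close> in
  \<open>\<Prod>\<^sub>r (z - u\<^sub>r) = \<Sum>\<^sub>s w\<^sub>s * \<Prod>\<^sub>t\<^sub>\<noteq>\<^sub>s (z - v\<^sub>t)\<close> follow a Dirichlet law not depending on \<open>v\<close>. Hence means of
  polynomials in the values \<open>\<Prod>\<^sub>r (z - u\<^sub>r)\<close> are polynomials in \<open>v\<close>, and Stone--Weierstrass extends
  the existence of limits to all continuous functions.
\<close>

section \<open>Elementary comparisons\<close>

text \<open>Two obstacles shape the proof. On the walls \<open>hypergeom\<close> is a
  \<open>Lim\<close>, which says nothing until the limit is known to exist, and the integrand of the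
  next rank must be measurable; so the induction carries continuity on the closed chamber along with
  the two bounds. The kernel contains \<open>dprod (n + 1) X powr (1 - 2 * k)\<close>, which
  degenerates at the walls while the domain of integration may collapse. Dividing by the total mass
  of the Dixon--Anderson density removes exactly this factor and leaves means of continuous
  functions. The mass is computed for exponent 1, and its dependence on the exponent is recovered
  from moments of the weights. In the estimates, \<open>psi k t\<close> is comparable to the
  integral of \<open>(u / (1 + u)) powr (k - 1)\<close> over \<open>0 < u < t\<close>: the mass
  which the kernel puts on an interval of length \<open>t\<close> at a node. The exponent
  \<open>k - 1\<close> changes sign at \<open>k = 1\<close>, hence comparisons in both directions
  and two Ptolemy bounds. No constant is sharp; it only matters that they depend on \<open>n\<close>
  and \<open>k\<close> alone.\<close>

lemma powr_ratio_le:
  fixes a b c e :: real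
  assumes "0 < a" "0 < b" "1 \<le> c" "a \<le> c * b" "b \<le> c * a"
  shows "a powr e \<le> c powr \<bar>e\<bar> * b powr e"
\<comment> \<open>Comparability in both directions makes the estimate insensitive to the sign of the
  exponent, and \<open>k - 1\<close> takes both signs.\<close>
proof (cases "e \<ge> 0")
  case True
  have "a powr e \<le> (c * b) powr e" using assms True by (intro powr_mono2) auto
  also have "\<dots> = c powr \<bar>e\<bar> * b powr e" using assms True by (simp add: powr_mult)
  finally show ?thesis .
next
  case False
  have "b powr (-e) \<le> (c * a) powr (-e)" using assms False by (intro powr_mono2) auto
  also have "\<dots> = c powr (-e) * a powr (-e)" using assms by (simp add: powr_mult)
  finally have "1 / b powr e \<le> c powr (-e) * (1 / a powr e)"
    by (simp add: powr_minus divide_inverse)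
  then have "a powr e \<le> c powr (-e) * b powr e"
    using assms by (simp add: field_simps)
  then show ?thesis using False by simp
qed

text \<open>This is \<open>exp (- t) * sinh t\<close>, so that Ptolemy's identity for \<open>sinh\<close> holds for it verbatim.\<close>

definition esinh :: "real \<Rightarrow> real" where "esinh t = (1 - exp (- 2 * t)) / 2"

lemma sinh_eq_exp_esinh: "sinh t = exp t * esinh t"
  by (simp add: esinh_def sinh_field_def field_simps flip: exp_add)

lemma esinh_pos: "0 < t \<Longrightarrow> 0 < esinh t" and esinh_nonneg: "0 \<le> t \<Longrightarrow> 0 \<le> esinh t"
  and esinh_0 [simp]: "esinh 0 = 0"
  by (simp_all add: esinh_def)

lemma esinh_mono: "s \<le> t \<Longrightarrow> esinh s \<le> esinh t"
  by (simp add: esinh_def)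

lemma esinh_le: assumes "0 \<le> t" shows "esinh t \<le> 2 * (t / (1 + t))"
proof -
  have "1 - 2 * t \<le> exp (- 2 * t)" using exp_ge_add_one_self[of "- 2 * t"] by simp
  then have 1: "esinh t \<le> t" by (simp add: esinh_def)
  have 2: "esinh t \<le> 1" using exp_gt_zero[of "- 2 * t"] unfolding esinh_def by argo
  have "esinh t * (1 + t) \<le> 2 * t"
  proof (cases "t \<le> 1")
    case True
    have "esinh t * (1 + t) \<le> t * 2" using 1 True assms esinh_nonneg[OF assms] by (intro mult_mono) auto
    then show ?thesis by simp
  next
    case False
    have s: "esinh t \<le> 1" by (fact 2)
    have "esinh t * (1 + t) \<le> 1 * (1 + t)" using s assms by (intro mult_right_mono) auto
    also have "\<dots> \<le> 2 * t" using False by simp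
    finally show ?thesis .
  qed
  then show ?thesis using assms by (simp add: field_simps)
qed

lemma esinh_ge: assumes "0 \<le> t" shows "t / (1 + t) \<le> 2 * esinh t"
proof -
  have "1 + 2 * t \<le> exp (2 * t)" by (rule exp_ge_add_one_self)
  then have "exp (- 2 * t) \<le> 1 / (1 + 2 * t)"
    using assms by (simp add: exp_minus field_simps)
  then have "1 - 1 / (1 + 2 * t) \<le> 2 * esinh t" by (simp add: esinh_def)
  moreover have "t / (1 + t) \<le> 1 - 1 / (1 + 2 * t)"
    using assms by (simp add: field_simps)
  ultimately show ?thesis by linarith
qed

text \<open>With \<open>A = exp (2 * a)\<close> and so on, \<open>a\<close> and \<open>b\<close>
  each lead one factor on either side, so both sides have the denominator \<open>4 * A * B\<close>.
  The numerators differ by \<open>(A - B) * (C - D)\<close>, which is nonnegative.\<close>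

lemma esinh_ptolemy:
  assumes "d \<le> c" "c \<le> b" "b \<le> a"
  shows "esinh (b - c) * esinh (a - d) \<le> esinh (a - c) * esinh (b - d)"
proof -
  define A B C D where "A = exp (2 * a)" and "B = exp (2 * b)" and "C = exp (2 * c)" and "D = exp (2 * d)"
  have pos: "0 < A" "0 < B" "0 < C" "0 < D" by (simp_all add: A_def B_def C_def D_def)
  have le: "D \<le> C" "C \<le> B" "B \<le> A" using assms by (simp_all add: A_def B_def C_def D_def)
  have e: "esinh (b - c) = (B - C) / (2 * B)" "esinh (a - d) = (A - D) / (2 * A)" "esinh (a - c) = (A - C) / (2 * A)"
     "esinh (b - d) = (B - D) / (2 * B)"
    using pos by (simp_all add: esinh_def A_def B_def C_def D_def field_simps exp_diff)
  have "(A - C) * (B - D) - (B - C) * (A - D) = (A - B) * (C - D)" by (simp add: algebra_simps)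
  moreover have "(A - B) * (C - D) \<ge> 0" using le by simp
  ultimately have "(B - C) * (A - D) \<le> (A - C) * (B - D)" by linarith
  then have "(B - C) * (A - D) / (4 * A * B) \<le> (A - C) * (B - D) / (4 * A * B)"
    using pos by (intro divide_right_mono) auto
  then show ?thesis unfolding e by (simp add: mult_ac)
qed

text \<open>Like \<open>t powr k\<close> near 0 and like \<open>t\<close> at infinity, with the
  transition at \<open>t = 1\<close>. This is the growth of the primitive of
  \<open>(u / (1 + u)) powr (k - 1)\<close> that vanishes at 0.\<close>

definition psi :: "real \<Rightarrow> real \<Rightarrow> real" where
  "psi k t = t powr k * (1 + t) powr (1 - k)"

lemma psi_nonneg: "0 \<le> psi k t" by (simp add: psi_def)

lemma psi_pos: "0 < t \<Longrightarrow> 0 < psi k t" by (simp add: psi_def)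

lemma psi_eq: "0 < t \<Longrightarrow> psi k t = t * (t / (1 + t)) powr (k - 1)"
  by (simp add: psi_def powr_divide powr_diff)

text \<open>The logarithmic slope of \<open>psi k\<close> at \<open>t\<close> is
  \<open>k + (1 - k) * t / (1 + t)\<close>, which lies between \<open>min 1 k\<close> and
  \<open>max 1 k\<close>. The exponent \<open>1 + k\<close> bounds the latter without a case
  distinction; \<open>psi_shrink\<close> uses the former.\<close>

lemma psi_scale:
  assumes "k > 0" "0 \<le> t" "1 \<le> c" shows "psi k (c * t) \<le> c powr (1 + k) * psi k t"
proof (cases "k \<le> 1")
  case True
  have "(1 + c * t) powr (1 - k) \<le> (c * (1 + t)) powr (1 - k)"
    using True assms by (intro powr_mono2) (auto simp: algebra_simps)
  also have "\<dots> \<le> c powr (1 - k) * (1 + t) powr (1 - k)" using assms by (simp add: powr_mult)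
  also have "\<dots> \<le> c powr 1 * (1 + t) powr (1 - k)"
    using assms by (intro mult_right_mono powr_mono) auto
  finally have "psi k (c * t) \<le> (c powr k * t powr k) * (c powr 1 * (1 + t) powr (1 - k))"
    unfolding psi_def using assms by (simp add: powr_mult mult_left_mono)
  also have "\<dots> = c powr (1 + k) * psi k t" using assms by (simp add: psi_def powr_add)
  finally show ?thesis .
next
  case False
  have "1 * t \<le> c * t" using assms by (intro mult_right_mono) auto
  then have "(1 + c * t) powr (1 - k) \<le> (1 + t) powr (1 - k)"
    using False assms by (intro powr_mono2') auto
  then have "psi k (c * t) \<le> (c powr k * t powr k) * (1 + t) powr (1 - k)"
    unfolding psi_def using assms by (simp add: powr_mult mult_left_mono)
  also have "\<dots> = c powr k * psi k t" by (simp add: psi_def)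
  also have "\<dots> \<le> c powr (1 + k) * psi k t"
    using assms by (intro mult_right_mono powr_mono psi_nonneg) auto
  finally show ?thesis .
qed

lemma psi_shrink:
  assumes "k > 0" "0 \<le> t" "0 < c" "c \<le> 1" shows "psi k (c * t) \<le> c powr (min 1 k) * psi k t"
proof (cases "k \<le> 1")
  case True
  have "(1 + c * t) powr (1 - k) \<le> (1 + t) powr (1 - k)"
    using True assms by (intro powr_mono2) (auto simp: mult_left_le_one_le)
  then have "psi k (c * t) \<le> (c powr k * t powr k) * (1 + t) powr (1 - k)"
    unfolding psi_def using assms by (simp add: powr_mult mult_left_mono)
  then show ?thesis using True by (simp add: psi_def)
next
  case False
  have "(1 + c * t) powr (1 - k) \<le> (c * (1 + t)) powr (1 - k)"
    using False assms by (intro powr_mono2') (auto simp: algebra_simps intro!: add_pos_nonneg)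
  also have "\<dots> = c powr (1 - k) * (1 + t) powr (1 - k)" using assms by (simp add: powr_mult)
  finally have "psi k (c * t) \<le> (c powr k * t powr k) * (c powr (1 - k) * (1 + t) powr (1 - k))"
    unfolding psi_def using assms by (simp add: powr_mult mult_left_mono)
  also have "\<dots> = (c powr k * c powr (1 - k)) * psi k t" by (simp add: psi_def)
  also have "c powr k * c powr (1 - k) = c powr 1" by (simp flip: powr_add)
  finally show ?thesis using False by simp
qed

lemma psi_mono:
  assumes "k > 0" "0 \<le> s" "s \<le> t" shows "psi k s \<le> psi k t"
proof (cases "s = 0")
  case True then show ?thesis using assms by (simp add: psi_def)
next
  case False
  with assms have t: "0 < t" "0 < s" by auto
  have "psi k s = psi k ((s / t) * t)" using t by simp
  also have "\<dots> \<le> (s / t) powr (min 1 k) * psi k t"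
    using assms t by (intro psi_shrink) auto
  also have "\<dots> \<le> 1 * psi k t"
    using assms t by (intro mult_right_mono psi_nonneg powr_le1) auto
  finally show ?thesis by simp
qed

lemma psi_le_scale:
  assumes "k > 0" "0 \<le> s" "0 \<le> t" "1 \<le> c" "s \<le> c * t" shows "psi k s \<le> c powr (1 + k) * psi k t"
proof -
  have "psi k s \<le> psi k (c * t)" using assms by (intro psi_mono) auto
  also have "\<dots> \<le> c powr (1 + k) * psi k t" using assms by (intro psi_scale)
  finally show ?thesis .
qed

text \<open>\<open>1 / damp l x = l + 1 / x\<close>, so this is comparable to the minimum of \<open>1 / l\<close> and \<open>x\<close>.\<close>

definition damp :: "real \<Rightarrow> real \<Rightarrow> real" where "damp l x = x / (1 + l * x)"

lemma damp_nonneg: "0 \<le> l \<Longrightarrow> 0 \<le> x \<Longrightarrow> 0 \<le> damp l x"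
  and damp_pos: "0 \<le> l \<Longrightarrow> 0 < x \<Longrightarrow> 0 < damp l x"
  by (simp_all add: damp_def add_pos_nonneg)

lemma inverse_damp: "0 \<le> l \<Longrightarrow> 0 < x \<Longrightarrow> inverse (damp l x) = l + inverse x"
  by (simp add: damp_def field_simps)

lemma damp_le_iff:
  assumes "0 \<le> l" "0 < x" "0 \<le> l'" "0 < x'" "0 < c"
  shows "damp l x \<le> c * damp l' x' \<longleftrightarrow> l' + inverse x' \<le> c * (l + inverse x)"
proof -
  have p: "0 < damp l x" "0 < damp l' x'" using assms by (auto intro: damp_pos)
  have "damp l x \<le> c * damp l' x' \<longleftrightarrow> inverse (damp l' x') \<le> c * inverse (damp l x)"
    using p assms by (simp add: field_simps)
  then show ?thesis using assms by (simp add: inverse_damp)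
qed

lemma damp_mono: "0 \<le> l \<Longrightarrow> 0 \<le> x \<Longrightarrow> x \<le> y \<Longrightarrow> damp l x \<le> damp l y"
  by (cases "x = 0") (use damp_le_iff[of l x l y 1] in \<open>auto simp: damp_def le_imp_inverse_le\<close>)

lemma damp_scale: "0 \<le> l \<Longrightarrow> 0 \<le> x \<Longrightarrow> 1 \<le> c \<Longrightarrow> damp l (c * x) \<le> c * damp l x"
proof (cases "x = 0")
  case False
  assume a: "0 \<le> l" "0 \<le> x" "1 \<le> c"
  then have "1 * l \<le> c * l" by (intro mult_right_mono) auto
  moreover have "c * inverse (c * x) = inverse x" using a by (simp add: field_simps)
  ultimately have "l + inverse x \<le> c * (l + inverse (c * x))"
    unfolding distrib_left by linarith
  then show ?thesis using a False by (subst damp_le_iff) auto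
qed (simp add: damp_def)

lemma damp_le_arg: "0 \<le> l \<Longrightarrow> 0 \<le> x \<Longrightarrow> damp l x \<le> x"
  by (simp add: damp_def field_simps add_pos_nonneg)

lemma damp_mult_le_1: "0 \<le> l \<Longrightarrow> 0 \<le> x \<Longrightarrow> l * damp l x \<le> 1"
  by (simp add: damp_def field_simps add_pos_nonneg)

text \<open>In the application \<open>L = \<lambda>\<^sub>i - \<lambda>\<^sub>n\<^sub>+\<^sub>1\<close>, \<open>L' = \<lambda>\<^sub>j - \<lambda>\<^sub>n\<^sub>+\<^sub>1\<close>, \<open>x = x\<^sub>i - x\<^sub>j\<close> and \<open>g = x\<^sub>j - x\<^sub>j\<^sub>+\<^sub>1\<close>:
  the quotient of the terms with \<open>L\<close> then telescopes in \<open>j\<close>.\<close>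

lemma damp_psi_compare:
  assumes k: "k > 0" and L': "0 \<le> L'" "L' \<le> L" and x: "0 < x" and g: "0 < g"
  defines "m \<equiv> damp L' g" and "l \<equiv> L - L'" and "c \<equiv> (4::real) powr (2 * (1 + k))"
  shows "psi k (damp l (x + m)) * psi k (damp L x) \<le> c * (psi k (damp L (x + g)) * psi k (damp l x))"
    and "psi k (damp L (x + g)) * psi k (damp l x) \<le> c * (psi k (damp l (x + m)) * psi k (damp L x))"
proof -
  have l: "0 \<le> l" "0 \<le> L" using L' by (auto simp: l_def)
  have m: "0 < m" using L' g by (auto simp: m_def intro: damp_pos)
  have im: "inverse m = L' + inverse g" using L' g by (simp add: m_def inverse_damp)
  \<comment> \<open>The four arguments may be matched in either order; each matched pair costs a
    factor \<open>4 powr (1 + k)\<close>, and \<open>c\<close> is the product of two of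
    these.\<close>
  have comb: "psi k p * psi k q \<le> c * (psi k r * psi k s)"
    if "0 \<le> p" "0 \<le> q" "0 \<le> r" "0 \<le> s" "p \<le> 4 * r \<and> q \<le> 4 * s \<or> p \<le> 4 * s \<and> q \<le> 4 * r" for p q r s
  proof -
    have *: "psi k p * psi k q \<le> c * (psi k r * psi k s)" if "0 \<le> p" "0 \<le> q" "0 \<le> r" "0 \<le> s"
       "p \<le> 4 * r" "q \<le> 4 * s" for p q r s
    proof -
      have "psi k p * psi k q \<le> (4 powr (1 + k) * psi k r) * (4 powr (1 + k) * psi k s)"
        using that k by (intro mult_mono psi_le_scale mult_nonneg_nonneg psi_nonneg) auto
      also have "\<dots> = (4 powr (1 + k) * 4 powr (1 + k)) * (psi k r * psi k s)" by simp
      also have "4 powr (1 + k) * 4 powr (1 + k) = c"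
        by (simp add: c_def flip: powr_add)
      finally show ?thesis .
    qed
    show ?thesis using that *[of p q r s] *[of p q s r] by (auto simp: mult_ac)
  qed
  \<comment> \<open>In reciprocals this is \<open>damp L' (x + g) \<le> x + m\<close>, that is,
    subadditivity of \<open>damp L'\<close> with its value at \<open>x\<close> replaced by
    \<open>x\<close>.\<close>
  have sub: "damp L (x + g) \<le> damp l (x + m)"
  proof -
    have "damp L' (x + g) \<le> x + m"
    proof -
      have "damp L' (x + g) = x / (1 + L' * (x + g)) + g / (1 + L' * (x + g))" by (simp add: damp_def add_divide_distrib)
      also have "\<dots> \<le> x / 1 + g / (1 + L' * g)"
        using x g L' by (intro add_mono divide_left_mono) (auto simp: add_pos_nonneg intro!: mult_left_mono)
      finally show ?thesis by (simp add: m_def damp_def)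
    qed
    moreover have "0 < damp L' (x + g)" using L' x g by (auto intro: damp_pos)
    ultimately have "inverse (x + m) \<le> inverse (damp L' (x + g))" by (simp add: le_imp_inverse_le)
    also have "\<dots> = L' + inverse (x + g)" using L' x g by (simp add: inverse_damp)
    finally have "l + inverse (x + m) \<le> L + inverse (x + g)" by (simp add: l_def)
    then show ?thesis using damp_le_iff[of L "x + g" l "x + m" 1] l x g m by simp
  qed
  have nn: "0 \<le> damp l (x + m)" "0 \<le> damp L x" "0 \<le> damp L (x + g)" "0 \<le> damp l x"
    using l x g m by (auto intro!: damp_nonneg)
  have lL: "damp L x \<le> damp l x"
    using damp_le_iff[of L x l x 1] l x L' by (simp add: l_def)
  have mono: "damp l x \<le> damp l (x + m)" "damp L x \<le> damp L (x + g)" using l x g m by (auto intro!: damp_mono)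
  \<comment> \<open>If \<open>L'\<close> is at most half of \<open>L\<close>, then \<open>l\<close>
    is comparable to \<open>L\<close> and the straight matching works. If \<open>m \<le> x\<close>,
    the shift by \<open>m\<close> is negligible and so is the one by \<open>g\<close>, because
    either \<open>g \<le> x\<close> or \<open>L\<close> already caps the length; this is the crossed
    matching. If \<open>x < m\<close>, then \<open>x\<close> is too short to be damped by
    \<open>L'\<close>, and \<open>x + m\<close> is comparable to \<open>m\<close>, whose reciprocal
    is \<open>L' + inverse g\<close>.\<close>
  consider "L' \<le> L / 2" | "L / 2 < L'" "m \<le> x" | "L / 2 < L'" "x < m" by linarith
  then have *: "(damp l (x + m) \<le> 4 * damp L (x + g) \<and> damp l x \<le> 4 * damp L x) \<or>
      (damp L (x + g) \<le> 4 * damp L x \<and> damp l (x + m) \<le> 4 * damp l x)"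
  proof cases
    case 1
    then have lL: "L \<le> 2 * l" by (simp add: l_def)
    have "L + inverse x \<le> 4 * (l + inverse x)"
      using lL l positive_imp_inverse_positive[OF x] by argo
    then have "damp l x \<le> 4 * damp L x" using l x by (subst damp_le_iff) auto
    moreover have "damp l (x + m) \<le> 4 * damp L (x + g)"
    proof (subst damp_le_iff)
      have "m \<le> g" using damp_le_arg[of L' g] L' g by (simp add: m_def)
      then have "inverse (x + g) \<le> inverse (x + m)" using x m by (simp add: le_imp_inverse_le)
      moreover have "0 \<le> inverse (x + m)" using x m by simp
      ultimately have "inverse (x + g) \<le> 4 * inverse (x + m)" by linarith
      then show "L + inverse (x + g) \<le> 4 * (l + inverse (x + m))" using lL l by (simp add: algebra_simps)
    qed (use l x g m in auto)
    ultimately show ?thesis by simp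
  next
    case 2
    have "damp l (x + m) \<le> damp l (2 * x)" using 2 x m l by (intro damp_mono) auto
    also have "\<dots> \<le> 2 * damp l x" using l x by (intro damp_scale) auto
    finally have "damp l (x + m) \<le> 4 * damp l x" using nn by simp
    moreover have "damp L (x + g) \<le> 4 * damp L x"
    proof (subst damp_le_iff)
      have "inverse x \<le> 2 * L + 4 * inverse (x + g)"
      proof (cases "g \<le> x")
        case True
        then have "inverse x \<le> 2 * inverse (x + g)" using x g by (simp add: field_simps)
        moreover have "0 \<le> inverse (x + g)" using x g by simp
        ultimately show ?thesis using l by linarith
      next
        case False
        have "inverse x \<le> inverse m" using 2 m by (simp add: le_imp_inverse_le)
        also have "\<dots> \<le> L + inverse g" using im L' by simp
        also have "inverse g \<le> 2 * inverse (x + g)" using False x g by (simp add: field_simps)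
        moreover have "0 \<le> inverse (x + g)" using x g by simp
        ultimately show ?thesis using l by linarith
      qed
      then show "L + inverse x \<le> 4 * (L + inverse (x + g))" using l by (simp add: algebra_simps)
    qed (use l x g m in auto)
    ultimately show ?thesis by simp
  next
    case 3
    have "L' * m \<le> 1" using damp_mult_le_1[of L' g] L' g by (simp add: m_def)
    have ix: "inverse m \<le> inverse x" using 3 x m by (simp add: le_imp_inverse_le)
    have L'm: "L' \<le> inverse m" using im g by simp
    have "damp l x \<le> 4 * damp L x"
    proof (subst damp_le_iff)
      show "L + inverse x \<le> 4 * (l + inverse x)"
        using L'm ix 3 l by (simp add: algebra_simps)
    qed (use l x g m in auto)
    moreover have "damp l (x + m) \<le> 4 * damp L (x + g)"
    proof (subst damp_le_iff)
      have "inverse (2 * m) \<le> inverse (x + m)" using 3 x m by (intro le_imp_inverse_le) auto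
      then have "inverse m \<le> 2 * inverse (x + m)" by simp
      moreover have "inverse (x + g) \<le> inverse g" using x g by (intro le_imp_inverse_le) auto
      moreover have "L \<le> 2 * L'" using 3 by simp
      moreover have "0 \<le> inverse g" using g by simp
      ultimately show "L + inverse (x + g) \<le> 4 * (l + inverse (x + m))"
        using im l L'm unfolding distrib_left by argo
    qed (use l x g m in auto)
    ultimately show ?thesis by simp
  qed
  show "psi k (damp l (x + m)) * psi k (damp L x) \<le> c * (psi k (damp L (x + g)) * psi k (damp l x))"
    using * lL nn mono by (intro comb) auto
  show "psi k (damp L (x + g)) * psi k (damp l x) \<le> c * (psi k (damp l (x + m)) * psi k (damp L x))"
    using * sub nn mono lL by (intro comb) auto
qed

definition root_factor :: "real \<Rightarrow> real \<Rightarrow> real \<Rightarrow> real" where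
  "root_factor k l x = (1 + x) / (1 + l * x) powr k * ((1 + l * (1 + x)) / (1 + l)) powr (k - 1)"

text \<open>With \<open>x / (1 + x)\<close> in place of \<open>esinh x\<close> the two sides differ
  exactly by \<open>(a / b) powr (k - 1)\<close>, and \<open>a / b\<close> lies between 1 and 2
  because \<open>a = b + l * x\<close> with \<open>l * x \<le> b\<close>. In \<open>c\<close>, the
  part \<open>2 powr k\<close> pays for the replacement and \<open>2 powr (1 + k)\<close> for this
  quotient.\<close>

lemma root_factor_esinh_psi:
  assumes k: "k > 0" and l: "0 \<le> l" and x: "0 < x"
  defines "c \<equiv> (2::real) powr (2 * k + 1)"
  shows "root_factor k l x * esinh x powr k \<le> c * psi k (damp l x)"
    and "psi k (damp l x) \<le> c * (root_factor k l x * esinh x powr k)"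
proof -
  define t where "t = x / (1 + x)"
  have t: "0 < t" using x by (simp add: t_def)
  have lx: "0 \<le> l * x" using l x by simp
  define a b where "a = (1 + l + l * x) * (1 + x + l * x)" and "b = (1 + x) * (1 + l * x) * (1 + l)"
  have b: "b > 0" unfolding b_def using l x lx by (intro mult_pos_pos) linarith+
  have ab: "a = b + l * x" by (simp add: a_def b_def algebra_simps)
  have "l * x \<le> b"
  proof -
    have "b = l * x + (1 + x + l + l * x + l * x\<^sup>2 + l\<^sup>2 * x + l\<^sup>2 * x\<^sup>2)" by (simp add: b_def algebra_simps power2_eq_square)
    moreover have "0 \<le> 1 + x + l + l * x + l * x\<^sup>2 + l\<^sup>2 * x + l\<^sup>2 * x\<^sup>2" using l x lx by simp
    ultimately show ?thesis by linarith
  qed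
  then have r: "b \<le> 2 * a" "a \<le> 2 * b" "a > 0" using ab b lx by auto
  have p: "0 < 1 + l" "0 < 1 + x" "0 < 1 + l * x" "0 < 1 + x + l * x" "0 < 1 + l + l * x"
    using l x lx by linarith+
  have psi: "psi k (damp l x) = x powr k * (1 + x + l * x) powr (1 - k) / (1 + l * x)"
  proof -
    have "1 + damp l x = (1 + x + l * x) / (1 + l * x)" using p by (simp add: damp_def field_simps)
    then show ?thesis using p x unfolding psi_def
      by (simp add: damp_def powr_divide powr_diff)
  qed
  have "root_factor k l x * t powr k = x powr k * (1 + x) powr (1 - k) / (1 + l * x) powr k * ((1 + l + l * x) / (1 + l)) powr (k - 1)"
  proof -
    have e: "1 + l * (1 + x) = 1 + l + l * x" by (simp add: algebra_simps)
    define d where "d = ((1 + l + l * x) / (1 + l)) powr (k - 1)"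
    show ?thesis unfolding root_factor_def e d_def[symmetric]
      using p x by (simp add: t_def powr_divide powr_diff mult_ac)
  qed
  also have "\<dots> = psi k (damp l x) * (a / b) powr (k - 1)"
    using p x by (simp add: psi a_def b_def powr_mult powr_divide powr_diff mult_ac)
  finally have root_factor: "root_factor k l x * t powr k = psi k (damp l x) * (a / b) powr (k - 1)" .
  have FFn: "0 \<le> root_factor k l x" using p by (simp add: root_factor_def)
  have pn: "0 \<le> psi k (damp l x)" by (rule psi_nonneg)
  have k1: "(2::real) powr \<bar>k - 1\<bar> \<le> 2 powr (1 + k)" using k by (intro powr_mono) auto
  have "(a / b) powr (k - 1) \<le> 2 powr \<bar>k - 1\<bar> * 1 powr (k - 1)"
    using r b by (intro powr_ratio_le) (auto simp: field_simps)
  then have u: "(a / b) powr (k - 1) \<le> 2 powr (1 + k)" using k1 by (simp only: powr_one_eq_one mult_1_right)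
  have "1 powr (k - 1) \<le> 2 powr \<bar>k - 1\<bar> * (a / b) powr (k - 1)"
    using r b by (intro powr_ratio_le) (auto simp: field_simps)
  also have "\<dots> \<le> 2 powr (1 + k) * (a / b) powr (k - 1)" using k1 by (intro mult_right_mono) auto
  finally have v: "1 \<le> 2 powr (1 + k) * (a / b) powr (k - 1)" by simp
  have st: "esinh x powr k \<le> 2 powr k * t powr k" "t powr k \<le> 2 powr k * esinh x powr k"
    using powr_ratio_le[of "esinh x" t 2 k] powr_ratio_le[of t "esinh x" 2 k] esinh_le[of x] esinh_ge[of x] t x esinh_pos[of x] k
    by (auto simp: t_def)
  have c: "c = 2 powr k * 2 powr (1 + k)" by (simp add: c_def algebra_simps flip: powr_add)
  have "root_factor k l x * esinh x powr k \<le> root_factor k l x * (2 powr k * t powr k)"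
    using st FFn by (intro mult_left_mono)
  also have "\<dots> = 2 powr k * (psi k (damp l x) * (a / b) powr (k - 1))" using root_factor by simp
  also have "\<dots> \<le> 2 powr k * (psi k (damp l x) * 2 powr (1 + k))"
    using u pn by (intro mult_left_mono) auto
  finally show "root_factor k l x * esinh x powr k \<le> c * psi k (damp l x)" by (simp add: c mult_ac)
  have "psi k (damp l x) * 1 \<le> psi k (damp l x) * (2 powr (1 + k) * (a / b) powr (k - 1))"
    using v pn by (intro mult_left_mono)
  also have "\<dots> = 2 powr (1 + k) * (root_factor k l x * t powr k)" using root_factor by simp
  also have "\<dots> \<le> 2 powr (1 + k) * (root_factor k l x * (2 powr k * esinh x powr k))"
    using st FFn by (intro mult_left_mono) auto
  finally show "psi k (damp l x) \<le> c * (root_factor k l x * esinh x powr k)" by (simp add: c mult_ac)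
qed

section \<open>The kernel of the recursion\<close>

lemma pos_roots_Suc: "pos_roots (Suc n) = pos_roots n \<union> (\<lambda>i. (i, Suc n)) ` {1..n}"
  unfolding pos_roots_def by (auto simp: less_Suc_eq_le le_Suc_eq image_iff)

lemma pos_roots_0 [simp]: "pos_roots 0 = {}" and pos_roots_1 [simp]: "pos_roots (Suc 0) = {}"
  by (auto simp: pos_roots_def)

lemma finite_pos_roots [simp]: "finite (pos_roots n)"
  by (induction n) (auto simp: pos_roots_Suc)

lemma sum_pos_roots_Suc:
  "(\<Sum>\<alpha>\<in>pos_roots (Suc n). f \<alpha>) = (\<Sum>\<alpha>\<in>pos_roots n. f \<alpha>) + (\<Sum>i=1..n. f (i, Suc n))"
proof -
  have "pos_roots n \<inter> (\<lambda>i. (i, Suc n)) ` {1..n} = {}" by (auto simp: pos_roots_def)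
  then show ?thesis
    unfolding pos_roots_Suc by (simp add: sum.union_disjoint sum.reindex inj_on_def)
qed

lemma prod_pos_roots_Suc:
  "(\<Prod>\<alpha>\<in>pos_roots (Suc n). f \<alpha>) = (\<Prod>\<alpha>\<in>pos_roots n. f \<alpha>) * (\<Prod>i=1..n. f (i, Suc n))"
proof -
  have "pos_roots n \<inter> (\<lambda>i. (i, Suc n)) ` {1..n} = {}" by (auto simp: pos_roots_def)
  then show ?thesis
    unfolding pos_roots_Suc by (simp add: prod.union_disjoint prod.reindex inj_on_def)
qed

text \<open>Splits off the simple roots and writes the others as column shifts
  \<open>(i, j + 1)\<close> of the roots of the next smaller rank. Both the lower Ptolemy bound and
  the telescoping rest on comparing this with \<open>prod_pos_roots_Suc\<close>.\<close>

lemma prod_pos_roots_shift: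
  "(\<Prod>\<alpha>\<in>pos_roots (Suc n). f \<alpha>) = (\<Prod>i=1..n. f (i, Suc i)) * (\<Prod>\<alpha>\<in>pos_roots n. f (fst \<alpha>, Suc (snd \<alpha>)))"
proof (induction n)
  case (Suc n)
  then show ?case
    by (simp add: prod_pos_roots_Suc[of _ "Suc n"] prod_pos_roots_Suc[of "\<lambda>\<alpha>. f (fst \<alpha>, Suc (snd \<alpha>))" n] mult_ac)
qed simp

lemma prod_pos_roots_col: "(\<Prod>\<alpha>\<in>pos_roots n. f \<alpha>) = (\<Prod>j=1..n. \<Prod>i\<in>{1..<j}. f (i, j))"
  by (induction n) (simp_all add: prod_pos_roots_Suc atLeastLessThanSuc_atLeastAtMost)

lemma prod_pos_roots_row: "(\<Prod>\<alpha>\<in>pos_roots n. f \<alpha>) = (\<Prod>i=1..n. \<Prod>j=i+1..n. f (i, j))"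
proof (induction n)
  case (Suc n)
  have "(\<Prod>i=1..n. \<Prod>j=i+1..Suc n. f (i, j)) = (\<Prod>i=1..n. (\<Prod>j=i+1..n. f (i, j)) * f (i, Suc n))"
    by (intro prod.cong refl) (simp add: prod.cl_ivl_Suc)
  then show ?case by (simp add: prod_pos_roots_Suc Suc prod.distrib)
qed simp

definition esinh_prod :: "nat \<Rightarrow> (nat \<Rightarrow> real) \<Rightarrow> real" where
  "esinh_prod N X = (\<Prod>\<alpha>\<in>pos_roots N. esinh (root_val \<alpha> X))"

text \<open>The bracket of \<open>kernel_S\<close> with \<open>esinh\<close> for
  \<open>sinh\<close>, sorted by the position of the node: \<open>s = r\<close>,
  \<open>s < r\<close> and \<open>s > r\<close>. The last family runs over
  \<open>pos_roots (Suc n)\<close> because the node index reaches \<open>n + 1\<close>.\<close>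

definition esinh_bracket :: "nat \<Rightarrow> (nat \<Rightarrow> real) \<Rightarrow> (nat \<Rightarrow> real) \<Rightarrow> real" where
  "esinh_bracket n X Y = (\<Prod>r=1..n. esinh (X r - Y r)) * (\<Prod>\<alpha>\<in>pos_roots n. esinh (X (fst \<alpha>) - Y (snd \<alpha>))) *
     (\<Prod>\<alpha>\<in>pos_roots (Suc n). esinh (Y (fst \<alpha>) - X (snd \<alpha>)))"

lemma bracket_decomp:
  fixes g :: "real \<Rightarrow> real \<Rightarrow> real"
  shows "(\<Prod>r=1..n. (\<Prod>s=1..r. g (X s) (Y r)) * (\<Prod>s=r+1..n+1. g (Y r) (X s))) =
    (\<Prod>r=1..n. g (X r) (Y r)) * (\<Prod>\<alpha>\<in>pos_roots n. g (X (fst \<alpha>)) (Y (snd \<alpha>))) *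
     (\<Prod>\<alpha>\<in>pos_roots (Suc n). g (Y (fst \<alpha>)) (X (snd \<alpha>)))"
proof -
  have "(\<Prod>r=1..n. (\<Prod>s=1..r. g (X s) (Y r)) * (\<Prod>s=r+1..n+1. g (Y r) (X s))) =
     (\<Prod>r=1..n. g (X r) (Y r) * (\<Prod>s\<in>{1..<r}. g (X s) (Y r)) * (\<Prod>s=r+1..n+1. g (Y r) (X s)))"
  proof (intro prod.cong refl)
    fix r assume "r \<in> {1..n}"
    then have "{1..r} = insert r {1..<r}" by auto
    then show "(\<Prod>s=1..r. g (X s) (Y r)) * (\<Prod>s=r+1..n+1. g (Y r) (X s)) =
      g (X r) (Y r) * (\<Prod>s\<in>{1..<r}. g (X s) (Y r)) * (\<Prod>s=r+1..n+1. g (Y r) (X s))"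
      by simp
  qed
  then show ?thesis
    unfolding prod_pos_roots_col[of _ n] prod_pos_roots_row[of _ "Suc n"] by (simp add: prod.distrib)
qed

lemma interlacingD:
  assumes "X \<in> chamber (Suc n)" "Y \<in> interlacing n X"
  shows "\<And>r. 1 \<le> r \<Longrightarrow> r \<le> n \<Longrightarrow> X (Suc r) \<le> Y r \<and> Y r \<le> X r"
    and "\<And>i j. 1 \<le> i \<Longrightarrow> i \<le> j \<Longrightarrow> j \<le> n \<Longrightarrow> Y j \<le> X i"
    and "\<And>i j. 1 \<le> i \<Longrightarrow> i < j \<Longrightarrow> j \<le> Suc n \<Longrightarrow> X j \<le> Y i"
    and "\<And>i j. 1 \<le> i \<Longrightarrow> i < j \<Longrightarrow> j \<le> n \<Longrightarrow> Y j \<le> Y i"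
proof -
  have X: "X j \<le> X i" if "1 \<le> i" "i \<le> j" "j \<le> Suc n" for i j
    using assms(1) that by (cases "i = j") (auto simp: chamber_def le_less intro: less_imp_le)
  show 1: "X (Suc r) \<le> Y r \<and> Y r \<le> X r" if "1 \<le> r" "r \<le> n" for r
    using assms(2) that by (auto simp: interlacing_def PiE_def Pi_def)
  show 2: "Y j \<le> X i" if "1 \<le> i" "i \<le> j" "j \<le> n" for i j
    using 1[of j] X[of i j] that by auto
  show 3: "X j \<le> Y i" if "1 \<le> i" "i < j" "j \<le> Suc n" for i j
    using 1[of i] X[of "Suc i" j] that by auto
  show "Y j \<le> Y i" if "1 \<le> i" "i < j" "j \<le> n" for i j
    using 2[of j j] 3[of i j] that by auto
qed

lemma chamber_pos: "X \<in> chamber N \<Longrightarrow> \<alpha> \<in> pos_roots N \<Longrightarrow> 0 < root_val \<alpha> X"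
  by (auto simp: chamber_def pos_roots_def root_val_def)

lemma closure_chamber_nonneg: "X \<in> closure (chamber N) \<Longrightarrow> \<alpha> \<in> pos_roots N \<Longrightarrow> 0 \<le> root_val \<alpha> X"
  unfolding closure_chamber by (auto simp: pos_roots_def root_val_def)

lemma esinh_prod_pos: "X \<in> chamber N \<Longrightarrow> 0 < esinh_prod N X"
  unfolding esinh_prod_def by (intro prod_pos) (auto intro: esinh_pos chamber_pos)

lemma interlacing_closure_chamber:
  "X \<in> chamber (Suc n) \<Longrightarrow> Y \<in> interlacing n X \<Longrightarrow> Y \<in> closure (chamber n)"
  unfolding closure_chamber using interlacingD(4) by auto

lemma dprod_eq: "dprod N X = exp (\<Sum>\<alpha>\<in>pos_roots N. root_val \<alpha> X) * esinh_prod N X"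
  by (simp add: dprod_def esinh_prod_def sinh_eq_exp_esinh prod.distrib exp_sum)

text \<open>The left side is the exponent which \<open>sinh t = exp t * esinh t\<close> extracts
  from the bracket. The families \<open>s < r\<close> and \<open>s > r\<close> combine pair by pair
  into a root of \<open>X\<close> plus a root of \<open>Y\<close>, so the exponent
  separates.\<close>

lemma kernel_exponent:
  "(\<Sum>r=1..n. X r - Y r) + (\<Sum>\<alpha>\<in>pos_roots n. X (fst \<alpha>) - Y (snd \<alpha>)) +
     (\<Sum>\<alpha>\<in>pos_roots (Suc n). Y (fst \<alpha>) - X (snd \<alpha>)) =
   (\<Sum>\<alpha>\<in>pos_roots (Suc n). root_val \<alpha> X) + (\<Sum>\<alpha>\<in>pos_roots n. root_val \<alpha> (Y::nat \<Rightarrow> real))"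
proof -
  have "(\<Sum>\<alpha>\<in>pos_roots n. X (fst \<alpha>) - Y (snd \<alpha>)) + (\<Sum>\<alpha>\<in>pos_roots n. Y (fst \<alpha>) - X (snd \<alpha>)) =
     (\<Sum>\<alpha>\<in>pos_roots n. root_val \<alpha> X) + (\<Sum>\<alpha>\<in>pos_roots n. root_val \<alpha> Y)"
    unfolding sum.distrib[symmetric] by (intro sum.cong) (auto simp: root_val_def)
  moreover have "(\<Sum>r=1..n. X r - Y r) + (\<Sum>i=1..n. Y i - X (Suc n)) = (\<Sum>i=1..n. root_val (i, Suc n) X)"
    unfolding sum.distrib[symmetric] by (intro sum.cong) (auto simp: root_val_def)
  ultimately show ?thesis by (simp add: sum_pos_roots_Suc)
qed

lemma esinh_bracket_nonneg:
  assumes "X \<in> chamber (Suc n)" "Y \<in> interlacing n X"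
  shows "0 \<le> esinh_bracket n X Y" "0 \<le> esinh_prod n Y"
  using interlacingD[OF assms] unfolding esinh_bracket_def esinh_prod_def
  by (auto intro!: mult_nonneg_nonneg prod_nonneg esinh_nonneg simp: pos_roots_def root_val_def)

text \<open>The root sums of \<open>X\<close> collect the coefficient
  \<open>(1 - 2 * k) + (k - 1) = - k\<close>, those of \<open>Y\<close> the coefficient
  \<open>1 + (k - 1) = k\<close>. This is how the two \<open>rho\<close> terms arise.\<close>

lemma kernel_eq:
  assumes X: "X \<in> chamber (Suc n)" and Y: "Y \<in> interlacing n X" and k: "k > 0"
  shows "kernel_S k n Y X * dprod n Y powr (2 * k) =
    exp (rho k n Y - rho k (Suc n) X) * esinh_prod (Suc n) X powr (1 - 2 * k) * esinh_prod n Y * esinh_bracket n X Y powr (k - 1)"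
\<comment> \<open>If coordinates of \<open>Y\<close> coincide, \<open>0 powr e = 0\<close> makes
  both sides vanish. Only otherwise may the exponents \<open>1 - 2 * k\<close> and
  \<open>2 * k\<close> be added to 1.\<close>
proof (cases "esinh_prod n Y = 0")
  case True
  then show ?thesis by (simp add: dprod_eq)
next
  case False
  with esinh_bracket_nonneg[OF X Y] have sY: "0 < esinh_prod n Y" by simp
  have sX: "0 < esinh_prod (Suc n) X" using X by (rule esinh_prod_pos)
  define DX DY where "DX = (\<Sum>\<alpha>\<in>pos_roots (Suc n). root_val \<alpha> X)" and "DY = (\<Sum>\<alpha>\<in>pos_roots n. root_val \<alpha> Y)"
  have br: "(\<Prod>r=1..n. (\<Prod>s=1..r. sinh (X s - Y r)) * (\<Prod>s=r+1..n+1. sinh (Y r - X s))) = exp (DX + DY) * esinh_bracket n X Y"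
    unfolding bracket_decomp[of "\<lambda>a b. sinh (a - b)"] DX_def DY_def kernel_exponent[symmetric]
    unfolding exp_add exp_sum[OF finite_pos_roots]
      exp_sum[OF finite_atLeastAtMost] sinh_eq_exp_esinh prod.distrib esinh_bracket_def
    by (simp only: mult_ac)
  have "kernel_S k n Y X * dprod n Y powr (2 * k) =
     (exp DX * esinh_prod (Suc n) X) powr (1 - 2 * k) * ((exp DY * esinh_prod n Y) powr (1 - 2 * k) * (exp DY * esinh_prod n Y) powr (2 * k)) *
     (exp (DX + DY) * esinh_bracket n X Y) powr (k - 1)"
    unfolding kernel_S_def br by (simp add: dprod_eq DX_def DY_def)
  also have "(exp DY * esinh_prod n Y) powr (1 - 2 * k) * (exp DY * esinh_prod n Y) powr (2 * k) = exp DY * esinh_prod n Y"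
    using sY by (simp flip: powr_add)
  also have "(exp DX * esinh_prod (Suc n) X) powr (1 - 2 * k) * (exp DY * esinh_prod n Y) * (exp (DX + DY) * esinh_bracket n X Y) powr (k - 1) =
    (exp (DX * (1 - 2 * k)) * exp DY * exp ((DX + DY) * (k - 1))) * esinh_prod (Suc n) X powr (1 - 2 * k) * esinh_prod n Y * esinh_bracket n X Y powr (k - 1)"
    using esinh_bracket_nonneg[OF X Y] sX by (simp add: powr_mult exp_powr_real mult_ac)
  also have "exp (DX * (1 - 2 * k)) * exp DY * exp ((DX + DY) * (k - 1)) = exp (k * DY - k * DX)"
    unfolding exp_add[symmetric] by (rule arg_cong[where f = exp]) (simp add: algebra_simps)
  finally show ?thesis by (simp add: rho_def DX_def DY_def)
qed

text \<open>Membership in \<open>interlacing n X\<close> is retained because it fixes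
  \<open>Y\<close> to be \<open>undefined\<close> outside \<open>1..n\<close>.\<close>

definition open_box :: "nat \<Rightarrow> (nat \<Rightarrow> real) \<Rightarrow> (nat \<Rightarrow> real) set" where
  "open_box n X = {Y \<in> interlacing n X. \<forall>j\<in>{1..n}. X (Suc j) < Y j \<and> Y j < X j}"

lemma open_boxD:
  assumes "X \<in> chamber (Suc n)" "Y \<in> open_box n X"
  shows "\<And>i j. 1 \<le> i \<Longrightarrow> i \<le> j \<Longrightarrow> j \<le> n \<Longrightarrow> Y j < X i"
    and "\<And>i j. 1 \<le> i \<Longrightarrow> i < j \<Longrightarrow> j \<le> Suc n \<Longrightarrow> X j < Y i"
    and "\<And>i j. 1 \<le> i \<Longrightarrow> i < j \<Longrightarrow> j \<le> n \<Longrightarrow> Y j < Y i"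
proof -
  have X: "X j \<le> X i" if "1 \<le> i" "i \<le> j" "j \<le> Suc n" for i j
    using assms(1) that by (cases "i = j") (auto simp: chamber_def le_less intro: less_imp_le)
  have 1: "X (Suc r) < Y r \<and> Y r < X r" if "1 \<le> r" "r \<le> n" for r
    using assms(2) that by (auto simp: open_box_def)
  show 2: "Y j < X i" if "1 \<le> i" "i \<le> j" "j \<le> n" for i j
    using 1[of j] X[of i j] that by auto
  show 3: "X j < Y i" if "1 \<le> i" "i < j" "j \<le> Suc n" for i j
    using 1[of i] X[of "Suc i" j] that by auto
  show "Y j < Y i" if "1 \<le> i" "i < j" "j \<le> n" for i j
    using 2[of j j] 3[of i j] that by auto
qed

text \<open>Since \<open>0 powr (k - 1) = 0\<close> for every \<open>k\<close>, the integrand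
  vanishes on the boundary of the box even when \<open>k < 1\<close>; hence the pointwise estimates
  are needed on \<open>open_box\<close> only.\<close>

lemma esinh_bracket_eq_0:
  assumes "X \<in> chamber (Suc n)" "Y \<in> interlacing n X" "Y \<notin> open_box n X"
  shows "esinh_bracket n X Y = 0"
proof -
  obtain j where "j \<in> {1..n}" "\<not> (X (Suc j) < Y j \<and> Y j < X j)"
    using assms(2,3) unfolding open_box_def by blast
  then have j: "1 \<le> j" "j \<le> n" "Y j = X (Suc j) \<or> Y j = X j"
    using interlacingD(1)[OF assms(1,2), of j] by auto
  from j(3) show ?thesis
  proof
    assume "Y j = X j"
    then have "(\<Prod>r=1..n. esinh (X r - Y r)) = 0" using j by (intro prod_zero bexI[of _ j]) auto
    then show ?thesis by (simp add: esinh_bracket_def)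
  next
    assume "Y j = X (Suc j)"
    then have "(\<Prod>\<alpha>\<in>pos_roots (Suc n). esinh (Y (fst \<alpha>) - X (snd \<alpha>))) = 0" using j
      by (intro prod_zero bexI[of _ "(j, Suc j)"] finite_pos_roots) (auto simp: pos_roots_def)
    then show ?thesis by (simp add: esinh_bracket_def)
  qed
qed

text \<open>For \<open>i < j\<close>, Ptolemy for \<open>Y j \<le> X j \<le> Y i \<le> X i\<close>
  bounds the two cross differences by the product of the root of \<open>Y\<close> and the root of
  \<open>X\<close>. The column \<open>n + 1\<close> has no partner in \<open>Y\<close>; there
  \<open>Y i \<le> X i\<close> is enough.\<close>

lemma esinh_bracket_upper:
  assumes X: "X \<in> chamber (Suc n)" and Y: "Y \<in> interlacing n X"
  shows "esinh_bracket n X Y \<le> (\<Prod>r=1..n. esinh (X r - Y r)) * (esinh_prod n Y * esinh_prod (Suc n) X)"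
proof -
  note D = interlacingD[OF assms]
  have E: "X j \<le> X i" if "1 \<le> i" "i < j" "j \<le> Suc n" for i j
    using X that by (auto simp: chamber_def intro: less_imp_le)
  have "esinh_bracket n X Y = (\<Prod>r=1..n. esinh (X r - Y r)) *
    ((\<Prod>\<alpha>\<in>pos_roots n. esinh (X (fst \<alpha>) - Y (snd \<alpha>)) * esinh (Y (fst \<alpha>) - X (snd \<alpha>))) * (\<Prod>i=1..n. esinh (Y i - X (Suc n))))"
    by (simp add: esinh_bracket_def prod_pos_roots_Suc prod.distrib mult_ac)
  also have "\<dots> \<le> (\<Prod>r=1..n. esinh (X r - Y r)) *
    ((\<Prod>\<alpha>\<in>pos_roots n. esinh (root_val \<alpha> Y) * esinh (root_val \<alpha> X)) * (\<Prod>i=1..n. esinh (X i - X (Suc n))))"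
  proof (intro mult_left_mono mult_mono prod_mono)
    fix \<alpha> assume "\<alpha> \<in> pos_roots n"
    then have r: "1 \<le> fst \<alpha>" "fst \<alpha> < snd \<alpha>" "snd \<alpha> \<le> n" by (auto simp: pos_roots_def)
    show "0 \<le> esinh (X (fst \<alpha>) - Y (snd \<alpha>)) * esinh (Y (fst \<alpha>) - X (snd \<alpha>)) \<and>
      esinh (X (fst \<alpha>) - Y (snd \<alpha>)) * esinh (Y (fst \<alpha>) - X (snd \<alpha>)) \<le> esinh (root_val \<alpha> Y) * esinh (root_val \<alpha> X)"
      using esinh_ptolemy[of "Y (snd \<alpha>)" "X (snd \<alpha>)" "Y (fst \<alpha>)" "X (fst \<alpha>)"] r D(2)[of "snd \<alpha>" "snd \<alpha>"]
        D(3)[of "fst \<alpha>" "snd \<alpha>"] D(2)[of "fst \<alpha>" "fst \<alpha>"] D(2)[of "fst \<alpha>" "snd \<alpha>"]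
      by (simp add: root_val_def mult_ac esinh_nonneg)
  next
    fix i assume "i \<in> {1..n}"
    then show "0 \<le> esinh (Y i - X (Suc n)) \<and> esinh (Y i - X (Suc n)) \<le> esinh (X i - X (Suc n))"
      using D(1)[of i] D(3)[of i "Suc n"] by (intro conjI esinh_mono esinh_nonneg) auto
  qed (use D E in \<open>auto simp: pos_roots_def root_val_def
     intro!: prod_nonneg mult_nonneg_nonneg esinh_nonneg\<close>)
  also have "\<dots> = (\<Prod>r=1..n. esinh (X r - Y r)) * (esinh_prod n Y * esinh_prod (Suc n) X)"
    by (simp add: esinh_prod_def prod_pos_roots_Suc prod.distrib root_val_def mult_ac)
  finally show ?thesis .
qed

text \<open>Compared with the upper bound, Ptolemy's inequality is applied with the pairs shifted by one
  column. For \<open>k < 1\<close>, where the lower bound is the one needed, this leaves only the integrable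
  singularities at the ends of each interval.\<close>

lemma esinh_bracket_lower:
  assumes X: "X \<in> chamber (Suc n)" and Y: "Y \<in> interlacing n X"
  shows "(\<Prod>r=1..n. esinh (X r - Y r) * esinh (Y r - X (Suc r)) / esinh (X r - X (Suc r))) * (esinh_prod n Y * esinh_prod (Suc n) X) \<le> esinh_bracket n X Y"
proof -
  note D = interlacingD[OF assms]
  have ne: "(\<Prod>r=1..n. esinh (X r - X (Suc r))) > 0"
    using X by (intro prod_pos) (auto intro!: esinh_pos simp: chamber_def)
  have "(\<Prod>r=1..n. esinh (X r - Y r) * esinh (Y r - X (Suc r)) / esinh (X r - X (Suc r))) * (esinh_prod n Y * esinh_prod (Suc n) X) =
    (\<Prod>r=1..n. esinh (X r - Y r)) * (\<Prod>r=1..n. esinh (Y r - X (Suc r))) *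
    (\<Prod>\<alpha>\<in>pos_roots n. esinh (root_val \<alpha> Y) * esinh (root_val (fst \<alpha>, Suc (snd \<alpha>)) X))"
  proof -
    \<comment> \<open>The denominators on the left are exactly the simple roots of \<open>X\<close>;
      they cancel the factor \<open>G\<close> of \<open>esinh_prod (Suc n) X\<close> and leave the
      shifted roots \<open>P\<close>.\<close>
    define G where "G = (\<Prod>r=1..n. esinh (X r - X (Suc r)))"
    have G: "G \<noteq> 0" using ne unfolding G_def by (rule less_imp_neq[THEN not_sym])
    define P where "P = (\<Prod>\<alpha>\<in>pos_roots n. esinh (root_val (fst \<alpha>, Suc (snd \<alpha>)) X))"
    have 1: "esinh_prod (Suc n) X = G * P"
      unfolding esinh_prod_def prod_pos_roots_shift G_def P_def by (simp add: root_val_def)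
    show ?thesis
      unfolding 1 prod_dividef prod.distrib G_def[symmetric] P_def[symmetric] esinh_prod_def[symmetric]
      using G by simp
  qed
  also have "\<dots> \<le> (\<Prod>r=1..n. esinh (X r - Y r)) * (\<Prod>r=1..n. esinh (Y r - X (Suc r))) *
    (\<Prod>\<alpha>\<in>pos_roots n. esinh (X (fst \<alpha>) - Y (snd \<alpha>)) * esinh (Y (fst \<alpha>) - X (Suc (snd \<alpha>))))"
  proof (intro mult_left_mono mult_mono prod_mono)
    fix \<alpha> assume "\<alpha> \<in> pos_roots n"
    then have r: "1 \<le> fst \<alpha>" "fst \<alpha> < snd \<alpha>" "snd \<alpha> \<le> n" by (auto simp: pos_roots_def)
    have "0 \<le> root_val (fst \<alpha>, Suc (snd \<alpha>)) X" using chamber_pos[OF X, of "(fst \<alpha>, Suc (snd \<alpha>))"] r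
      by (auto simp: pos_roots_def)
    then show "0 \<le> esinh (root_val \<alpha> Y) * esinh (root_val (fst \<alpha>, Suc (snd \<alpha>)) X) \<and>
      esinh (root_val \<alpha> Y) * esinh (root_val (fst \<alpha>, Suc (snd \<alpha>)) X) \<le> esinh (X (fst \<alpha>) - Y (snd \<alpha>)) * esinh (Y (fst \<alpha>) - X (Suc (snd \<alpha>)))"
      using esinh_ptolemy[of "X (Suc (snd \<alpha>))" "Y (snd \<alpha>)" "Y (fst \<alpha>)" "X (fst \<alpha>)"] r D(1)[of "snd \<alpha>"]
        D(4)[of "fst \<alpha>" "snd \<alpha>"] D(1)[of "fst \<alpha>"] by (simp add: root_val_def mult_ac esinh_nonneg)
  qed (use D in \<open>auto simp: pos_roots_def root_val_def
     intro!: prod_nonneg mult_nonneg_nonneg esinh_nonneg\<close>)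
  also have "\<dots> = esinh_bracket n X Y"
    by (simp add: esinh_bracket_def prod_pos_roots_shift prod.distrib mult_ac)
  finally show ?thesis .
qed

section \<open>Estimates in the open chamber\<close>

lemma exp_powr_bounded:
  fixes E t :: real
  assumes "0 \<le> E" "0 \<le> t"
  shows "exp (- t) * (1 + t) powr E \<le> (max 1 E) powr E"
proof -
  define M where "M = max 1 E"
  have M: "1 \<le> M" "E \<le> M" by (auto simp: M_def)
  \<comment> \<open>\<open>M\<close> dominates both 1 and \<open>E\<close>, so after raising
    \<open>exp (t / M)\<close> to the power \<open>E\<close> it is still at most
    \<open>exp t\<close>.\<close>
  have "1 + t \<le> M * (1 + t / M)" using M assms by (simp add: field_simps)
  also have "\<dots> \<le> M * exp (t / M)" using M by (intro mult_left_mono) (auto simp: exp_ge_add_one_self)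
  finally have "(1 + t) powr E \<le> (M * exp (t / M)) powr E" using assms by (intro powr_mono2) auto
  also have "\<dots> = M powr E * exp (t / M * E)" using M by (simp add: powr_mult exp_powr_real)
  also have "\<dots> \<le> M powr E * exp t"
  proof -
    have "t / M * E \<le> t" using M assms by (simp add: field_simps mult_right_mono)
    then show ?thesis by (intro mult_left_mono) auto
  qed
  finally have "exp (- t) * (1 + t) powr E \<le> exp (- t) * (M powr E * exp t)" by (intro mult_left_mono) auto
  also have "\<dots> = M powr E" by (simp add: exp_minus field_simps)
  finally show ?thesis by (simp add: M_def)
qed

lemma nn_integral_powr_0:
  assumes "0 < \<kappa>" "0 < g"
  shows "(\<integral>\<^sup>+u. ennreal (u powr (\<kappa> - 1)) * indicator {0<..<g} u \<partial>lborel) \<le> ennreal (g powr \<kappa> / \<kappa>)"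
proof -
  have "((\<lambda>u. u powr (\<kappa> - 1)) has_integral g powr \<kappa> / \<kappa>) {0..g}"
    using has_integral_powr_from_0[of "\<kappa> - 1" g] assms by simp
  then have "(\<integral>\<^sup>+u. ennreal (indicator {0..g} u * u powr (\<kappa> - 1)) \<partial>lborel) = ennreal (g powr \<kappa> / \<kappa>)"
    by (intro nn_integral_has_integral_lebesgue) auto
  moreover have "(\<integral>\<^sup>+u. ennreal (u powr (\<kappa> - 1)) * indicator {0<..<g} u \<partial>lborel) \<le>
    (\<integral>\<^sup>+u. ennreal (indicator {0..g} u * u powr (\<kappa> - 1)) \<partial>lborel)"
    by (intro nn_integral_mono) (auto simp: indicator_def)
  ultimately show ?thesis by simp
qed

lemma nn_integral_inverse_square:
  assumes "0 < (m::real)"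
  shows "(\<integral>\<^sup>+u. ennreal (m / u\<^sup>2) * indicator {m..} u \<partial>lborel) = 1"
proof -
  have "((\<lambda>u. u powr (-2)) has_integral 1 / m) {m..}"
    using has_integral_powr_to_inf[of "-2" m] assms by (simp add: powr_minus field_simps)
  from has_integral_mult_right[OF this, of m]
  have "((\<lambda>u. m * u powr (-2)) has_integral 1) {m..}" using assms by simp
  then have "(\<integral>\<^sup>+u. ennreal (indicator {m..} u * (m * u powr (-2))) \<partial>lborel) = ennreal 1"
    using assms by (intro nn_integral_has_integral_lebesgue) auto
  moreover have "(\<integral>\<^sup>+u. ennreal (m / u\<^sup>2) * indicator {m..} u \<partial>lborel) =
    (\<integral>\<^sup>+u. ennreal (indicator {m..} u * (m * u powr (-2))) \<partial>lborel)"
    using assms by (intro nn_integral_cong) (auto simp: indicator_def powr_minus divide_inverse)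
  ultimately show ?thesis by simp
qed

text \<open>Majorant in \<open>u = X j - Y j\<close> of the factor with exponent
  \<open>k - 1\<close> belonging to one coordinate. The singularity at the far end
  \<open>u = g\<close> is switched on only for \<open>g / 2 \<le> u\<close>, where the exponential
  has already decayed over half of the interval.\<close>

definition edge_weight :: "real \<Rightarrow> real \<Rightarrow> real \<Rightarrow> real" where
  "edge_weight k g u = esinh u powr (k - 1) + (if g / 2 \<le> u then esinh (g - u) powr (k - 1) else 0)"

lemma esinh_powr_le_psi:
  assumes "0 < u" shows "esinh u powr (k - 1) \<le> 2 powr \<bar>k - 1\<bar> * (psi k u / u)"
proof -
  have "esinh u powr (k - 1) \<le> 2 powr \<bar>k - 1\<bar> * (u / (1 + u)) powr (k - 1)"
    using esinh_le[of u] esinh_ge[of u] esinh_pos[of u] assms by (intro powr_ratio_le) auto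
  then show ?thesis using assms by (simp add: psi_eq)
qed

text \<open>\<open>psi_shrink\<close> for \<open>u \<le> m\<close> and \<open>psi_scale\<close> for
  \<open>u > m\<close> in one formula: the positive exponent \<open>min 1 k\<close> keeps
  \<open>psi k u / u\<close> integrable at 0, and the other factor is polynomial growth for the
  exponential to absorb.\<close>

lemma psi_le_ratio:
  assumes "k > 0" "0 < u" "0 < m"
  shows "psi k u \<le> psi k m * ((u / m) powr (min 1 k) * (1 + u / m) powr (1 + k))"
proof (cases "u \<le> m")
  case True
  have "psi k u = psi k ((u / m) * m)" using assms by simp
  also have "\<dots> \<le> (u / m) powr (min 1 k) * psi k m" using assms True by (intro psi_shrink) auto
  also have "\<dots> \<le> ((u / m) powr (min 1 k) * (1 + u / m) powr (1 + k)) * psi k m"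
  proof -
    have "1 \<le> (1 + u / m) powr (1 + k)" using assms by (intro ge_one_powr_ge_zero) auto
    then have "(u / m) powr (min 1 k) * 1 \<le> (u / m) powr (min 1 k) * (1 + u / m) powr (1 + k)"
      by (intro mult_left_mono) auto
    then show ?thesis using psi_nonneg by (intro mult_right_mono) auto
  qed
  finally show ?thesis by (simp add: mult_ac)
next
  case False
  have "psi k u = psi k ((u / m) * m)" using assms by simp
  also have "\<dots> \<le> (u / m) powr (1 + k) * psi k m" using assms False by (intro psi_scale) auto
  also have "\<dots> \<le> ((u / m) powr (min 1 k) * (1 + u / m) powr (1 + k)) * psi k m"
  proof -
    have "1 \<le> (u / m) powr (min 1 k)" using assms False by (intro ge_one_powr_ge_zero) auto
    moreover have "(u / m) powr (1 + k) \<le> (1 + u / m) powr (1 + k)" using assms by (intro powr_mono2) auto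
    ultimately have "1 * (u / m) powr (1 + k) \<le> (u / m) powr (min 1 k) * (1 + u / m) powr (1 + k)"
      by (intro mult_mono) auto
    then show ?thesis using psi_nonneg by (intro mult_right_mono) auto
  qed
  finally show ?thesis by (simp add: mult_ac)
qed

text \<open>Shrinking from the endpoint \<open>g\<close> dominates the integrand by a multiple of
  \<open>u powr (min 1 k - 1)\<close>, and the powers of \<open>g\<close> cancel, which makes the
  constant uniform in \<open>g\<close>.\<close>

lemma nn_integral_esinh_powr:
  assumes "k > 0" "0 < g"
  shows "(\<integral>\<^sup>+u. ennreal (esinh u powr (k - 1)) * indicator {0<..<g} u \<partial>lborel)
    \<le> ennreal (2 powr \<bar>k - 1\<bar> * psi k g / min 1 k)"
proof -
  define \<kappa> where "\<kappa> = min 1 k"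
  have \<kappa>: "0 < \<kappa>" using assms by (simp add: \<kappa>_def)
  define c where "c = 2 powr \<bar>k - 1\<bar> * (psi k g / g powr \<kappa>)"
  have c: "0 \<le> c" by (simp add: c_def psi_nonneg)
  have "(\<integral>\<^sup>+u. ennreal (esinh u powr (k - 1)) * indicator {0<..<g} u \<partial>lborel)
    \<le> (\<integral>\<^sup>+u. ennreal c * (ennreal (u powr (\<kappa> - 1)) * indicator {0<..<g} u) \<partial>lborel)"
  proof (intro nn_integral_mono)
    fix u :: real
    show "ennreal (esinh u powr (k - 1)) * indicator {0<..<g} u \<le> ennreal c * (ennreal (u powr (\<kappa> - 1)) * indicator {0<..<g} u)"
    proof (cases "u \<in> {0<..<g}")
      case True
      then have u: "0 < u" "u < g" by auto
      have "psi k u = psi k ((u / g) * g)" using u by simp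
      also have "\<dots> \<le> (u / g) powr \<kappa> * psi k g"
        using u assms unfolding \<kappa>_def by (intro psi_shrink) auto
      finally have "psi k u / u \<le> (u / g) powr \<kappa> * psi k g / u" using u by (intro divide_right_mono) auto
      also have "\<dots> = (psi k g / g powr \<kappa>) * u powr (\<kappa> - 1)"
        using u by (simp add: powr_divide powr_diff)
      finally have "2 powr \<bar>k - 1\<bar> * (psi k u / u) \<le> c * u powr (\<kappa> - 1)"
        unfolding c_def mult.assoc by (intro mult_left_mono) auto
      then have "esinh u powr (k - 1) \<le> c * u powr (\<kappa> - 1)" using esinh_powr_le_psi[of u k] u by simp
      then have "ennreal (esinh u powr (k - 1)) \<le> ennreal (c * u powr (\<kappa> - 1))" by (rule ennreal_leI)
      then show ?thesis using u c by (simp add: ennreal_mult)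
    qed auto
  qed
  also have "\<dots> = ennreal c * (\<integral>\<^sup>+u. ennreal (u powr (\<kappa> - 1)) * indicator {0<..<g} u \<partial>lborel)"
    by (rule nn_integral_cmult) auto
  also have "\<dots> \<le> ennreal c * ennreal (g powr \<kappa> / \<kappa>)"
    using nn_integral_powr_0[OF \<kappa> assms(2)] by (intro mult_left_mono) auto
  also have "\<dots> = ennreal (c * (g powr \<kappa> / \<kappa>))" using c \<kappa> by (intro ennreal_mult[symmetric]) auto
  also have "c * (g powr \<kappa> / \<kappa>) = 2 powr \<bar>k - 1\<bar> * psi k g / min 1 k"
    using assms by (simp add: c_def \<kappa>_def)
  finally show ?thesis .
qed

lemma esinh_half: "0 \<le> g \<Longrightarrow> esinh g \<le> 2 * esinh (g / 2)"
proof -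
  assume "0 \<le> g"
  have "1 - exp (- 2 * g) = (1 - exp (- g)) * (1 + exp (- g))"
    by (simp add: algebra_simps flip: exp_add)
  also have "\<dots> \<le> (1 - exp (- g)) * 2" using \<open>0 \<le> g\<close> by (intro mult_left_mono) auto
  finally show ?thesis by (simp add: esinh_def)
qed

text \<open>One of \<open>u\<close> and \<open>g - u\<close> is at least \<open>g / 2\<close>; by
  \<open>esinh_half\<close> its \<open>esinh\<close> cancels \<open>esinh g\<close> up to a factor
  2, and the negative exponent turns this into \<open>2 powr (1 - k)\<close>.\<close>

lemma edge_weight_bound:
  assumes u: "0 < u" "u < g" and k: "k < 1"
  shows "(esinh u * esinh (g - u) / esinh g) powr (k - 1) \<le> 2 powr (1 - k) * edge_weight k g u"
proof -
  have p: "0 < esinh u" "0 < esinh (g - u)" "0 < esinh g" using u by (auto intro: esinh_pos)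
  have gen: "(esinh u * esinh (g - u) / esinh g) powr (k - 1) \<le> 2 powr (1 - k) * esinh v powr (k - 1)"
    if v: "0 < esinh v" "esinh v / 2 \<le> esinh u * esinh (g - u) / esinh g" for v
  proof -
    have "(esinh u * esinh (g - u) / esinh g) powr (k - 1) \<le> (esinh v / 2) powr (k - 1)"
      using that k p by (intro powr_mono2') auto
    also have "\<dots> = 2 powr (1 - k) * esinh v powr (k - 1)"
      using v by (simp add: powr_divide powr_diff field_simps)
    finally show ?thesis .
  qed
  have half: "esinh g \<le> 2 * esinh (g / 2)" using u by (intro esinh_half) auto
  show ?thesis
  proof (cases "g / 2 \<le> u")
    case True
    then have "esinh (g / 2) \<le> esinh u" by (intro esinh_mono)
    with half have "esinh g \<le> 2 * esinh u" by simp
    then have "esinh (g - u) / 2 \<le> esinh u * esinh (g - u) / esinh g" using p by (simp add: field_simps)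
    from gen[OF p(2) this] have "(esinh u * esinh (g - u) / esinh g) powr (k - 1) \<le> 2 powr (1 - k) * esinh (g - u) powr (k - 1)" .
    also have "\<dots> \<le> 2 powr (1 - k) * edge_weight k g u" using True by (simp add: edge_weight_def)
    finally show ?thesis .
  next
    case False
    then have "esinh (g / 2) \<le> esinh (g - u)" by (intro esinh_mono) auto
    with half have "esinh g \<le> 2 * esinh (g - u)" by simp
    then have "esinh u / 2 \<le> esinh u * esinh (g - u) / esinh g" using p by (simp add: field_simps)
    from gen[OF p(1) this] have "(esinh u * esinh (g - u) / esinh g) powr (k - 1) \<le> 2 powr (1 - k) * esinh u powr (k - 1)" .
    also have "\<dots> \<le> 2 powr (1 - k) * edge_weight k g u" using False by (simp add: edge_weight_def)
    finally show ?thesis .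
  qed
qed

text \<open>The only properties of \<open>col_prod\<close> that enter the one-dimensional integral.
  They bound \<open>q u\<close> by \<open>q m\<close> times a power of \<open>1 + u / m\<close>,
  uniformly over all such \<open>q\<close>.\<close>

definition doubling :: "real \<Rightarrow> (real \<Rightarrow> real) \<Rightarrow> bool" where
  "doubling D q \<longleftrightarrow> (\<forall>u\<ge>0. 0 \<le> q u) \<and> (\<forall>u v. 0 \<le> u \<and> u \<le> v \<longrightarrow> q u \<le> q v) \<and>
     (\<forall>c u. 1 \<le> c \<and> 0 \<le> u \<longrightarrow> q (c * u) \<le> c powr D * q u)"

lemma doubling_le: assumes "doubling D q" "0 < m" "0 \<le> u" shows "q u \<le> (1 + u / m) powr D * q m"
proof -
  have "u \<le> (1 + u / m) * m" using assms by (simp add: field_simps)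
  then have "q u \<le> q ((1 + u / m) * m)" using assms by (auto simp: doubling_def)
  also have "\<dots> \<le> (1 + u / m) powr D * q m" using assms by (auto simp: doubling_def)
  finally show ?thesis .
qed

text \<open>\<open>u / damp L g = u / g + L * u\<close>, and \<open>u / g \<le> 1\<close> on the
  interval. At the cost of a factor \<open>exp 1\<close>, the finite length \<open>g\<close> is thus
  treated as additional exponential decay.\<close>

lemma exp_damp_bound:
  assumes "0 \<le> L" "0 < g" "0 \<le> u" "u \<le> g"
  shows "exp (- (L * u)) \<le> exp 1 * exp (- (u / damp L g))"
proof -
  have "u / damp L g = u * (inverse g + L)" using assms by (simp add: divide_inverse inverse_damp)
  also have "\<dots> = u / g + L * u" by (simp add: field_simps)
  also have "\<dots> \<le> 1 + L * u" using assms by (simp add: field_simps)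
  finally show ?thesis by (simp flip: exp_add)
qed

text \<open>In the variable \<open>t = u / m\<close> with \<open>m = damp L g\<close>, all factors
  grow at most polynomially except for \<open>exp (- t)\<close>, so the mass sits at
  \<open>u\<close> of size \<open>m\<close>. \<open>I1\<close> majorises the part
  \<open>u < m\<close>, \<open>I2\<close> the tail, and \<open>I3\<close> the singularity at
  \<open>u = g\<close>.\<close>

lemma integral_1d_upper:
  assumes k: "k > 0" and D: "0 \<le> D"
  obtains C where "C > 0" "\<And>L g q. 0 \<le> L \<Longrightarrow> 0 < g \<Longrightarrow> doubling D q \<Longrightarrow>
    (\<integral>\<^sup>+u. ennreal (exp (- (L * u)) * edge_weight k g u * q u) * indicator {0<..<g} u \<partial>lborel)
      \<le> ennreal (C * (psi k (damp L g) * q (damp L g)))"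
proof -
  define \<kappa> where "\<kappa> = min 1 k"
  have \<kappa>: "0 < \<kappa>" "\<kappa> \<le> 1" using k by (auto simp: \<kappa>_def)
  define c2 where "c2 = (2::real) powr \<bar>k - 1\<bar>"
  \<comment> \<open>\<open>D\<close> comes from the doubling function and \<open>1 + k\<close> from
    \<open>psi_le_ratio\<close>. The surplus \<open>\<kappa> + 1\<close> is kept as a negative power
    of \<open>1 + t\<close>: it turns \<open>t powr \<kappa> / u\<close> into the integrable tail
    \<open>m / u\<^sup>2\<close>.\<close>
  define E where "E = D + (1 + k) + (\<kappa> + 1)"
  define M where "M = (max 1 E) powr E"
  define C1 where "C1 = exp 1 * c2 * M"
  define F where "F = D + (1 + k)"
  define M' where "M' = (max 1 F) powr F"
  define C2 where "C2 = exp 1 * 2 powr F * M' * c2 / \<kappa>"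
  have E: "0 \<le> E" and F: "0 \<le> F" using D k \<kappa> by (auto simp: E_def F_def)
  have pos: "c2 > 0" "M > 0" "C1 > 0" "M' > 0" "C2 > 0"
    using \<kappa> by (auto simp: c2_def M_def C1_def M'_def C2_def)
  show ?thesis
  proof (rule that[of "C1 * (1 / \<kappa> + 1) + C2"])
    show "0 < C1 * (1 / \<kappa> + 1) + C2" using pos \<kappa> by (auto intro!: add_pos_pos mult_pos_pos)
  next
    fix L g :: real and q assume L: "0 \<le> L" and g: "0 < g" and q: "doubling D q"
    define m where "m = damp L g"
    have m: "0 < m" "m \<le> g" using L g by (auto simp: m_def intro: damp_pos damp_le_arg)
    have qn: "0 \<le> q u" if "0 \<le> u" for u using q that by (auto simp: doubling_def)
    define P where "P = psi k m * q m"
    have P: "0 \<le> P" using qn[of m] m psi_nonneg[of k m] by (simp add: P_def)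
    define I1 where "I1 u = ennreal (C1 * P / m powr \<kappa>) * (ennreal (u powr (\<kappa> - 1)) * indicator {0<..<m} u)" for u
    define I2 where "I2 u = ennreal (C1 * P) * (ennreal (m / u\<^sup>2) * indicator {m..} u)" for u
    \<comment> \<open>For \<open>u \<ge> g / 2\<close> the decay is at least
      \<open>exp (- (g / (2 * m)))\<close>. This absorbs the power of \<open>1 + g / m\<close> lost
      when \<open>q\<close> and \<open>psi k\<close> are moved from \<open>g\<close> back to
      \<open>m\<close>.\<close>
    define c3 where "c3 = exp 1 * exp (- (g / (2 * m))) * q g"
    define I3 where "I3 u = ennreal c3 * (ennreal (esinh (g - u) powr (k - 1)) * indicator {0<..<g} u)" for u
    have [measurable]: "esinh \<in> borel_measurable borel" unfolding esinh_def[abs_def] by measurable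
    have [measurable]: "I1 \<in> borel_measurable borel" "I2 \<in> borel_measurable borel" "I3 \<in> borel_measurable borel"
      unfolding I1_def[abs_def] I2_def[abs_def] I3_def[abs_def] by measurable
    have c3: "0 \<le> c3" using g by (simp add: c3_def qn)
    have pw: "ennreal (exp (- (L * u)) * edge_weight k g u * q u) * indicator {0<..<g} u \<le> I1 u + I2 u + I3 u" for u
    proof (cases "u \<in> {0<..<g}")
      case True
      then have u: "0 < u" "u < g" by auto
      define t where "t = u / m"
      have t: "0 < t" using u m by (simp add: t_def)
      have ex: "exp (- (L * u)) \<le> exp 1 * exp (- t)" using exp_damp_bound[of L g u] L g u by (simp add: m_def t_def)
      have "exp (- (L * u)) * esinh u powr (k - 1) * q u \<le>
         (exp 1 * exp (- t)) * (c2 * (psi k u / u)) * ((1 + t) powr D * q m)"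
        using ex esinh_powr_le_psi[of u k] doubling_le[OF q m(1), of u] u qn[of u] psi_nonneg[of k u]
        by (intro mult_mono) (auto simp: c2_def t_def)
      also have "\<dots> \<le> (exp 1 * exp (- t)) * (c2 * (psi k m * (t powr \<kappa> * (1 + t) powr (1 + k)) / u)) * ((1 + t) powr D * q m)"
        using psi_le_ratio[OF k u(1) m(1)] u pos qn[of m] m
        by (intro mult_right_mono mult_left_mono divide_right_mono) (auto simp: t_def \<kappa>_def)
      also have "\<dots> = exp 1 * c2 * P * (exp (- t) * ((1 + t) powr (1 + k) * (1 + t) powr D)) * (t powr \<kappa> / u)"
        by (simp add: P_def)
      also have "(1 + t) powr (1 + k) * (1 + t) powr D = (1 + t) powr E * (1 + t) powr (- (\<kappa> + 1))"
        unfolding powr_add[symmetric] by (rule arg_cong[where f = "\<lambda>e. (1 + t) powr e"]) (simp add: E_def)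
      also have "exp 1 * c2 * P * (exp (- t) * ((1 + t) powr E * (1 + t) powr (- (\<kappa> + 1)))) * (t powr \<kappa> / u) =
        exp 1 * c2 * P * (exp (- t) * (1 + t) powr E) * ((1 + t) powr (- (\<kappa> + 1)) * (t powr \<kappa> / u))" by simp
      also have "\<dots> \<le> exp 1 * c2 * P * M * ((1 + t) powr (- (\<kappa> + 1)) * (t powr \<kappa> / u))"
        using exp_powr_bounded[OF E, of t] t pos P u
        by (intro mult_right_mono mult_left_mono) (auto simp: M_def)
      finally have A: "exp (- (L * u)) * esinh u powr (k - 1) * q u \<le> C1 * P * ((1 + t) powr (- (\<kappa> + 1)) * (t powr \<kappa> / u))"
        by (simp add: C1_def mult_ac)
      have A': "ennreal (exp (- (L * u)) * esinh u powr (k - 1) * q u) \<le> I1 u + I2 u"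
      proof (cases "u < m")
        case True
        have "(1 + t) powr (- (\<kappa> + 1)) \<le> 1 powr (- (\<kappa> + 1))" using t \<kappa> by (intro powr_mono2') auto
        then have "(1 + t) powr (- (\<kappa> + 1)) * (t powr \<kappa> / u) \<le> 1 * (t powr \<kappa> / u)"
          using u by (intro mult_right_mono) auto
        also have "\<dots> = u powr (\<kappa> - 1) / m powr \<kappa>"
          using u m by (simp add: t_def powr_divide powr_diff)
        finally have "C1 * P * ((1 + t) powr (- (\<kappa> + 1)) * (t powr \<kappa> / u)) \<le> C1 * P * (u powr (\<kappa> - 1) / m powr \<kappa>)"
          using pos P by (intro mult_left_mono) auto
        with A have "exp (- (L * u)) * esinh u powr (k - 1) * q u \<le> C1 * P / m powr \<kappa> * u powr (\<kappa> - 1)" by simp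
        then have "ennreal (exp (- (L * u)) * esinh u powr (k - 1) * q u) \<le> ennreal (C1 * P / m powr \<kappa> * u powr (\<kappa> - 1))"
          by (rule ennreal_leI)
        also have "\<dots> = ennreal (C1 * P / m powr \<kappa>) * ennreal (u powr (\<kappa> - 1))"
          using P pos by (intro ennreal_mult) auto
        also have "\<dots> = I1 u" using True u by (simp add: I1_def)
        finally show ?thesis by (simp add: add_increasing2)
      next
        case False
        have "(1 + t) powr (- (\<kappa> + 1)) \<le> t powr (- (\<kappa> + 1))" using t \<kappa> by (intro powr_mono2') auto
        then have "(1 + t) powr (- (\<kappa> + 1)) * (t powr \<kappa> / u) \<le> t powr (- (\<kappa> + 1)) * (t powr \<kappa> / u)"
          using u by (intro mult_right_mono) auto
        also have "\<dots> = t powr (- 1) / u" using t by (simp flip: powr_add)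
        also have "\<dots> = m / u\<^sup>2"
          using u m t by (simp add: t_def powr_minus field_simps power2_eq_square)
        finally have "C1 * P * ((1 + t) powr (- (\<kappa> + 1)) * (t powr \<kappa> / u)) \<le> C1 * P * (m / u\<^sup>2)"
          using pos P by (intro mult_left_mono) auto
        with A have "exp (- (L * u)) * esinh u powr (k - 1) * q u \<le> C1 * P * (m / u\<^sup>2)" by simp
        then have "ennreal (exp (- (L * u)) * esinh u powr (k - 1) * q u) \<le> ennreal (C1 * P * (m / u\<^sup>2))"
          by (rule ennreal_leI)
        also have "\<dots> = ennreal (C1 * P) * ennreal (m / u\<^sup>2)" using P pos m by (intro ennreal_mult) auto
        also have "\<dots> = I2 u" using False by (simp add: I2_def)
        finally show ?thesis by (simp add: add_increasing)
      qed
      have B: "ennreal (exp (- (L * u)) * (if g / 2 \<le> u then esinh (g - u) powr (k - 1) else 0) * q u) \<le> I3 u"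
      proof (cases "g / 2 \<le> u")
        case True
        have "g / (2 * m) \<le> t" using True m by (simp add: t_def field_simps)
        then have "exp (- (L * u)) \<le> exp 1 * exp (- (g / (2 * m)))"
          by (intro order_trans[OF ex]) (auto intro!: mult_left_mono)
        moreover have "q u \<le> q g" using q u by (auto simp: doubling_def)
        ultimately have "exp (- (L * u)) * esinh (g - u) powr (k - 1) * q u \<le>
          (exp 1 * exp (- (g / (2 * m)))) * esinh (g - u) powr (k - 1) * q g"
          using u qn by (intro mult_mono) auto
        also have "\<dots> = c3 * esinh (g - u) powr (k - 1)" by (simp add: c3_def)
        finally have "ennreal (exp (- (L * u)) * esinh (g - u) powr (k - 1) * q u) \<le> ennreal (c3 * esinh (g - u) powr (k - 1))"
          by (rule ennreal_leI)
        then show ?thesis using True u c3 by (simp add: I3_def ennreal_mult)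
      qed auto
      have "ennreal (exp (- (L * u)) * edge_weight k g u * q u) =
        ennreal (exp (- (L * u)) * esinh u powr (k - 1) * q u) +
        ennreal (exp (- (L * u)) * (if g / 2 \<le> u then esinh (g - u) powr (k - 1) else 0) * q u)"
        using u qn[of u] by (subst ennreal_plus[symmetric]) (auto simp: edge_weight_def algebra_simps)
      also have "\<dots> \<le> I1 u + I2 u + I3 u" using A' B by (rule add_mono)
      finally show ?thesis using u by simp
    qed auto
    have i1: "(\<integral>\<^sup>+u. I1 u \<partial>lborel) \<le> ennreal (C1 * P / \<kappa>)"
    proof -
      have "(\<integral>\<^sup>+u. I1 u \<partial>lborel) = ennreal (C1 * P / m powr \<kappa>) * (\<integral>\<^sup>+u. ennreal (u powr (\<kappa> - 1)) * indicator {0<..<m} u \<partial>lborel)"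
        unfolding I1_def by (rule nn_integral_cmult) auto
      also have "\<dots> \<le> ennreal (C1 * P / m powr \<kappa>) * ennreal (m powr \<kappa> / \<kappa>)"
        using nn_integral_powr_0[OF \<kappa>(1) m(1)] by (intro mult_left_mono) auto
      also have "\<dots> = ennreal (C1 * P / m powr \<kappa> * (m powr \<kappa> / \<kappa>))" using P pos \<kappa> by (intro ennreal_mult[symmetric]) auto
      also have "C1 * P / m powr \<kappa> * (m powr \<kappa> / \<kappa>) = C1 * P / \<kappa>" using m by simp
      finally show ?thesis .
    qed
    have i2: "(\<integral>\<^sup>+u. I2 u \<partial>lborel) = ennreal (C1 * P)"
      unfolding I2_def by (subst nn_integral_cmult) (auto simp: nn_integral_inverse_square[OF m(1)])
    have i3: "(\<integral>\<^sup>+u. I3 u \<partial>lborel) \<le> ennreal (C2 * P)"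
    proof -
      define f where "f u = ennreal (esinh u powr (k - 1)) * indicator {0<..<g} u" for u
      have [measurable]: "f \<in> borel_measurable borel" unfolding f_def[abs_def] by measurable
      have "(\<integral>\<^sup>+u. I3 u \<partial>lborel) = ennreal c3 * (\<integral>\<^sup>+u. ennreal (esinh (g - u) powr (k - 1)) * indicator {0<..<g} u \<partial>lborel)"
        unfolding I3_def by (rule nn_integral_cmult) auto
      also have "(\<integral>\<^sup>+u. ennreal (esinh (g - u) powr (k - 1)) * indicator {0<..<g} u \<partial>lborel) = (\<integral>\<^sup>+u. f (g + (-1) * u) \<partial>lborel)"
        by (intro nn_integral_cong) (auto simp: f_def indicator_def)
      also have "\<dots> = (\<integral>\<^sup>+u. f u \<partial>lborel)"
        using nn_integral_real_affine[of f "-1" g] by simp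
      also have "ennreal c3 * \<dots> \<le> ennreal c3 * ennreal (c2 * psi k g / \<kappa>)"
        using nn_integral_esinh_powr[OF k g] unfolding f_def c2_def \<kappa>_def by (intro mult_left_mono) auto
      also have "\<dots> = ennreal (c3 * (c2 * psi k g / \<kappa>))"
        using c3 pos \<kappa> psi_nonneg[of k g] by (intro ennreal_mult[symmetric]) auto
      also have "\<dots> \<le> ennreal (C2 * P)"
      proof (rule ennreal_leI)
        define T where "T = g / m"
        have T: "0 < T" using g m by (simp add: T_def)
        have qg: "q g \<le> (1 + T) powr D * q m" using doubling_le[OF q m(1), of g] g by (simp add: T_def)
        have "psi k g \<le> psi k ((1 + T) * m)" using g m k by (intro psi_mono) (auto simp: T_def field_simps)
        also have "\<dots> \<le> (1 + T) powr (1 + k) * psi k m" using T m k by (intro psi_scale) auto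
        finally have pg: "psi k g \<le> (1 + T) powr (1 + k) * psi k m" .
        have "exp (- (T / 2)) * (1 + T) powr F \<le> exp (- (T / 2)) * (2 * (1 + T / 2)) powr F"
          using T F by (intro mult_left_mono powr_mono2) auto
        also have "\<dots> = 2 powr F * (exp (- (T / 2)) * (1 + T / 2) powr F)" using T by (subst powr_mult) auto
        also have "\<dots> \<le> 2 powr F * M'" using exp_powr_bounded[OF F, of "T / 2"] T by (simp add: M'_def)
        finally have TF: "exp (- (T / 2)) * (1 + T) powr F \<le> 2 powr F * M'" .
        have "c3 * (c2 * psi k g / \<kappa>) = exp 1 * exp (- (T / 2)) * q g * (c2 / \<kappa> * psi k g)"
          by (simp add: c3_def T_def)
        also have "\<dots> \<le> exp 1 * exp (- (T / 2)) * ((1 + T) powr D * q m) * (c2 / \<kappa> * ((1 + T) powr (1 + k) * psi k m))"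
          using qg pg qn g m pos \<kappa> psi_nonneg[of k g] by (intro mult_mono mult_left_mono) auto
        also have "\<dots> = exp 1 * c2 / \<kappa> * P * (exp (- (T / 2)) * (1 + T) powr F)"
          by (simp add: P_def F_def powr_add)
        also have "\<dots> \<le> exp 1 * c2 / \<kappa> * P * (2 powr F * M')"
          using TF pos P \<kappa> by (intro mult_left_mono) auto
        also have "\<dots> = C2 * P" by (simp add: C2_def)
        finally show "c3 * (c2 * psi k g / \<kappa>) \<le> C2 * P" .
      qed
      finally show ?thesis .
    qed
    have "(\<integral>\<^sup>+u. ennreal (exp (- (L * u)) * edge_weight k g u * q u) * indicator {0<..<g} u \<partial>lborel)
      \<le> (\<integral>\<^sup>+u. I1 u + I2 u + I3 u \<partial>lborel)" using pw by (intro nn_integral_mono)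
    also have "\<dots> = (\<integral>\<^sup>+u. I1 u \<partial>lborel) + (\<integral>\<^sup>+u. I2 u \<partial>lborel) + (\<integral>\<^sup>+u. I3 u \<partial>lborel)"
      by (simp add: nn_integral_add)
    also have "\<dots> \<le> ennreal (C1 * P / \<kappa>) + ennreal (C1 * P) + ennreal (C2 * P)"
      using i1 i2 i3 by (intro add_mono) auto
    also have "\<dots> = ennreal (C1 * P / \<kappa> + C1 * P + C2 * P)"
      using P pos \<kappa> by (subst ennreal_plus[symmetric], simp, simp)+ simp
    also have "C1 * P / \<kappa> + C1 * P + C2 * P = (C1 * (1 / \<kappa> + 1) + C2) * (psi k (damp L g) * q (damp L g))"
      by (simp add: P_def m_def algebra_simps add_divide_distrib)
    finally show "(\<integral>\<^sup>+u. ennreal (exp (- (L * u)) * edge_weight k g u * q u) * indicator {0<..<g} u \<partial>lborel)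
      \<le> ennreal ((C1 * (1 / \<kappa> + 1) + C2) * (psi k (damp L g) * q (damp L g)))" .
  qed
qed

section \<open>Reduction of the multiple integral to products over coordinates\<close>

definition lam_diff :: "nat \<Rightarrow> (nat \<Rightarrow> real) \<Rightarrow> nat \<Rightarrow> real" where "lam_diff n l j = l j - l (Suc n)"

definition damped_gap :: "nat \<Rightarrow> (nat \<Rightarrow> real) \<Rightarrow> (nat \<Rightarrow> real) \<Rightarrow> nat \<Rightarrow> real" where
  "damped_gap n l X j = damp (lam_diff n l j) (X j - X (Suc j))"

text \<open>Decouples the coordinates: \<open>Y i \<le> X i\<close> gives
  \<open>Y i - Y j \<le> X i - X j + u\<close> with \<open>u = X j - Y j\<close>, so the roots in
  column \<open>j\<close> are bounded by a function of the displacement \<open>u\<close>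
  alone.\<close>

definition col_prod :: "real \<Rightarrow> (nat \<Rightarrow> real) \<Rightarrow> (nat \<Rightarrow> real) \<Rightarrow> nat \<Rightarrow> real \<Rightarrow> real" where
  "col_prod k l X j u = (\<Prod>i\<in>{1..<j}. psi k (damp (l i - l j) (X i - X j + u)))"

definition psi_prod :: "real \<Rightarrow> nat \<Rightarrow> (nat \<Rightarrow> real) \<Rightarrow> (nat \<Rightarrow> real) \<Rightarrow> real" where
  "psi_prod k N l X = (\<Prod>\<alpha>\<in>pos_roots N. psi k (damp (root_val \<alpha> l) (root_val \<alpha> X)))"

text \<open>The integrand of the recursion applied to \<open>B\<close>, divided by \<open>exp ((\<lambda> - \<rho>)(X))\<close>.\<close>

definition reduced_integrand :: "real \<Rightarrow> nat \<Rightarrow> (nat \<Rightarrow> real) \<Rightarrow> (nat \<Rightarrow> real) \<Rightarrow> (nat \<Rightarrow> real) \<Rightarrow> real" where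
  "reduced_integrand k n l X Y = exp (- (\<Sum>j=1..n. lam_diff n l j * (X j - Y j))) * esinh_prod (Suc n) X powr (1 - 2 * k) *
     (esinh_prod n Y * (\<Prod>\<alpha>\<in>pos_roots n. root_factor k (root_val \<alpha> l) (root_val \<alpha> Y))) * esinh_bracket n X Y powr (k - 1)"

lemma prod_le_const:
  fixes f g :: "'a \<Rightarrow> real"
  assumes "finite A" "\<And>x. x \<in> A \<Longrightarrow> 0 \<le> f x" "\<And>x. x \<in> A \<Longrightarrow> f x \<le> c * g x"
  shows "prod f A \<le> c ^ card A * prod g A"
proof -
  have "prod f A \<le> (\<Prod>x\<in>A. c * g x)" using assms by (intro prod_mono) auto
  then show ?thesis by (simp add: prod.distrib)
qed

lemma closure_chamberD: "l \<in> closure (chamber N) \<Longrightarrow> 1 \<le> i \<Longrightarrow> i \<le> j \<Longrightarrow> j \<le> N \<Longrightarrow> l j \<le> l i"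
  unfolding closure_chamber by (cases "i = j") auto

lemma chamberD: "X \<in> chamber N \<Longrightarrow> 1 \<le> i \<Longrightarrow> i < j \<Longrightarrow> j \<le> N \<Longrightarrow> X j < X i"
  by (auto simp: chamber_def)

lemma damped_gap_pos:
  assumes "X \<in> chamber (Suc n)" "l \<in> closure (chamber (Suc n))" "1 \<le> j" "j \<le> n"
  shows "0 < damped_gap n l X j" "damped_gap n l X j \<le> X j - X (Suc j)" "lam_diff n l j * damped_gap n l X j \<le> 1" "0 \<le> lam_diff n l j"
proof -
  have "0 \<le> lam_diff n l j" "0 < X j - X (Suc j)"
    using closure_chamberD[OF assms(2), of j "Suc n"] chamberD[OF assms(1), of j "Suc j"] assms(3,4)
    by (auto simp: lam_diff_def)
  then show "0 < damped_gap n l X j" "damped_gap n l X j \<le> X j - X (Suc j)" "lam_diff n l j * damped_gap n l X j \<le> 1" "0 \<le> lam_diff n l j"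
    unfolding damped_gap_def by (auto intro: damp_pos damp_le_arg damp_mult_le_1)
qed

text \<open>Multiplying \<open>damp_psi_compare\<close> over all pairs compares \<open>A * B\<close>
  with \<open>C' * D\<close>. Here \<open>B\<close> and \<open>C'\<close> are products of one
  function \<open>h\<close> over the roots and over their column shifts; computing the product of
  \<open>h\<close> over \<open>pos_roots (Suc n)\<close> in two ways gives
  \<open>B * H2 = H1 * C'\<close>, so \<open>B\<close> cancels. This is the telescoping.\<close>

lemma psi_prod_compare:
  assumes k: "k > 0" and X: "X \<in> chamber (Suc n)" and l: "l \<in> closure (chamber (Suc n))"
  defines "c \<equiv> ((4::real) powr (2 * (1 + k))) ^ card (pos_roots n)"
  defines "S \<equiv> (\<Prod>j=1..n. psi k (damped_gap n l X j) * col_prod k l X j (damped_gap n l X j))"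
  shows "S \<le> c * psi_prod k (Suc n) l X" "psi_prod k (Suc n) l X \<le> c * S"
proof -
  define h where "h = (\<lambda>\<alpha>. psi k (damp (lam_diff n l (fst \<alpha>)) (root_val \<alpha> X)))"
  define B where "B = (\<Prod>\<alpha>\<in>pos_roots n. h \<alpha>)"
  define C' where "C' = (\<Prod>\<alpha>\<in>pos_roots n. h (fst \<alpha>, Suc (snd \<alpha>)))"
  define A where "A = (\<Prod>\<alpha>\<in>pos_roots n. psi k (damp (root_val \<alpha> l) (root_val \<alpha> X + damped_gap n l X (snd \<alpha>))))"
  define D where "D = (\<Prod>\<alpha>\<in>pos_roots n. psi k (damp (root_val \<alpha> l) (root_val \<alpha> X)))"
  define H1 where "H1 = (\<Prod>i=1..n. psi k (damped_gap n l X i))"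
  define H2 where "H2 = (\<Prod>i=1..n. h (i, Suc n))"
  have h: "h (i, Suc i) = psi k (damped_gap n l X i)" for i by (simp add: h_def damped_gap_def root_val_def)
  have BH: "B * H2 = H1 * C'"
    using prod_pos_roots_Suc[of h n] prod_pos_roots_shift[of h n]
    by (simp add: B_def H2_def H1_def C'_def h)
  have T: "psi_prod k (Suc n) l X = D * H2"
    by (simp add: psi_prod_def prod_pos_roots_Suc D_def H2_def h_def lam_diff_def root_val_def)
  have S: "S = H1 * A"
    unfolding S_def prod.distrib H1_def A_def col_prod_def prod_pos_roots_col by (simp add: root_val_def)
  have Bpos: "0 < B"
    unfolding B_def h_def
  proof (intro prod_pos psi_pos damp_pos)
    fix \<alpha> assume a: "\<alpha> \<in> pos_roots n"
    then show "0 < root_val \<alpha> X" using chamberD[OF X] by (auto simp: pos_roots_def root_val_def)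
    show "0 \<le> lam_diff n l (fst \<alpha>)" using a closure_chamberD[OF l] by (auto simp: pos_roots_def lam_diff_def)
  qed
  have H1: "0 \<le> H1" "0 \<le> H2" unfolding H1_def H2_def h_def by (auto intro!: prod_nonneg psi_nonneg)
  have cmp: "psi k (damp (root_val \<alpha> l) (root_val \<alpha> X + damped_gap n l X (snd \<alpha>))) * h \<alpha>
      \<le> 4 powr (2 * (1 + k)) * (h (fst \<alpha>, Suc (snd \<alpha>)) * psi k (damp (root_val \<alpha> l) (root_val \<alpha> X)))"
    "h (fst \<alpha>, Suc (snd \<alpha>)) * psi k (damp (root_val \<alpha> l) (root_val \<alpha> X)) \<le>
      4 powr (2 * (1 + k)) * (psi k (damp (root_val \<alpha> l) (root_val \<alpha> X + damped_gap n l X (snd \<alpha>))) * h \<alpha>)"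
    if "\<alpha> \<in> pos_roots n" for \<alpha>
  proof -
    obtain i j where \<alpha>: "\<alpha> = (i, j)" by (cases \<alpha>)
    with that have ij: "1 \<le> i" "i < j" "j \<le> n" by (auto simp: pos_roots_def)
    have 1: "0 \<le> lam_diff n l j" "lam_diff n l j \<le> lam_diff n l i" "0 < X i - X j" "0 < X j - X (Suc j)"
      using closure_chamberD[OF l, of j "Suc n"] closure_chamberD[OF l, of i j] chamberD[OF X, of i j]
        chamberD[OF X, of j "Suc j"] ij by (auto simp: lam_diff_def)
    have e: "lam_diff n l i - lam_diff n l j = l i - l j" "X i - X j + (X j - X (Suc j)) = X i - X (Suc j)"
      by (auto simp: lam_diff_def)
    note damp_psi_compare[OF k 1, unfolded e, folded damped_gap_def]
    then show "psi k (damp (root_val \<alpha> l) (root_val \<alpha> X + damped_gap n l X (snd \<alpha>))) * h \<alpha>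
      \<le> 4 powr (2 * (1 + k)) * (h (fst \<alpha>, Suc (snd \<alpha>)) * psi k (damp (root_val \<alpha> l) (root_val \<alpha> X)))"
    "h (fst \<alpha>, Suc (snd \<alpha>)) * psi k (damp (root_val \<alpha> l) (root_val \<alpha> X)) \<le>
      4 powr (2 * (1 + k)) * (psi k (damp (root_val \<alpha> l) (root_val \<alpha> X + damped_gap n l X (snd \<alpha>))) * h \<alpha>)"
      by (auto simp: \<alpha> root_val_def h_def)
  qed
  have c0: "0 \<le> c" by (simp add: c_def)
  have 1: "A * B \<le> c * (C' * D)"
    unfolding A_def B_def C'_def D_def c_def prod.distrib[symmetric]
    by (rule prod_le_const, simp, simp add: h_def psi_nonneg, rule cmp(1))
  have 2: "C' * D \<le> c * (A * B)"
    unfolding A_def B_def C'_def D_def c_def prod.distrib[symmetric]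
    by (rule prod_le_const, simp, simp add: h_def psi_nonneg, rule cmp(2))
  have "B * S \<le> B * (c * psi_prod k (Suc n) l X)"
  proof -
    have "B * S = H1 * (A * B)" by (simp add: S)
    also have "\<dots> \<le> H1 * (c * (C' * D))" using 1 H1 by (intro mult_left_mono)
    also have "\<dots> = c * D * (H1 * C')" by simp
    also have "\<dots> = B * (c * psi_prod k (Suc n) l X)" by (simp add: BH[symmetric] T)
    finally show ?thesis .
  qed
  then show "S \<le> c * psi_prod k (Suc n) l X" using Bpos by simp
  have "B * psi_prod k (Suc n) l X \<le> B * (c * S)"
  proof -
    have "B * psi_prod k (Suc n) l X = H1 * (C' * D)" using BH by (simp add: T mult_ac)
    also have "\<dots> \<le> H1 * (c * (A * B))" using 2 H1 by (intro mult_left_mono)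
    also have "\<dots> = B * (c * S)" by (simp add: S)
    finally show ?thesis .
  qed
  then show "psi_prod k (Suc n) l X \<le> c * S" using Bpos by simp
qed

text \<open>Replacing \<open>u\<close> by \<open>c * u\<close> increases the length
  \<open>X i - X j + u\<close> at most by the factor \<open>c\<close>, and each of the
  \<open>j - 1\<close> factors then grows by at most \<open>c powr (1 + k)\<close>.\<close>

lemma doubling_col_prod:
  fixes k :: real
  assumes k: "k > 0" and X: "X \<in> chamber (Suc n)" and l: "l \<in> closure (chamber (Suc n))"
    and j: "1 \<le> j" "j \<le> n"
  shows "doubling ((1 + k) * n) (col_prod k l X j)"
  unfolding doubling_def
proof (intro conjI allI impI)
  have p: "0 \<le> l i - l j" "0 < X i - X j" if "i \<in> {1..<j}" for i
    using that closure_chamberD[OF l, of i j] chamberD[OF X, of i j] j by auto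
  show "0 \<le> col_prod k l X j u" for u unfolding col_prod_def by (intro prod_nonneg psi_nonneg)
  show "col_prod k l X j u \<le> col_prod k l X j v" if "0 \<le> u \<and> u \<le> v" for u v
    unfolding col_prod_def
  proof (intro prod_mono conjI psi_nonneg psi_mono k damp_mono damp_nonneg)
    fix i assume "i \<in> {1..<j}"
    from p[OF this] that show "0 \<le> l i - l j" "0 \<le> l i - l j" "0 \<le> X i - X j + u" "0 \<le> X i - X j + u" "X i - X j + u \<le> X i - X j + v"
      by auto
  qed
  show "col_prod k l X j (c * u) \<le> c powr ((1 + k) * n) * col_prod k l X j u" if "1 \<le> c \<and> 0 \<le> u" for c u
  proof -
    have c: "1 \<le> c" "0 \<le> u" using that by auto
    have "col_prod k l X j (c * u) \<le> (c powr (1 + k)) ^ card {1..<j} * col_prod k l X j u"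
      unfolding col_prod_def
    proof (rule prod_le_const)
      fix i assume i: "i \<in> {1..<j}"
      have "damp (l i - l j) (X i - X j + c * u) \<le> damp (l i - l j) (c * (X i - X j + u))"
      proof (intro damp_mono)
        have "1 * (X i - X j) \<le> c * (X i - X j)" using p[OF i] c by (intro mult_right_mono) auto
        then show "X i - X j + c * u \<le> c * (X i - X j + u)" by (simp only: distrib_left mult_1_left add_right_mono)
      qed (use p[OF i] c in auto)
      also have "\<dots> \<le> c * damp (l i - l j) (X i - X j + u)" using p[OF i] c by (intro damp_scale) auto
      finally show "psi k (damp (l i - l j) (X i - X j + c * u)) \<le> c powr (1 + k) * psi k (damp (l i - l j) (X i - X j + u))"
        using p[OF i] c k by (intro psi_le_scale damp_nonneg) (auto intro!: add_nonneg_nonneg)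
    qed (auto simp: psi_nonneg)
    also have "(c powr (1 + k)) ^ card {1..<j} = c powr ((1 + k) * (real j - 1))"
      using c j by (simp add: powr_realpow[symmetric] powr_powr)
    also have "\<dots> \<le> c powr ((1 + k) * n)" using c j k by (intro powr_mono mult_left_mono) auto
    finally show ?thesis unfolding col_prod_def by (auto simp: mult_right_mono prod_nonneg psi_nonneg)
  qed
qed

text \<open>The powers are redistributed so that each \<open>root_factor\<close> meets
  \<open>esinh powr k\<close>, the combination comparable to \<open>psi\<close>. What is left of the
  bracket is the cross-ratio \<open>K\<close>, which the Ptolemy bounds control.\<close>

lemma reduced_integrand_eq:
  assumes X: "X \<in> chamber (Suc n)" and Y: "Y \<in> open_box n X"
  defines "K \<equiv> esinh_bracket n X Y / (esinh_prod n Y * esinh_prod (Suc n) X)"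
  shows "reduced_integrand k n l X Y = exp (- (\<Sum>j=1..n. lam_diff n l j * (X j - Y j))) * esinh_prod (Suc n) X powr (- k) *
     (\<Prod>\<alpha>\<in>pos_roots n. root_factor k (root_val \<alpha> l) (root_val \<alpha> Y) * esinh (root_val \<alpha> Y) powr k) * K powr (k - 1)"
    and "0 < esinh_prod n Y" "0 < K"
proof -
  note D = open_boxD[OF X Y]
  show sY: "0 < esinh_prod n Y" unfolding esinh_prod_def
    using D(3) by (intro prod_pos esinh_pos) (auto simp: pos_roots_def root_val_def)
  have sX: "0 < esinh_prod (Suc n) X" using X by (rule esinh_prod_pos)
  have br: "0 < esinh_bracket n X Y" unfolding esinh_bracket_def
    using D by (intro prod_pos mult_pos_pos esinh_pos conjI) (auto simp: pos_roots_def)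
  then show "0 < K" using sX sY by (simp add: K_def)
  have F: "(\<Prod>\<alpha>\<in>pos_roots n. root_factor k (root_val \<alpha> l) (root_val \<alpha> Y) * esinh (root_val \<alpha> Y) powr k) =
     (\<Prod>\<alpha>\<in>pos_roots n. root_factor k (root_val \<alpha> l) (root_val \<alpha> Y)) * esinh_prod n Y powr k"
    unfolding prod.distrib esinh_prod_def
    by (subst prod_powr_distrib) (auto intro!: esinh_nonneg D(3)[THEN less_imp_le] simp: pos_roots_def root_val_def)
  have "esinh_prod (Suc n) X powr (- k) * esinh_prod n Y powr k * K powr (k - 1) =
    esinh_prod (Suc n) X powr (1 - 2 * k) * esinh_prod n Y * esinh_bracket n X Y powr (k - 1)"
  proof -
    have "K powr (k - 1) = esinh_bracket n X Y powr (k - 1) / (esinh_prod n Y powr (k - 1) * esinh_prod (Suc n) X powr (k - 1))"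
      using sX sY br by (simp add: K_def powr_divide powr_mult)
    moreover have "esinh_prod n Y powr k = esinh_prod n Y * esinh_prod n Y powr (k - 1)" using sY by (simp add: powr_diff)
    moreover have "esinh_prod (Suc n) X powr (- k) = esinh_prod (Suc n) X powr (1 - 2 * k) * esinh_prod (Suc n) X powr (k - 1)"
      by (simp flip: powr_add)
    ultimately show ?thesis using sX sY by (simp add: field_simps)
  qed
  then show "reduced_integrand k n l X Y = exp (- (\<Sum>j=1..n. lam_diff n l j * (X j - Y j))) * esinh_prod (Suc n) X powr (- k) *
     (\<Prod>\<alpha>\<in>pos_roots n. root_factor k (root_val \<alpha> l) (root_val \<alpha> Y) * esinh (root_val \<alpha> Y) powr k) * K powr (k - 1)"
    unfolding F reduced_integrand_def by (simp add: mult_ac)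
qed

definition coord_bound :: "real \<Rightarrow> nat \<Rightarrow> (nat \<Rightarrow> real) \<Rightarrow> (nat \<Rightarrow> real) \<Rightarrow> nat \<Rightarrow> real \<Rightarrow> real" where
  "coord_bound k n l X j u = exp (- (lam_diff n l j * u)) * edge_weight k (X j - X (Suc j)) u * col_prod k l X j u"

lemma edge_weight_nonneg: "0 \<le> edge_weight k g u" by (simp add: edge_weight_def)

text \<open>\<open>K\<close> carries the exponent \<open>k - 1\<close>, so it is bounded from above
  by \<open>esinh_bracket_upper\<close> if \<open>k \<ge> 1\<close> and through
  \<open>esinh_bracket_lower\<close> if \<open>k < 1\<close>. Each root costs
  \<open>2 powr (2 * k + 1)\<close>, each coordinate at most \<open>2 powr (1 + k)\<close>.\<close>

lemma reduced_integrand_upper: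
  assumes k: "k > 0" and X: "X \<in> chamber (Suc n)" and l: "l \<in> closure (chamber (Suc n))"
    and Y: "Y \<in> open_box n X"
  defines "c \<equiv> ((2::real) powr (2 * k + 1)) ^ card (pos_roots n) * (2 powr (1 + k)) ^ n"
  shows "reduced_integrand k n l X Y \<le> c * esinh_prod (Suc n) X powr (- k) * (\<Prod>j=1..n. coord_bound k n l X j (X j - Y j))"
proof -
  note D = open_boxD[OF X Y]
  have YI: "Y \<in> interlacing n X" using Y by (simp add: open_box_def)
  note ce = reduced_integrand_eq(1)[OF X Y, where k = k and l = l] reduced_integrand_eq(2,3)[OF X Y]
  define K where "K = esinh_bracket n X Y / (esinh_prod n Y * esinh_prod (Suc n) X)"
  have sX: "0 < esinh_prod (Suc n) X" using X by (rule esinh_prod_pos)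
  have u: "0 < X j - Y j" "X j - Y j < X j - X (Suc j)" if "j \<in> {1..n}" for j
    using D(1)[of j j] D(2)[of j "Suc j"] that by auto
  have A: "(\<Prod>\<alpha>\<in>pos_roots n. root_factor k (root_val \<alpha> l) (root_val \<alpha> Y) * esinh (root_val \<alpha> Y) powr k)
    \<le> (2 powr (2 * k + 1)) ^ card (pos_roots n) * (\<Prod>\<alpha>\<in>pos_roots n. psi k (damp (root_val \<alpha> l) (root_val \<alpha> X + (X (snd \<alpha>) - Y (snd \<alpha>)))))"
  proof (rule prod_le_const)
    fix \<alpha> assume a: "\<alpha> \<in> pos_roots n"
    have l0: "0 \<le> root_val \<alpha> l" using a closure_chamberD[OF l] by (auto simp: pos_roots_def root_val_def)
    have y: "0 < root_val \<alpha> Y" using a D(3) by (auto simp: pos_roots_def root_val_def)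
    show "0 \<le> root_factor k (root_val \<alpha> l) (root_val \<alpha> Y) * esinh (root_val \<alpha> Y) powr k"
      using l0 y by (simp add: root_factor_def)
    have "root_factor k (root_val \<alpha> l) (root_val \<alpha> Y) * esinh (root_val \<alpha> Y) powr k \<le>
      2 powr (2 * k + 1) * psi k (damp (root_val \<alpha> l) (root_val \<alpha> Y))"
      by (rule root_factor_esinh_psi(1)[OF k l0 y])
    also have "\<dots> \<le> 2 powr (2 * k + 1) * psi k (damp (root_val \<alpha> l) (root_val \<alpha> X + (X (snd \<alpha>) - Y (snd \<alpha>))))"
    proof (intro mult_left_mono psi_mono k damp_nonneg damp_mono l0)
      have "Y (fst \<alpha>) \<le> X (fst \<alpha>)" using D(1)[of "fst \<alpha>" "fst \<alpha>"] a by (auto simp: pos_roots_def)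
      then show "root_val \<alpha> Y \<le> root_val \<alpha> X + (X (snd \<alpha>) - Y (snd \<alpha>))" by (simp add: root_val_def)
    qed (use y in auto)
    finally show "root_factor k (root_val \<alpha> l) (root_val \<alpha> Y) * esinh (root_val \<alpha> Y) powr k \<le>
      2 powr (2 * k + 1) * psi k (damp (root_val \<alpha> l) (root_val \<alpha> X + (X (snd \<alpha>) - Y (snd \<alpha>))))" .
  qed simp
  have A': "(\<Prod>\<alpha>\<in>pos_roots n. psi k (damp (root_val \<alpha> l) (root_val \<alpha> X + (X (snd \<alpha>) - Y (snd \<alpha>))))) =
    (\<Prod>j=1..n. col_prod k l X j (X j - Y j))"
    unfolding prod_pos_roots_col col_prod_def by (simp add: root_val_def)
  have B: "K powr (k - 1) \<le> (2 powr (1 + k)) ^ n * (\<Prod>j=1..n. edge_weight k (X j - X (Suc j)) (X j - Y j))"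
  proof (cases "k \<ge> 1")
    case True
    have "K \<le> (\<Prod>r=1..n. esinh (X r - Y r))"
      using esinh_bracket_upper[OF X YI] ce(2) sX by (simp add: K_def field_simps)
    then have "K powr (k - 1) \<le> (\<Prod>r=1..n. esinh (X r - Y r)) powr (k - 1)"
      using True ce(3) by (intro powr_mono2) (auto simp: K_def)
    also have "\<dots> = (\<Prod>r=1..n. esinh (X r - Y r) powr (k - 1))"
      using u by (intro prod_powr_distrib esinh_nonneg less_imp_le)
    also have "\<dots> \<le> (2 powr (1 + k)) ^ card {1..n} * (\<Prod>j=1..n. edge_weight k (X j - X (Suc j)) (X j - Y j))"
    proof (rule prod_le_const)
      fix j assume j: "j \<in> {1..n}"
      have "1 * edge_weight k (X j - X (Suc j)) (X j - Y j) \<le> 2 powr (1 + k) * edge_weight k (X j - X (Suc j)) (X j - Y j)"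
        using k edge_weight_nonneg by (intro mult_right_mono ge_one_powr_ge_zero) auto
      moreover have "esinh (X j - Y j) powr (k - 1) \<le> edge_weight k (X j - X (Suc j)) (X j - Y j)"
        by (simp add: edge_weight_def)
      ultimately show "esinh (X j - Y j) powr (k - 1) \<le> 2 powr (1 + k) * edge_weight k (X j - X (Suc j)) (X j - Y j)"
        by (simp only: mult_1_left)
    qed auto
    finally show ?thesis by simp
  next
    case False
    define R where "R r = esinh (X r - Y r) * esinh (Y r - X (Suc r)) / esinh (X r - X (Suc r))" for r
    have R: "0 < R r" if "r \<in> {1..n}" for r
      using u[OF that] unfolding R_def by (intro divide_pos_pos mult_pos_pos esinh_pos) auto
    have "(\<Prod>r=1..n. R r) \<le> K"
      using esinh_bracket_lower[OF X YI] ce(2) sX by (simp add: K_def R_def field_simps)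
    then have "K powr (k - 1) \<le> (\<Prod>r=1..n. R r) powr (k - 1)"
      using False R by (intro powr_mono2' prod_pos) auto
    also have "\<dots> = (\<Prod>r=1..n. R r powr (k - 1))"
      using R by (intro prod_powr_distrib less_imp_le)
    also have "\<dots> \<le> (2 powr (1 + k)) ^ card {1..n} * (\<Prod>j=1..n. edge_weight k (X j - X (Suc j)) (X j - Y j))"
    proof (rule prod_le_const)
      fix j assume j: "j \<in> {1..n}"
      have "R j powr (k - 1) \<le> 2 powr (1 - k) * edge_weight k (X j - X (Suc j)) (X j - Y j)"
        using edge_weight_bound[OF u[OF j], of k] False by (simp add: R_def)
      also have "\<dots> \<le> 2 powr (1 + k) * edge_weight k (X j - X (Suc j)) (X j - Y j)"
        using k edge_weight_nonneg by (intro mult_right_mono powr_mono) auto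
      finally show "R j powr (k - 1) \<le> 2 powr (1 + k) * edge_weight k (X j - X (Suc j)) (X j - Y j)" .
    qed auto
    finally show ?thesis by simp
  qed
  have "reduced_integrand k n l X Y \<le> exp (- (\<Sum>j=1..n. lam_diff n l j * (X j - Y j))) * esinh_prod (Suc n) X powr (- k) *
     ((2 powr (2 * k + 1)) ^ card (pos_roots n) * (\<Prod>j=1..n. col_prod k l X j (X j - Y j))) *
     ((2 powr (1 + k)) ^ n * (\<Prod>j=1..n. edge_weight k (X j - X (Suc j)) (X j - Y j)))"
    unfolding ce(1) K_def[symmetric]
    using A B unfolding A'
    by (intro mult_mono mult_left_mono mult_nonneg_nonneg prod_nonneg)
       (auto simp: col_prod_def psi_nonneg intro!: prod_nonneg mult_nonneg_nonneg)
  also have "\<dots> = c * esinh_prod (Suc n) X powr (- k) * (\<Prod>j=1..n. coord_bound k n l X j (X j - Y j))"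
    by (simp add: c_def coord_bound_def prod.distrib exp_sum[symmetric] sum_negf mult_ac)
  finally show ?thesis .
qed

text \<open>The upper end of the box keeps \<open>Y j\<close> in the upper half of its interval, so
  \<open>K\<close> agrees with the product of the \<open>esinh (X j - Y j)\<close> up to
  \<open>2 ^ n\<close>. The lower end makes each of these comparable to its value at the damped gap,
  with 8 as 4 from the box times 2 from \<open>esinh\<close>. Both ends together give
  \<open>X i - X j + damped_gap n l X j \<le> 4 * (Y i - Y j)\<close>, and the exponential loses at
  most \<open>exp 1\<close> per coordinate.\<close>

lemma reduced_integrand_lower:
  assumes k: "k > 0" and X: "X \<in> chamber (Suc n)" and l: "l \<in> closure (chamber (Suc n))"
    and Y: "Y \<in> interlacing n X" and m: "\<And>j. j \<in> {1..n} \<Longrightarrow> damped_gap n l X j / 4 \<le> X j - Y j \<and> X j - Y j \<le> damped_gap n l X j / 2"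
  defines "c \<equiv> ((2::real) powr (2 * k + 1)) ^ card (pos_roots n) * (4 powr (1 + k)) ^ card (pos_roots n) *
     (2 ^ n) powr \<bar>k - 1\<bar> * (8 powr \<bar>k - 1\<bar>) ^ n * exp 1 ^ n"
  shows "esinh_prod (Suc n) X powr (- k) * (\<Prod>j=1..n. psi k (damped_gap n l X j) / damped_gap n l X j * col_prod k l X j (damped_gap n l X j)) \<le> c * reduced_integrand k n l X Y"
proof -
  note mp = damped_gap_pos[OF X l]
  have u: "0 < X j - Y j" "X j - Y j \<le> (X j - X (Suc j)) / 2" "0 < X j - X (Suc j)" if "j \<in> {1..n}" for j
    using m[OF that] mp(1,2)[of j] that by auto
  have Yo: "Y \<in> open_box n X" using Y u unfolding open_box_def by force
  note D = open_boxD[OF X Yo]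
  note ce = reduced_integrand_eq(1)[OF X Yo, where k = k and l = l] reduced_integrand_eq(2,3)[OF X Yo]
  define K where "K = esinh_bracket n X Y / (esinh_prod n Y * esinh_prod (Suc n) X)"
  have sX: "0 < esinh_prod (Suc n) X" using X by (rule esinh_prod_pos)
  define P where "P = (\<Prod>\<alpha>\<in>pos_roots n. root_factor k (root_val \<alpha> l) (root_val \<alpha> Y) * esinh (root_val \<alpha> Y) powr k)"
  have A: "(\<Prod>j=1..n. col_prod k l X j (damped_gap n l X j)) \<le>
     ((2 powr (2 * k + 1)) * (4 powr (1 + k))) ^ card (pos_roots n) * P"
  proof -
    have "(\<Prod>j=1..n. col_prod k l X j (damped_gap n l X j)) = (\<Prod>\<alpha>\<in>pos_roots n. psi k (damp (root_val \<alpha> l) (root_val \<alpha> X + damped_gap n l X (snd \<alpha>))))"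
      unfolding prod_pos_roots_col col_prod_def by (simp add: root_val_def)
    also have "\<dots> \<le> ((2 powr (2 * k + 1)) * (4 powr (1 + k))) ^ card (pos_roots n) * P"
      unfolding P_def
    proof (rule prod_le_const)
      fix \<alpha> assume a: "\<alpha> \<in> pos_roots n"
      obtain i j where \<alpha>: "\<alpha> = (i, j)" by (cases \<alpha>)
      with a have ij: "1 \<le> i" "i < j" "j \<le> n" by (auto simp: pos_roots_def)
      have l0: "0 \<le> root_val \<alpha> l" using a closure_chamberD[OF l] by (auto simp: pos_roots_def root_val_def)
      have y: "0 < root_val \<alpha> Y" using a D(3) by (auto simp: pos_roots_def root_val_def)
      have x: "0 < root_val \<alpha> X" using chamberD[OF X] a by (auto simp: pos_roots_def root_val_def)
      have "X j \<le> X (Suc i)" using chamberD[OF X, of "Suc i" j] ij by (cases "Suc i = j") auto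
      then have "X i - Y i \<le> (X i - X j) / 2" using u(2)[of i] ij by auto
      then have "root_val \<alpha> X + damped_gap n l X j \<le> 4 * root_val \<alpha> Y"
        using m[of j] ij x y by (auto simp: \<alpha> root_val_def)
      then have "damp (root_val \<alpha> l) (root_val \<alpha> X + damped_gap n l X j) \<le> damp (root_val \<alpha> l) (4 * root_val \<alpha> Y)"
        using l0 x mp(1)[of j] ij by (intro damp_mono) auto
      also have "\<dots> \<le> 4 * damp (root_val \<alpha> l) (root_val \<alpha> Y)" using l0 y by (intro damp_scale) auto
      finally have "psi k (damp (root_val \<alpha> l) (root_val \<alpha> X + damped_gap n l X j)) \<le> 4 powr (1 + k) * psi k (damp (root_val \<alpha> l) (root_val \<alpha> Y))"
        using l0 x y mp(1)[of j] ij k by (intro psi_le_scale damp_nonneg) auto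
      also have "\<dots> \<le> 4 powr (1 + k) * (2 powr (2 * k + 1) * (root_factor k (root_val \<alpha> l) (root_val \<alpha> Y) * esinh (root_val \<alpha> Y) powr k))"
        by (intro mult_left_mono root_factor_esinh_psi(2)[OF k l0 y]) auto
      finally show "psi k (damp (root_val \<alpha> l) (root_val \<alpha> X + damped_gap n l X (snd \<alpha>))) \<le>
         2 powr (2 * k + 1) * 4 powr (1 + k) * (root_factor k (root_val \<alpha> l) (root_val \<alpha> Y) * esinh (root_val \<alpha> Y) powr k)"
        by (simp add: \<alpha> mult_ac)
    qed (auto simp: psi_nonneg)
    finally show ?thesis .
  qed
  have B: "(\<Prod>j=1..n. psi k (damped_gap n l X j) / damped_gap n l X j) \<le> (8 powr \<bar>k - 1\<bar>) ^ n * ((2 ^ n) powr \<bar>k - 1\<bar> * K powr (k - 1))"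
  proof -
    have "(\<Prod>j=1..n. psi k (damped_gap n l X j) / damped_gap n l X j) \<le> (8 powr \<bar>k - 1\<bar>) ^ card {1..n} * (\<Prod>j=1..n. esinh (X j - Y j) powr (k - 1))"
    proof (rule prod_le_const)
      fix j assume j: "j \<in> {1..n}"
      define M where "M = damped_gap n l X j"
      define v where "v = X j - Y j"
      have M: "0 < M" "M / 4 \<le> v" "v \<le> M" using m[OF j] mp(1)[of j] j by (auto simp: M_def v_def)
      have v: "0 < v" using M by simp
      show "0 \<le> psi k (damped_gap n l X j) / damped_gap n l X j" using M by (auto simp: M_def psi_nonneg)
      have 1: "v / (1 + v) \<le> M / (1 + M)" using M v by (simp add: field_simps)
      have 2: "M / (1 + M) \<le> 4 * (v / (1 + v))"
      proof -
        have "M / (1 + M) \<le> (4 * v) / (1 + 4 * v)" using M v by (simp add: field_simps)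
        also have "\<dots> \<le> 4 * v / (1 + v)" using v by (intro divide_left_mono) auto
        finally show ?thesis by simp
      qed
      have "psi k M / M = (M / (1 + M)) powr (k - 1)" using M by (simp add: psi_eq)
      also have "\<dots> \<le> 8 powr \<bar>k - 1\<bar> * esinh v powr (k - 1)"
        using 1 2 esinh_le[of v] esinh_ge[of v] v M by (intro powr_ratio_le esinh_pos) auto
      finally show "psi k (damped_gap n l X j) / damped_gap n l X j \<le> 8 powr \<bar>k - 1\<bar> * esinh (X j - Y j) powr (k - 1)"
        by (simp add: M_def v_def)
    qed auto
    also have "(\<Prod>j=1..n. esinh (X j - Y j) powr (k - 1)) = (\<Prod>j=1..n. esinh (X j - Y j)) powr (k - 1)"
      using u by (intro prod_powr_distrib[symmetric] esinh_nonneg less_imp_le)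
    also have "\<dots> \<le> (2 ^ n) powr \<bar>k - 1\<bar> * K powr (k - 1)"
    proof (rule powr_ratio_le)
      show "0 < (\<Prod>j=1..n. esinh (X j - Y j))" using u by (intro prod_pos esinh_pos) auto
      show "0 < K" using ce(3) by (simp add: K_def)
      show "(1::real) \<le> 2 ^ n" by simp
      have "K \<le> (\<Prod>r=1..n. esinh (X r - Y r))"
        using esinh_bracket_upper[OF X Y] ce(2) sX by (simp add: K_def field_simps)
      also have "\<dots> \<le> 2 ^ n * (\<Prod>r=1..n. esinh (X r - Y r))"
        using \<open>0 < (\<Prod>j=1..n. esinh (X j - Y j))\<close> by (simp add: mult_le_cancel_right1)
      finally show "K \<le> 2 ^ n * (\<Prod>r=1..n. esinh (X r - Y r))" .
      have "(\<Prod>r=1..n. esinh (X r - Y r)) \<le> 2 ^ card {1..n} * (\<Prod>r=1..n. esinh (X r - Y r) * esinh (Y r - X (Suc r)) / esinh (X r - X (Suc r)))"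
      proof (rule prod_le_const)
        fix j assume j: "j \<in> {1..n}"
        show "0 \<le> esinh (X j - Y j)" using u[OF j] by (intro esinh_nonneg) auto
        have "esinh (X j - X (Suc j)) \<le> 2 * esinh ((X j - X (Suc j)) / 2)" using u[OF j] by (intro esinh_half) auto
        also have "esinh ((X j - X (Suc j)) / 2) \<le> esinh (Y j - X (Suc j))" using u(2)[OF j] by (intro esinh_mono) auto
        finally have "esinh (X j - X (Suc j)) \<le> 2 * esinh (Y j - X (Suc j))" by simp
        from mult_left_mono[OF this, of "esinh (X j - Y j)"]
        show "esinh (X j - Y j) \<le> 2 * (esinh (X j - Y j) * esinh (Y j - X (Suc j)) / esinh (X j - X (Suc j)))"
          using esinh_pos[OF u(1)[OF j]] esinh_pos[OF u(3)[OF j]] by (simp add: field_simps)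
      qed auto
      also have "(\<Prod>r=1..n. esinh (X r - Y r) * esinh (Y r - X (Suc r)) / esinh (X r - X (Suc r))) \<le> K"
        using esinh_bracket_lower[OF X Y] ce(2) sX by (simp add: K_def field_simps)
      finally show "(\<Prod>r=1..n. esinh (X r - Y r)) \<le> 2 ^ n * K" by simp
    qed
    finally show ?thesis by simp
  qed
  have E: "1 \<le> exp 1 ^ n * exp (- (\<Sum>j=1..n. lam_diff n l j * (X j - Y j)))"
  proof -
    have "(\<Sum>j=1..n. lam_diff n l j * (X j - Y j)) \<le> (\<Sum>j=1..n. 1)"
    proof (intro sum_mono)
      fix j assume j: "j \<in> {1..n}"
      have "lam_diff n l j * (X j - Y j) \<le> lam_diff n l j * damped_gap n l X j" using m[OF j] mp[of j] j by (intro mult_left_mono) auto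
      then show "lam_diff n l j * (X j - Y j) \<le> 1" using mp(3)[of j] j by simp
    qed
    then have "0 \<le> real n - (\<Sum>j=1..n. lam_diff n l j * (X j - Y j))" by simp
    then have "1 \<le> exp (real n - (\<Sum>j=1..n. lam_diff n l j * (X j - Y j)))" by simp
    also have "\<dots> = exp 1 ^ n * exp (- (\<Sum>j=1..n. lam_diff n l j * (X j - Y j)))"
      by (simp add: exp_of_nat_mult[symmetric] flip: exp_add)
    finally show ?thesis .
  qed
  have pn: "0 \<le> (\<Prod>j=1..n. col_prod k l X j (damped_gap n l X j))" by (auto simp: col_prod_def psi_nonneg intro!: prod_nonneg)
  have pm: "0 \<le> (\<Prod>j=1..n. psi k (damped_gap n l X j) / damped_gap n l X j)"
  proof (intro prod_nonneg divide_nonneg_nonneg psi_nonneg)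
    show "0 \<le> damped_gap n l X j" if "j \<in> {1..n}" for j using mp(1)[of j] that by simp
  qed
  have Pn: "0 \<le> P" unfolding P_def
  proof (intro prod_nonneg)
    fix \<alpha> assume a: "\<alpha> \<in> pos_roots n"
    have "0 \<le> root_val \<alpha> l" "0 < root_val \<alpha> Y"
      using a closure_chamberD[OF l] D(3) by (auto simp: pos_roots_def root_val_def)
    then show "0 \<le> root_factor k (root_val \<alpha> l) (root_val \<alpha> Y) * esinh (root_val \<alpha> Y) powr k"
      by (simp add: root_factor_def)
  qed
  have "(\<Prod>j=1..n. psi k (damped_gap n l X j) / damped_gap n l X j * col_prod k l X j (damped_gap n l X j)) =
    1 * ((\<Prod>j=1..n. psi k (damped_gap n l X j) / damped_gap n l X j) * (\<Prod>j=1..n. col_prod k l X j (damped_gap n l X j)))"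
    unfolding prod.distrib by simp
  also have "\<dots> \<le> (exp 1 ^ n * exp (- (\<Sum>j=1..n. lam_diff n l j * (X j - Y j)))) *
     (((8 powr \<bar>k - 1\<bar>) ^ n * ((2 ^ n) powr \<bar>k - 1\<bar> * K powr (k - 1))) *
      (((2 powr (2 * k + 1)) * (4 powr (1 + k))) ^ card (pos_roots n) * P))"
    using A B E pn pm by (intro mult_mono mult_nonneg_nonneg) auto
  finally have "esinh_prod (Suc n) X powr (- k) * (\<Prod>j=1..n. psi k (damped_gap n l X j) / damped_gap n l X j * col_prod k l X j (damped_gap n l X j)) \<le>
    esinh_prod (Suc n) X powr (- k) * \<dots>" by (intro mult_left_mono) auto
  also have "\<dots> = c * reduced_integrand k n l X Y"
    unfolding ce(1) K_def[symmetric] P_def[symmetric] c_def power_mult_distrib by (simp only: mult_ac)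
  finally show ?thesis .
qed

lemma product_sigma_finite_lborel: "product_sigma_finite (\<lambda>_. lborel :: real measure)"
  by (simp add: product_sigma_finite_def sigma_finite_lborel)

lemma interlacing_sets [measurable]: "interlacing n X \<in> sets (Pi\<^sub>M {1..n} (\<lambda>_. lborel))"
  unfolding interlacing_def by (intro sets_PiM_I_finite) auto

text \<open>Stated for any measurable \<open>f\<close> squeezed between multiples of
  \<open>reduced_integrand\<close>, so that \<open>C1\<close> and \<open>C2\<close> are fixed before
  the constants \<open>a1\<close>, \<open>a2\<close> of the previous rank, which enter
  linearly.\<close>

lemma step_bounds:
  fixes k :: real and n :: nat
  assumes k: "k > 0"
  shows "\<exists>C1 C2. 0 < C1 \<and> 0 < C2 \<and>
    (\<forall>X\<in>chamber (Suc n). \<forall>l\<in>closure (chamber (Suc n)). \<forall>f\<in>borel_measurable (Pi\<^sub>M {1..n} (\<lambda>_. lborel)). \<forall>a1 a2.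
       0 < a1 \<longrightarrow> 0 < a2 \<longrightarrow>
       (\<forall>Y\<in>interlacing n X. a1 * reduced_integrand k n l X Y \<le> f Y \<and> f Y \<le> a2 * reduced_integrand k n l X Y) \<longrightarrow>
       a1 * C1 * (esinh_prod (Suc n) X powr (- k) * psi_prod k (Suc n) l X) \<le> (LINT Y:interlacing n X|Pi\<^sub>M {1..n} (\<lambda>_. lborel). f Y) \<and>
       (LINT Y:interlacing n X|Pi\<^sub>M {1..n} (\<lambda>_. lborel). f Y) \<le> a2 * C2 * (esinh_prod (Suc n) X powr (- k) * psi_prod k (Suc n) l X))"
proof -
  interpret product_sigma_finite "\<lambda>_::nat. lborel :: real measure" by (rule product_sigma_finite_lborel)
  have D: "0 \<le> (1 + k) * real n" using k by simp
  obtain C where C: "C > 0" "\<And>L g q. 0 \<le> L \<Longrightarrow> 0 < g \<Longrightarrow> doubling ((1 + k) * real n) q \<Longrightarrow>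
    (\<integral>\<^sup>+u. ennreal (exp (- (L * u)) * edge_weight k g u * q u) * indicator {0<..<g} u \<partial>lborel)
      \<le> ennreal (C * (psi k (damp L g) * q (damp L g)))"
    using integral_1d_upper[OF k D] by blast
  define cu where "cu = ((2::real) powr (2 * k + 1)) ^ card (pos_roots n) * (2 powr (1 + k)) ^ n"
  define cl where "cl = ((2::real) powr (2 * k + 1)) ^ card (pos_roots n) * (4 powr (1 + k)) ^ card (pos_roots n) *
     (2 ^ n) powr \<bar>k - 1\<bar> * (8 powr \<bar>k - 1\<bar>) ^ n * exp 1 ^ n"
  define c4 where "c4 = ((4::real) powr (2 * (1 + k))) ^ card (pos_roots n)"
  have pos: "0 < cu" "0 < cl" "0 < c4" by (simp_all add: cu_def cl_def c4_def)
  show ?thesis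
  \<comment> \<open>\<open>cu\<close> and \<open>cl\<close> come from the pointwise bounds,
    \<open>C ^ n\<close> from the one-dimensional integrals, \<open>4 ^ n\<close> from the volume of
    the box of the lower bound, and \<open>c4\<close> from \<open>psi_prod_compare\<close>.\<close>
  proof (rule exI[of _ "1 / (cl * 4 ^ n * c4)"], rule exI[of _ "cu * C ^ n * c4"], intro conjI ballI allI impI)
    show "0 < 1 / (cl * 4 ^ n * c4)" "0 < cu * C ^ n * c4" using pos C(1) by simp_all
  next
    fix X l :: "nat \<Rightarrow> real" and f and a1 a2 :: real
    assume X: "X \<in> chamber (Suc n)" and l: "l \<in> closure (chamber (Suc n))"
      and f[measurable]: "f \<in> borel_measurable (Pi\<^sub>M {1..n} (\<lambda>_. lborel))" and a: "0 < a1" "0 < a2"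
      and fb': "\<forall>Y\<in>interlacing n X. a1 * reduced_integrand k n l X Y \<le> f Y \<and> f Y \<le> a2 * reduced_integrand k n l X Y"
    have fb: "a1 * reduced_integrand k n l X Y \<le> f Y \<and> f Y \<le> a2 * reduced_integrand k n l X Y" if "Y \<in> interlacing n X" for Y
      using fb' that by blast
    define M where "M = Pi\<^sub>M {1..n} (\<lambda>_. lborel :: real measure)"
    define I where "I = (LINT Y:interlacing n X|M. f Y)"
    define F where "F Y = indicator (interlacing n X) Y * f Y" for Y
    have F_meas[measurable]: "F \<in> borel_measurable M" unfolding F_def M_def by measurable
    define s where "s = esinh_prod (Suc n) X powr (- k)"
    have s: "0 < s" using esinh_prod_pos[OF X] by (simp add: s_def)
    define S where "S = (\<Prod>j=1..n. psi k (damped_gap n l X j) * col_prod k l X j (damped_gap n l X j))"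
    note mp = damped_gap_pos[OF X l]
    have qpos: "0 < col_prod k l X j u" if "1 \<le> j" "j \<le> n" "0 \<le> u" for j u
      unfolding col_prod_def using that closure_chamberD[OF l, of _ j] chamberD[OF X, of _ j]
      by (intro prod_pos psi_pos damp_pos) (auto intro!: add_pos_nonneg)
    have qn: "0 \<le> col_prod k l X j u" for j u unfolding col_prod_def by (intro prod_nonneg psi_nonneg)
    have mn: "0 \<le> damped_gap n l X j" if "j \<in> {1..n}" for j using mp(1)[of j] that by simp
    have Sn: "0 \<le> S" unfolding S_def by (intro prod_nonneg mult_nonneg_nonneg psi_nonneg qn)
    have cmp: "S \<le> c4 * psi_prod k (Suc n) l X" "psi_prod k (Suc n) l X \<le> c4 * S"
      using psi_prod_compare[OF k X l] by (simp_all add: S_def c4_def)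
    have reduced_integrand_nn: "0 \<le> reduced_integrand k n l X Y" if "Y \<in> interlacing n X" for Y
    proof -
      have "0 \<le> root_val \<alpha> l" "0 \<le> root_val \<alpha> Y" if "\<alpha> \<in> pos_roots n" for \<alpha>
        using that closure_chamberD[OF l] interlacingD(4)[OF X \<open>Y \<in> interlacing n X\<close>]
        by (auto simp: pos_roots_def root_val_def)
      then have "0 \<le> (\<Prod>\<alpha>\<in>pos_roots n. root_factor k (root_val \<alpha> l) (root_val \<alpha> Y))"
        by (intro prod_nonneg) (auto simp: root_factor_def)
      then show ?thesis unfolding reduced_integrand_def using esinh_bracket_nonneg[OF X that] by simp
    qed
    have Fn: "0 \<le> F Y" for Y
    proof (cases "Y \<in> interlacing n X")
      case True
      have "0 \<le> a1 * reduced_integrand k n l X Y" using a reduced_integrand_nn[OF True] by simp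
      then show ?thesis using fb[OF True] by (simp add: F_def)
    qed (simp add: F_def)
    define H where "H j y = ennreal (coord_bound k n l X j (X j - y)) * indicator {0<..<X j - X (Suc j)} (X j - y)" for j y
    have [measurable]: "esinh \<in> borel_measurable borel" unfolding esinh_def[abs_def] by measurable
    have [measurable]: "coord_bound k n l X j \<in> borel_measurable borel" for j
      unfolding coord_bound_def[abs_def] edge_weight_def[abs_def] col_prod_def[abs_def] psi_def damp_def by measurable
    have H_meas[measurable]: "H j \<in> borel_measurable lborel" for j unfolding H_def[abs_def] by measurable
    have H_comp: "(\<lambda>Y. H j (Y j)) \<in> borel_measurable M" if "j \<in> {1..n}" for j
      using that unfolding M_def by measurable
    have Hprod: "(\<lambda>Y. \<Prod>j=1..n. H j (Y j)) \<in> borel_measurable M"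
      by (intro borel_measurable_prod_ennreal H_comp) auto
    have pw: "ennreal (F Y) \<le> ennreal (a2 * cu * s) * (\<Prod>j=1..n. H j (Y j))" for Y
    proof (cases "Y \<in> open_box n X")
      case True
      then have YI: "Y \<in> interlacing n X" by (simp add: open_box_def)
      note D = open_boxD[OF X True]
      have u: "0 < X j - Y j" "X j - Y j < X j - X (Suc j)" if "j \<in> {1..n}" for j
        using D(1)[of j j] D(2)[of j "Suc j"] that by auto
      have Wn: "0 \<le> coord_bound k n l X j (X j - Y j)" if "j \<in> {1..n}" for j
        unfolding coord_bound_def by (intro mult_nonneg_nonneg edge_weight_nonneg qn) simp
      have "F Y \<le> a2 * reduced_integrand k n l X Y" using fb[OF YI] YI by (simp add: F_def)
      also have "\<dots> \<le> a2 * (cu * s * (\<Prod>j=1..n. coord_bound k n l X j (X j - Y j)))"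
        using reduced_integrand_upper[OF k X l True] a by (intro mult_left_mono) (auto simp: cu_def s_def)
      finally have "ennreal (F Y) \<le> ennreal (a2 * cu * s * (\<Prod>j=1..n. coord_bound k n l X j (X j - Y j)))"
        by (intro ennreal_leI) (simp add: mult_ac)
      also have "\<dots> = ennreal (a2 * cu * s) * ennreal (\<Prod>j=1..n. coord_bound k n l X j (X j - Y j))"
        using a pos s Wn by (intro ennreal_mult) (auto intro!: prod_nonneg)
      also have "ennreal (\<Prod>j=1..n. coord_bound k n l X j (X j - Y j)) = (\<Prod>j=1..n. ennreal (coord_bound k n l X j (X j - Y j)))"
        using Wn by (intro prod_ennreal[symmetric])
      also have "\<dots> = (\<Prod>j=1..n. H j (Y j))"
        using u by (intro prod.cong) (auto simp: H_def)
      finally show ?thesis .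
    next
      case False
      have "F Y \<le> 0"
      proof (cases "Y \<in> interlacing n X")
        case True
        with esinh_bracket_eq_0[OF X True False] have "reduced_integrand k n l X Y = 0" by (simp add: reduced_integrand_def)
        then show ?thesis using fb[OF True] by (simp add: F_def True)
      qed (simp add: F_def)
      then show ?thesis by (simp add: ennreal_neg)
    qed
    have Hint: "(\<integral>\<^sup>+y. H j y \<partial>lborel) \<le> ennreal (C * (psi k (damped_gap n l X j) * col_prod k l X j (damped_gap n l X j)))"
      if "j \<in> {1..n}" for j
    proof -
      define W where "W u = ennreal (coord_bound k n l X j u) * indicator {0<..<X j - X (Suc j)} u" for u
      have [measurable]: "W \<in> borel_measurable borel" unfolding W_def[abs_def] by measurable
      have "(\<integral>\<^sup>+y. H j y \<partial>lborel) = (\<integral>\<^sup>+y. W (X j + (-1) * y) \<partial>lborel)"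
        by (simp add: H_def W_def)
      also have "\<dots> = (\<integral>\<^sup>+u. W u \<partial>lborel)"
        using nn_integral_real_affine[of W "-1" "X j"] by simp
      also have "\<dots> \<le> ennreal (C * (psi k (damped_gap n l X j) * col_prod k l X j (damped_gap n l X j)))"
        unfolding W_def coord_bound_def damped_gap_def
        using that mp(4)[of j] chamberD[OF X, of j "Suc j"] doubling_col_prod[OF k X l, of j] by (intro C(2)) auto
      finally show ?thesis .
    qed
    have "(\<integral>\<^sup>+Y. ennreal (F Y) \<partial>M) \<le> (\<integral>\<^sup>+Y. ennreal (a2 * cu * s) * (\<Prod>j=1..n. H j (Y j)) \<partial>M)"
      by (intro nn_integral_mono pw)
    also have "\<dots> = ennreal (a2 * cu * s) * (\<integral>\<^sup>+Y. (\<Prod>j=1..n. H j (Y j)) \<partial>M)"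
      by (rule nn_integral_cmult[OF Hprod])
    also have "(\<integral>\<^sup>+Y. (\<Prod>j=1..n. H j (Y j)) \<partial>M) = (\<Prod>j=1..n. \<integral>\<^sup>+y. H j y \<partial>lborel)"
      unfolding M_def by (rule product_nn_integral_prod) auto
    also have "\<dots> \<le> (\<Prod>j=1..n. ennreal (C * (psi k (damped_gap n l X j) * col_prod k l X j (damped_gap n l X j))))"
      using Hint by (intro prod_mono_ennreal) auto
    also have "\<dots> = ennreal (\<Prod>j=1..n. C * (psi k (damped_gap n l X j) * col_prod k l X j (damped_gap n l X j)))"
      using C(1) by (intro prod_ennreal mult_nonneg_nonneg psi_nonneg qn) simp
    also have "\<dots> = ennreal (C ^ n * S)" by (simp add: prod.distrib S_def)
    also have "ennreal (a2 * cu * s) * ennreal (C ^ n * S) = ennreal (a2 * cu * s * (C ^ n * S))"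
      using a pos s C(1) Sn by (intro ennreal_mult[symmetric]) auto
    also have "\<dots> \<le> ennreal (a2 * cu * s * (C ^ n * (c4 * psi_prod k (Suc n) l X)))"
      using a pos s C(1) cmp by (intro ennreal_leI mult_left_mono) auto
    also have "a2 * cu * s * (C ^ n * (c4 * psi_prod k (Suc n) l X)) = a2 * (cu * C ^ n * c4) * (s * psi_prod k (Suc n) l X)" by simp
    finally have U: "(\<integral>\<^sup>+Y. ennreal (F Y) \<partial>M) \<le> ennreal (a2 * (cu * C ^ n * c4) * (s * psi_prod k (Suc n) l X))" by (simp add: mult_left_mono)
    \<comment> \<open>The upper estimate supplies integrability, which the lower one needs: the
      Bochner integral of a function that is not integrable would be 0.\<close>
    have int: "integrable M F"
      using U Fn by (intro integrableI_nonneg) (auto simp: le_less_trans)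
    have I: "I = integral\<^sup>L M F" unfolding I_def set_lebesgue_integral_def F_def[abs_def] by simp
    have nn: "(\<integral>\<^sup>+Y. ennreal (F Y) \<partial>M) = ennreal I"
      unfolding I using int Fn by (intro nn_integral_eq_integral) auto
    have I0: "0 \<le> I" unfolding I using Fn by simp
    have Tn: "0 \<le> psi_prod k (Suc n) l X" unfolding psi_prod_def by (intro prod_nonneg psi_nonneg)
    have upper: "I \<le> a2 * (cu * C ^ n * c4) * (s * psi_prod k (Suc n) l X)"
      using U a pos C(1) s Tn unfolding nn by (subst (asm) ennreal_le_iff) auto
    \<comment> \<open>In each coordinate a quarter of the damped gap, so the volume turns
      \<open>psi k m / m\<close> into \<open>psi k m\<close> up to a constant.\<close>
    define B where "B = (\<Pi>\<^sub>E j\<in>{1..n}. {X j - damped_gap n l X j / 2..X j - damped_gap n l X j / 4})"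
    have B_sets: "B \<in> sets M" unfolding B_def M_def by (intro sets_PiM_I_finite) auto
    define \<beta> where "\<beta> = a1 / cl * s * (\<Prod>j=1..n. psi k (damped_gap n l X j) / damped_gap n l X j * col_prod k l X j (damped_gap n l X j))"
    have beta: "0 \<le> \<beta>" unfolding \<beta>_def using a pos s
      by (intro mult_nonneg_nonneg prod_nonneg divide_nonneg_nonneg psi_nonneg qn mn) auto
    have lb: "ennreal \<beta> * indicator B Y \<le> ennreal (F Y)" for Y
    proof (cases "Y \<in> B")
      case True
      have mB: "damped_gap n l X j / 4 \<le> X j - Y j \<and> X j - Y j \<le> damped_gap n l X j / 2" if "j \<in> {1..n}" for j
      proof -
        have "Y j \<in> {X j - damped_gap n l X j / 2..X j - damped_gap n l X j / 4}" using True that unfolding B_def by (rule PiE_mem)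
        then show ?thesis by auto
      qed
      have YI: "Y \<in> interlacing n X"
        unfolding interlacing_def
      proof (rule PiE_I)
        fix j assume j: "j \<in> {1..n}"
        show "Y j \<in> {X (j + 1)..X j}" using mB[OF j] mp(1,2)[of j] j by auto
      next
        fix j assume "j \<notin> {1..n}"
        then show "Y j = undefined" using True unfolding B_def by (rule PiE_arb[rotated])
      qed
      have "\<beta> = a1 / cl * (s * (\<Prod>j=1..n. psi k (damped_gap n l X j) / damped_gap n l X j * col_prod k l X j (damped_gap n l X j)))"
        by (simp add: \<beta>_def)
      also have "\<dots> \<le> a1 / cl * (cl * reduced_integrand k n l X Y)"
        using reduced_integrand_lower[OF k X l YI mB] a pos unfolding s_def cl_def by (intro mult_left_mono) auto
      also have "\<dots> = a1 * reduced_integrand k n l X Y" using pos by simp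
      also have "\<dots> \<le> F Y" using fb[OF YI] YI by (simp add: F_def)
      finally show ?thesis using True by (simp add: ennreal_leI)
    qed simp
    have "emeasure M B = (\<Prod>j=1..n. emeasure lborel {X j - damped_gap n l X j / 2..X j - damped_gap n l X j / 4})"
      unfolding M_def B_def by (rule emeasure_PiM) auto
    also have "\<dots> = (\<Prod>j=1..n. ennreal (damped_gap n l X j / 4))"
      using mn by (intro prod.cong refl) (subst emeasure_lborel_Icc, auto simp: field_simps)
    also have "\<dots> = ennreal (\<Prod>j=1..n. damped_gap n l X j / 4)"
      using mn by (intro prod_ennreal) simp
    finally have eB: "emeasure M B = ennreal (\<Prod>j=1..n. damped_gap n l X j / 4)" .
    have "ennreal (\<beta> * (\<Prod>j=1..n. damped_gap n l X j / 4)) = ennreal \<beta> * emeasure M B"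
      unfolding eB using beta mn by (intro ennreal_mult prod_nonneg) auto
    also have "\<dots> = (\<integral>\<^sup>+Y. ennreal \<beta> * indicator B Y \<partial>M)"
      by (rule nn_integral_cmult_indicator[symmetric, OF B_sets])
    also have "\<dots> \<le> ennreal I" unfolding nn[symmetric] by (intro nn_integral_mono lb)
    finally have "\<beta> * (\<Prod>j=1..n. damped_gap n l X j / 4) \<le> I" using I0 by (simp add: ennreal_le_iff)
    also have "\<beta> * (\<Prod>j=1..n. damped_gap n l X j / 4) = a1 / cl * s * (S / 4 ^ n)"
    proof -
      have "(\<Prod>j=1..n. psi k (damped_gap n l X j) / damped_gap n l X j * col_prod k l X j (damped_gap n l X j)) * (\<Prod>j=1..n. damped_gap n l X j / 4)
         = (\<Prod>j=1..n. psi k (damped_gap n l X j) * col_prod k l X j (damped_gap n l X j) / 4)"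
        unfolding prod.distrib[symmetric] using mp(1) by (intro prod.cong refl) (force simp: field_simps)
      also have "\<dots> = S / 4 ^ n" by (simp add: S_def prod_dividef)
      finally have e: "(\<Prod>j=1..n. psi k (damped_gap n l X j) / damped_gap n l X j * col_prod k l X j (damped_gap n l X j)) * (\<Prod>j=1..n. damped_gap n l X j / 4) = S / 4 ^ n" .
      show ?thesis unfolding \<beta>_def by (simp only: mult.assoc e)
    qed
    finally have L: "a1 / cl * s * (S / 4 ^ n) \<le> I" .
    have "psi_prod k (Suc n) l X / c4 \<le> S" using cmp(2) pos by (simp add: field_simps)
    then have "a1 / cl * s * (psi_prod k (Suc n) l X / c4 / 4 ^ n) \<le> a1 / cl * s * (S / 4 ^ n)"
      using a pos s by (intro mult_left_mono divide_right_mono) auto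
    with L have lower: "a1 / cl * s * (psi_prod k (Suc n) l X / c4 / 4 ^ n) \<le> I" by simp
    have "a1 / cl * s * (psi_prod k (Suc n) l X / c4 / 4 ^ n) = a1 * (1 / (cl * 4 ^ n * c4)) * (s * psi_prod k (Suc n) l X)"
      by (simp add: field_simps)
    with lower upper show "a1 * (1 / (cl * 4 ^ n * c4)) * (esinh_prod (Suc n) X powr (- k) * psi_prod k (Suc n) l X) \<le> (LINT Y:interlacing n X|Pi\<^sub>M {1..n} (\<lambda>_. lborel). f Y)"
       "(LINT Y:interlacing n X|Pi\<^sub>M {1..n} (\<lambda>_. lborel). f Y) \<le> a2 * (cu * C ^ n * c4) * (esinh_prod (Suc n) X powr (- k) * psi_prod k (Suc n) l X)"
      by (simp_all only: I_def M_def s_def)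
  qed
qed

lemma bound_B_eq:
  "bound_B k n l X = exp (pairing (Suc n) l X - rho k (Suc n) X) *
     (\<Prod>\<alpha>\<in>pos_roots (Suc n). root_factor k (root_val \<alpha> l) (root_val \<alpha> X))"
  by (simp add: bound_B_def root_factor_def)

lemma bound_B_psi_prod:
  assumes k: "k > 0" and X: "X \<in> chamber (Suc n)" and l: "l \<in> closure (chamber (Suc n))"
  defines "c \<equiv> ((2::real) powr (2 * k + 1)) ^ card (pos_roots (Suc n))"
    and "E \<equiv> exp (pairing (Suc n) l X - rho k (Suc n) X)"
  shows "bound_B k n l X \<le> c * (E * (esinh_prod (Suc n) X powr (- k) * psi_prod k (Suc n) l X))"
    "E * (esinh_prod (Suc n) X powr (- k) * psi_prod k (Suc n) l X) \<le> c * bound_B k n l X"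
proof -
  have sX: "0 < esinh_prod (Suc n) X" using X by (rule esinh_prod_pos)
  have x: "0 < root_val \<alpha> X" "0 \<le> root_val \<alpha> l" if "\<alpha> \<in> pos_roots (Suc n)" for \<alpha>
    using that chamber_pos[OF X] closure_chamber_nonneg[OF l] by auto
  define P where "P = (\<Prod>\<alpha>\<in>pos_roots (Suc n). root_factor k (root_val \<alpha> l) (root_val \<alpha> X) * esinh (root_val \<alpha> X) powr k)"
  have "P = (\<Prod>\<alpha>\<in>pos_roots (Suc n). root_factor k (root_val \<alpha> l) (root_val \<alpha> X)) * esinh_prod (Suc n) X powr k"
    unfolding P_def prod.distrib esinh_prod_def
    by (subst prod_powr_distrib) (auto intro!: esinh_nonneg x(1)[THEN less_imp_le])
  then have B: "bound_B k n l X = E * (esinh_prod (Suc n) X powr (- k) * P)"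
    unfolding bound_B_eq E_def using sX by (simp add: powr_minus)
  have 1: "P \<le> c * psi_prod k (Suc n) l X" unfolding P_def c_def psi_prod_def
  proof (rule prod_le_const)
    fix \<alpha> assume a: "\<alpha> \<in> pos_roots (Suc n)"
    show "0 \<le> root_factor k (root_val \<alpha> l) (root_val \<alpha> X) * esinh (root_val \<alpha> X) powr k" using x[OF a] by (simp add: root_factor_def)
    show "root_factor k (root_val \<alpha> l) (root_val \<alpha> X) * esinh (root_val \<alpha> X) powr k \<le> 2 powr (2 * k + 1) * psi k (damp (root_val \<alpha> l) (root_val \<alpha> X))"
      by (rule root_factor_esinh_psi(1)[OF k x(2,1)[OF a]])
  qed simp
  have 2: "psi_prod k (Suc n) l X \<le> c * P" unfolding P_def c_def psi_prod_def
  proof (rule prod_le_const)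
    fix \<alpha> assume a: "\<alpha> \<in> pos_roots (Suc n)"
    show "psi k (damp (root_val \<alpha> l) (root_val \<alpha> X)) \<le> 2 powr (2 * k + 1) * (root_factor k (root_val \<alpha> l) (root_val \<alpha> X) * esinh (root_val \<alpha> X) powr k)"
      by (rule root_factor_esinh_psi(2)[OF k x(2,1)[OF a]])
  qed (auto simp: psi_nonneg)
  have E: "0 \<le> E * esinh_prod (Suc n) X powr (- k)" by (simp add: E_def)
  show "bound_B k n l X \<le> c * (E * (esinh_prod (Suc n) X powr (- k) * psi_prod k (Suc n) l X))"
    using mult_left_mono[OF 1 E] by (simp add: B mult_ac)
  show "E * (esinh_prod (Suc n) X powr (- k) * psi_prod k (Suc n) l X) \<le> c * bound_B k n l X"
    using mult_left_mono[OF 2 E] by (simp add: B mult_ac)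
qed

section \<open>The Dixon--Anderson integral\<close>

text \<open>Taken over an arbitrary index set so that one index can be deleted. The smaller index
  comes first, which makes the product positive for decreasing values.\<close>

definition vand :: "nat set \<Rightarrow> (nat \<Rightarrow> real) \<Rightarrow> real" where
  "vand A u = (\<Prod>\<alpha>\<in>{\<alpha> \<in> A \<times> A. fst \<alpha> < snd \<alpha>}. u (fst \<alpha>) - u (snd \<alpha>))"

lemma vand_remove:
  assumes "finite A" "r \<in> A"
  shows "vand A u = (-1) ^ card {i\<in>A. i < r} * vand (A - {r}) u * (\<Prod>q\<in>A - {r}. u r - u q)"
proof -
  define B where "B = A - {r}"
  have fB: "finite B" using assms by (simp add: B_def)
  have split: "{\<alpha> \<in> A \<times> A. fst \<alpha> < snd \<alpha>} = {\<alpha> \<in> B \<times> B. fst \<alpha> < snd \<alpha>} \<union>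
      ((\<lambda>i. (i, r)) ` {i\<in>B. i < r} \<union> (\<lambda>j. (r, j)) ` {j\<in>B. r < j})"
    using assms by (auto simp: B_def image_iff)
  have 0: "finite {\<alpha> \<in> B \<times> B. fst \<alpha> < snd \<alpha>}" using fB by auto
  have "vand A u = vand B u * ((\<Prod>i\<in>{i\<in>B. i < r}. u i - u r) * (\<Prod>j\<in>{j\<in>B. r < j}. u r - u j))"
    unfolding vand_def split
    by (subst prod.union_disjoint, (use 0 fB in \<open>auto simp: B_def\<close>)[3], subst prod.union_disjoint,
        (use fB in \<open>auto simp: B_def\<close>)[3]) (simp add: prod.reindex inj_on_def)
  also have "(\<Prod>i\<in>{i\<in>B. i < r}. u i - u r) = (\<Prod>i\<in>{i\<in>B. i < r}. (-1) * (u r - u i))"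
    by (intro prod.cong) auto
  also have "\<dots> = (-1) ^ card {i\<in>B. i < r} * (\<Prod>i\<in>{i\<in>B. i < r}. u r - u i)"
    by (subst prod.distrib) simp
  also have "{i\<in>B. i < r} = {i\<in>A. i < r}" by (auto simp: B_def)
  also have "vand B u * ((-1) ^ card {i\<in>A. i < r} * (\<Prod>i\<in>{i\<in>A. i < r}. u r - u i) * (\<Prod>j\<in>{j\<in>B. r < j}. u r - u j)) =
     (-1) ^ card {i\<in>A. i < r} * vand B u * ((\<Prod>i\<in>{i\<in>A. i < r}. u r - u i) * (\<Prod>j\<in>{j\<in>B. r < j}. u r - u j))"
    by simp
  also have "(\<Prod>i\<in>{i\<in>A. i < r}. u r - u i) * (\<Prod>j\<in>{j\<in>B. r < j}. u r - u j) = (\<Prod>q\<in>B. u r - u q)"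
  proof -
    have "B = {i\<in>A. i < r} \<union> {j\<in>B. r < j}" by (auto simp: B_def)
    then have "(\<Prod>q\<in>B. u r - u q) = (\<Prod>q\<in>{i\<in>A. i < r} \<union> {j\<in>B. r < j}. u r - u q)" by simp
    also have "\<dots> = (\<Prod>i\<in>{i\<in>A. i < r}. u r - u i) * (\<Prod>j\<in>{j\<in>B. r < j}. u r - u j)"
      using assms fB by (intro prod.union_disjoint) auto
    finally show ?thesis by simp
  qed
  finally show ?thesis by (simp add: B_def)
qed

text \<open>The degree may equal the number of nodes. Subtracting the leading coefficient times the
  nodal polynomial \<open>w\<close> lowers the degree without changing values at the nodes; this
  accounts for the correction term.\<close>

lemma lagrange_interpolation:
  fixes p :: "real poly" and u :: "'i \<Rightarrow> real"
  assumes A: "finite A" "A \<noteq> {}" "inj_on u A" and p: "degree p \<le> card A"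
  shows "(\<Sum>r\<in>A. poly p (u r) * (\<Prod>q\<in>A - {r}. (c - u q) / (u r - u q))) =
    poly p c - coeff p (card A) * (\<Prod>q\<in>A. c - u q)"
proof -
  define N where "N = card A"
  have N: "N > 0" using A by (auto simp: N_def card_gt_0_iff)
  define l where "l r = (\<Prod>q\<in>A - {r}. [:- u q, 1:])" for r
  define w where "w = (\<Prod>q\<in>A. [:- u q, 1:])"
  define L where "L = (\<Sum>r\<in>A. smult (poly p (u r) / (\<Prod>q\<in>A - {r}. u r - u q)) (l r))"
  define R where "R = p - smult (coeff p N) w"
  have dw: "degree w = N" "coeff w N = 1"
  proof -
    show d: "degree w = N" unfolding w_def N_def by (subst degree_prod_eq_sum_degree) auto
    have "lead_coeff w = 1" unfolding w_def by (simp add: lead_coeff_prod)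
    then show "coeff w N = 1" using d by simp
  qed
  have dl: "degree (l r) \<le> N - 1" if "r \<in> A" for r
  proof -
    have "degree (l r) = card (A - {r})" unfolding l_def by (subst degree_prod_eq_sum_degree) auto
    then show ?thesis using A that by (simp add: N_def)
  qed
  have pl: "poly (l r) x = (\<Prod>q\<in>A - {r}. x - u q)" for r x by (simp add: l_def poly_prod)
  have pw: "poly w x = (\<Prod>q\<in>A. x - u q)" for x by (simp add: w_def poly_prod)
  have "degree L \<le> N - 1"
    unfolding L_def using A dl by (intro degree_sum_le) (auto intro: order_trans[OF degree_smult_le])
  then have dL: "degree L < N" using N by simp
  have dR: "degree R < N"
  proof -
    have "degree R \<le> N" unfolding R_def using p dw
      by (intro degree_diff_le) (auto simp: N_def intro: order_trans[OF degree_smult_le])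
    moreover have "coeff R N = 0" by (simp add: R_def dw)
    ultimately show ?thesis using N by (metis le_neq_implies_less leading_coeff_0_iff degree_0)
  qed
  have "L = R"
  proof (rule poly_eqI_degree[of "u ` A"])
    fix x assume "x \<in> u ` A"
    then obtain s where s: "s \<in> A" "x = u s" by auto
    have z: "(\<Prod>q\<in>A - {r}. u s - u q) = 0" if "r \<in> A" "r \<noteq> s" for r
      using A s that by (intro prod_zero) auto
    have nz: "(\<Prod>q\<in>A - {s}. u s - u q) \<noteq> 0" using A s by (auto simp: inj_on_def)
    have "poly L x = (\<Sum>r\<in>A. poly p (u r) / (\<Prod>q\<in>A - {r}. u r - u q) * (\<Prod>q\<in>A - {r}. u s - u q))"
      by (simp add: L_def poly_sum pl s)
    also have "\<dots> = (\<Sum>r\<in>{s}. poly p (u r) / (\<Prod>q\<in>A - {r}. u r - u q) * (\<Prod>q\<in>A - {r}. u s - u q))"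
      using A s z by (intro sum.mono_neutral_right) auto
    also have "\<dots> = poly p (u s)" using nz by simp
    finally have "poly L x = poly p (u s)" .
    moreover have "poly w (u s) = 0" unfolding pw using A s by (intro prod_zero) auto
    ultimately show "poly L x = poly R x" by (simp add: R_def s)
  qed (use dL dR A in \<open>auto simp: N_def card_image\<close>)
  then have "poly L c = poly R c" by simp
  moreover have "poly L c = (\<Sum>r\<in>A. poly p (u r) * (\<Prod>q\<in>A - {r}. (c - u q) / (u r - u q)))"
    by (simp add: L_def poly_sum pl prod_dividef)
  ultimately show ?thesis by (simp add: R_def pw N_def)
qed

text \<open>Multiplying by \<open>vand A u\<close> clears the denominators. The summand of index
  \<open>r\<close> then involves \<open>u r\<close> through \<open>poly p (u r)\<close> only, so the
  integral over that coordinate splits off.\<close>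

lemma lagrange_vand:
  fixes p :: "real poly" and u :: "nat \<Rightarrow> real"
  assumes A: "finite A" "A \<noteq> {}" "inj_on u A" and p: "degree p \<le> card A"
  shows "(\<Sum>r\<in>A. (-1) ^ card {i\<in>A. i < r} * poly p (u r) * vand (A - {r}) u * (\<Prod>q\<in>A - {r}. c - u q)) =
    (poly p c - coeff p (card A) * (\<Prod>q\<in>A. c - u q)) * vand A u"
proof -
  have "(\<Sum>r\<in>A. (-1) ^ card {i\<in>A. i < r} * poly p (u r) * vand (A - {r}) u * (\<Prod>q\<in>A - {r}. c - u q)) =
    (\<Sum>r\<in>A. poly p (u r) * (\<Prod>q\<in>A - {r}. (c - u q) / (u r - u q)) * vand A u)"
  proof (intro sum.cong refl)
    fix r assume r: "r \<in> A"
    have nz: "(\<Prod>q\<in>A - {r}. u r - u q) \<noteq> 0" using A r by (auto simp: inj_on_def)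
    show "(-1) ^ card {i\<in>A. i < r} * poly p (u r) * vand (A - {r}) u * (\<Prod>q\<in>A - {r}. c - u q) =
      poly p (u r) * (\<Prod>q\<in>A - {r}. (c - u q) / (u r - u q)) * vand A u"
      unfolding vand_remove[OF A(1) r] prod_dividef using nz by simp
  qed
  also have "\<dots> = (poly p c - coeff p (card A) * (\<Prod>q\<in>A. c - u q)) * vand A u"
    unfolding lagrange_interpolation[OF A p, of c, symmetric] by (simp add: sum_distrib_right)
  finally show ?thesis .
qed

text \<open>The factor \<open>exp (2 * y)\<close> is the Jacobian of \<open>y \<mapsto> exp (2 * y)\<close> up to a constant. Since \<open>0 powr 0 = 0\<close>,
  the weight vanishes at the nodes even when \<open>\<kappa> s = 1\<close>.\<close>

definition node_weight :: "nat \<Rightarrow> (nat \<Rightarrow> real) \<Rightarrow> (nat \<Rightarrow> real) \<Rightarrow> real \<Rightarrow> real" where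
  "node_weight n \<kappa> X y = exp (2 * y) * (\<Prod>s=1..Suc n. \<bar>exp (2 * y) - exp (2 * X s)\<bar> powr (\<kappa> s - 1))"

definition cut_weight :: "nat \<Rightarrow> (nat \<Rightarrow> real) \<Rightarrow> (nat \<Rightarrow> real) \<Rightarrow> nat \<Rightarrow> real \<Rightarrow> real" where
  "cut_weight n \<kappa> X r y = indicator {X (Suc r)..X r} y * node_weight n \<kappa> X y"

lemma node_weight_nonneg: "0 \<le> node_weight n \<kappa> X y"
  by (auto simp: node_weight_def intro!: mult_nonneg_nonneg prod_nonneg)

lemma cut_weight_nonneg: "0 \<le> cut_weight n \<kappa> X r y"
  by (simp add: cut_weight_def node_weight_nonneg)

lemma node_weight_measurable [measurable]: "node_weight n \<kappa> X \<in> borel_measurable borel"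
  unfolding node_weight_def[abs_def] by measurable

lemma cut_weight_measurable [measurable]: "cut_weight n \<kappa> X r \<in> borel_measurable borel"
  unfolding cut_weight_def[abs_def] by measurable

section \<open>Integrability and exactness of the weight on one interval\<close>

lemma nn_integral_exp_powr_finite:
  assumes "\<kappa> > 0" "a \<le> b" "c \<le> exp (2 * a) \<or> exp (2 * b) \<le> c"
  shows "(\<integral>\<^sup>+y. ennreal (indicator {a..b} y * (exp (2 * y) * \<bar>exp (2 * y) - c\<bar> powr (\<kappa> - 1))) \<partial>lborel) < \<infinity>"
proof -
  have "\<exists>F. ((\<lambda>y. exp (2 * y) * \<bar>exp (2 * y) - c\<bar> powr (\<kappa> - 1)) has_integral (F b - F a)) {a..b}"
  proof (cases "c \<le> exp (2 * a)")
    case True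
    define F where "F y = (exp (2 * y) - c) powr \<kappa> / (2 * \<kappa>)" for y
    have "((\<lambda>y. exp (2 * y) * \<bar>exp (2 * y) - c\<bar> powr (\<kappa> - 1)) has_integral (F b - F a)) {a..b}"
    proof (rule fundamental_theorem_of_calculus_interior[OF assms(2)])
      have "c \<le> exp (2 * y)" if "y \<in> {a..b}" for y
        using that True by (intro order_trans[OF True]) auto
      then show "continuous_on {a..b} F" unfolding F_def using assms
        by (intro continuous_intros continuous_on_powr') auto
    next
      fix y assume "y \<in> {a<..<b}"
      then have "exp (2 * a) < exp (2 * y)" by simp
      with True have c: "0 < exp (2 * y) - c" by linarith
      show "(F has_vector_derivative exp (2 * y) * \<bar>exp (2 * y) - c\<bar> powr (\<kappa> - 1)) (at y)"
        unfolding F_def has_real_derivative_iff_has_vector_derivative[symmetric]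
        using c assms by (auto intro!: derivative_eq_intros simp: powr_diff field_simps)
    qed
    then show ?thesis by blast
  next
    case False
    with assms have c: "exp (2 * b) \<le> c" by simp
    define F where "F y = - ((c - exp (2 * y)) powr \<kappa> / (2 * \<kappa>))" for y
    have "((\<lambda>y. exp (2 * y) * \<bar>exp (2 * y) - c\<bar> powr (\<kappa> - 1)) has_integral (F b - F a)) {a..b}"
    proof (rule fundamental_theorem_of_calculus_interior[OF assms(2)])
      have "exp (2 * y) \<le> c" if "y \<in> {a..b}" for y
        using that by (intro order_trans[OF _ c]) auto
      then show "continuous_on {a..b} F" unfolding F_def using assms
        by (intro continuous_intros continuous_on_powr') auto
    next
      fix y assume "y \<in> {a<..<b}"
      then have "exp (2 * y) < exp (2 * b)" by simp
      with c have c: "0 < c - exp (2 * y)" by linarith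
      show "(F has_vector_derivative exp (2 * y) * \<bar>exp (2 * y) - c\<bar> powr (\<kappa> - 1)) (at y)"
        unfolding F_def has_real_derivative_iff_has_vector_derivative[symmetric]
        using c assms by (auto intro!: derivative_eq_intros simp: powr_diff field_simps)
    qed
    then show ?thesis by blast
  qed
  then obtain I where "((\<lambda>y. exp (2 * y) * \<bar>exp (2 * y) - c\<bar> powr (\<kappa> - 1)) has_integral I) {a..b}" by blast
  then have "(\<integral>\<^sup>+y. ennreal (indicator {a..b} y * (exp (2 * y) * \<bar>exp (2 * y) - c\<bar> powr (\<kappa> - 1))) \<partial>lborel) = ennreal I"
    by (intro nn_integral_has_integral_lebesgue) auto
  then show ?thesis by simp
qed

lemma exp_factor_bounded:
  assumes "finite S" "\<And>y s. y \<in> {a..b} \<Longrightarrow> s \<in> S \<Longrightarrow> y \<noteq> X s"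
  shows "\<exists>C\<ge>0. \<forall>y\<in>{a..b::real}. (\<Prod>s\<in>S. \<bar>exp (2 * y) - exp (2 * X s)\<bar> powr (\<kappa> s - 1)) \<le> C"
proof -
  have "continuous_on {a..b} (\<lambda>y. \<Prod>s\<in>S. \<bar>exp (2 * y) - exp (2 * X s)\<bar> powr (\<kappa> s - 1))"
    using assms by (intro continuous_intros continuous_on_powr) auto
  then have "compact ((\<lambda>y. \<Prod>s\<in>S. \<bar>exp (2 * y) - exp (2 * X s)\<bar> powr (\<kappa> s - 1)) ` {a..b})"
    by (intro compact_continuous_image) auto
  then have "bounded ((\<lambda>y. \<Prod>s\<in>S. \<bar>exp (2 * y) - exp (2 * X s)\<bar> powr (\<kappa> s - 1)) ` {a..b})"
    by (rule compact_imp_bounded)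
  then obtain C where "\<forall>v\<in>(\<lambda>y. \<Prod>s\<in>S. \<bar>exp (2 * y) - exp (2 * X s)\<bar> powr (\<kappa> s - 1)) ` {a..b}. norm v \<le> C"
    unfolding bounded_iff by blast
  then have C: "\<bar>\<Prod>s\<in>S. \<bar>exp (2 * y) - exp (2 * X s)\<bar> powr (\<kappa> s - 1)\<bar> \<le> C" if "y \<in> {a..b}" for y
    using that unfolding real_norm_def by blast
  show ?thesis
  proof (intro exI[of _ "max 0 C"] conjI ballI)
    fix y assume "y \<in> {a..b}"
    from C[OF this] show "(\<Prod>s\<in>S. \<bar>exp (2 * y) - exp (2 * X s)\<bar> powr (\<kappa> s - 1)) \<le> max 0 C" by linarith
  qed simp
qed

text \<open>Cut at the midpoint \<open>d\<close>, each half touches one node only. The factor of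
  that node is integrable by an explicit primitive, and the remaining factors are bounded by
  compactness.\<close>

lemma integrable_cut_weight:
  assumes X: "X \<in> chamber (Suc n)" and r: "r \<in> {1..n}" and \<kappa>: "\<kappa> r > 0" "\<kappa> (Suc r) > 0"
  shows "integrable lborel (cut_weight n \<kappa> X r)"
proof -
  define a b where "a = X (Suc r)" and "b = X r"
  define d where "d = (a + b) / 2"
  have ab: "a < b" using chamberD[OF X, of r "Suc r"] r by (simp add: a_def b_def)
  have d: "a < d" "d < b" using ab by (auto simp: d_def)
  have sep: "X s \<notin> {a<..<b}" if "s \<in> {1..Suc n}" for s
    using chamberD[OF X, of s r] chamberD[OF X, of "Suc r" s] that r
    by (cases "s < r"; cases "s = r"; cases "s = Suc r") (auto simp: a_def b_def)
  define S where "S = {1..Suc n}"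
  have "\<exists>C\<ge>0. \<forall>y\<in>{d..b}. (\<Prod>s\<in>S - {r}. \<bar>exp (2 * y) - exp (2 * X s)\<bar> powr (\<kappa> s - 1)) \<le> C"
  proof (rule exp_factor_bounded)
    fix y s assume y: "y \<in> {d..b}" and s: "s \<in> S - {r}"
    have "X s \<noteq> b" using chamberD[OF X, of s r] chamberD[OF X, of r s] s r
      by (cases "s < r") (auto simp: S_def b_def)
    with y sep[of s] s d show "y \<noteq> X s" by (auto simp: S_def)
  qed (simp add: S_def)
  then obtain C1 where C1: "0 \<le> C1" "\<And>y. y \<in> {d..b} \<Longrightarrow> (\<Prod>s\<in>S - {r}. \<bar>exp (2 * y) - exp (2 * X s)\<bar> powr (\<kappa> s - 1)) \<le> C1" by blast
  have "\<exists>C\<ge>0. \<forall>y\<in>{a..d}. (\<Prod>s\<in>S - {Suc r}. \<bar>exp (2 * y) - exp (2 * X s)\<bar> powr (\<kappa> s - 1)) \<le> C"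
  proof (rule exp_factor_bounded)
    fix y s assume y: "y \<in> {a..d}" and s: "s \<in> S - {Suc r}"
    have "X s \<noteq> a" using chamberD[OF X, of s "Suc r"] chamberD[OF X, of "Suc r" s] s r
      by (cases "s < Suc r") (auto simp: S_def a_def)
    with y sep[of s] s d show "y \<noteq> X s" by (auto simp: S_def)
  qed (simp add: S_def)
  then obtain C2 where C2: "0 \<le> C2" "\<And>y. y \<in> {a..d} \<Longrightarrow> (\<Prod>s\<in>S - {Suc r}. \<bar>exp (2 * y) - exp (2 * X s)\<bar> powr (\<kappa> s - 1)) \<le> C2" by blast
  define g where "g s y = indicator {a..b} y * (exp (2 * y) * \<bar>exp (2 * y) - exp (2 * X s)\<bar> powr (\<kappa> s - 1))" for s y
  have g0: "0 \<le> g s y" for s y by (simp add: g_def)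
  have [measurable]: "g s \<in> borel_measurable borel" for s unfolding g_def[abs_def] by measurable
  have fin: "(\<integral>\<^sup>+y. ennreal (g r y) \<partial>lborel) < \<infinity>" "(\<integral>\<^sup>+y. ennreal (g (Suc r) y) \<partial>lborel) < \<infinity>"
    unfolding g_def using ab \<kappa> nn_integral_exp_powr_finite[of "\<kappa> r" a b "exp (2 * X r)"]
      nn_integral_exp_powr_finite[of "\<kappa> (Suc r)" a b "exp (2 * X (Suc r))"]
    by (simp_all add: a_def b_def)
  have pw: "ennreal (cut_weight n \<kappa> X r y) \<le> ennreal C1 * ennreal (g r y) + ennreal C2 * ennreal (g (Suc r) y)" for y
  proof (cases "y \<in> {a..b}")
    case True
    have rem: "node_weight n \<kappa> X y = exp (2 * y) * \<bar>exp (2 * y) - exp (2 * X s)\<bar> powr (\<kappa> s - 1) *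
       (\<Prod>s\<in>S - {s}. \<bar>exp (2 * y) - exp (2 * X s)\<bar> powr (\<kappa> s - 1))" if "s \<in> S" for s
      using that prod.remove[of S s "\<lambda>s. \<bar>exp (2 * y) - exp (2 * X s)\<bar> powr (\<kappa> s - 1)"]
      by (simp add: node_weight_def S_def)
    have rS: "r \<in> S" "Suc r \<in> S" using r by (auto simp: S_def)
    have b1: "cut_weight n \<kappa> X r y = node_weight n \<kappa> X y" using True by (simp add: cut_weight_def a_def b_def)
    have "cut_weight n \<kappa> X r y \<le> C1 * g r y + C2 * g (Suc r) y"
    proof (cases "d \<le> y")
      case d: True
      have "node_weight n \<kappa> X y \<le> exp (2 * y) * \<bar>exp (2 * y) - exp (2 * X r)\<bar> powr (\<kappa> r - 1) * C1"
        unfolding rem[OF rS(1)] using d True by (intro mult_left_mono C1(2)) auto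
      also have "\<dots> = C1 * g r y" using True by (simp add: g_def)
      also have "\<dots> \<le> C1 * g r y + C2 * g (Suc r) y" using C2(1) g0 by simp
      finally show ?thesis by (simp add: b1)
    next
      case d: False
      have "node_weight n \<kappa> X y \<le> exp (2 * y) * \<bar>exp (2 * y) - exp (2 * X (Suc r))\<bar> powr (\<kappa> (Suc r) - 1) * C2"
        unfolding rem[OF rS(2)] using d True by (intro mult_left_mono C2(2)) auto
      also have "\<dots> = C2 * g (Suc r) y" using True by (simp add: g_def)
      also have "\<dots> \<le> C1 * g r y + C2 * g (Suc r) y" using C1(1) g0 by simp
      finally show ?thesis by (simp add: b1)
    qed
    then have "ennreal (cut_weight n \<kappa> X r y) \<le> ennreal (C1 * g r y + C2 * g (Suc r) y)" by (rule ennreal_leI)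
    then show ?thesis using C1(1) C2(1) g0 by (simp add: ennreal_mult)
  next
    case False
    then show ?thesis by (simp add: cut_weight_def a_def b_def)
  qed
  have "(\<integral>\<^sup>+y. ennreal (cut_weight n \<kappa> X r y) \<partial>lborel) \<le> (\<integral>\<^sup>+y. ennreal C1 * ennreal (g r y) + ennreal C2 * ennreal (g (Suc r) y) \<partial>lborel)"
    by (intro nn_integral_mono pw)
  also have "\<dots> = ennreal C1 * (\<integral>\<^sup>+y. ennreal (g r y) \<partial>lborel) + ennreal C2 * (\<integral>\<^sup>+y. ennreal (g (Suc r) y) \<partial>lborel)"
    by (simp add: nn_integral_add nn_integral_cmult)
  also have "\<dots> < \<infinity>" using fin by (simp add: ennreal_mult_less_top)
  finally show ?thesis by (intro integrableI_nonneg) (auto simp: cut_weight_nonneg)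
qed

lemma integrable_cut_weight_mult:
  assumes X: "X \<in> chamber (Suc n)" and r: "r \<in> {1..n}" and \<kappa>: "\<kappa> r > 0" "\<kappa> (Suc r) > 0"
    and f: "continuous_on UNIV f"
  shows "integrable lborel (\<lambda>y. f y * cut_weight n \<kappa> X r y)"
proof -
  have "compact (f ` {X (Suc r)..X r})"
    by (intro compact_continuous_image continuous_on_subset[OF f]) auto
  then have "bounded (f ` {X (Suc r)..X r})" by (rule compact_imp_bounded)
  then obtain C where "\<forall>v\<in>f ` {X (Suc r)..X r}. norm v \<le> C" unfolding bounded_iff by blast
  then have C: "\<bar>f y\<bar> \<le> C" if "y \<in> {X (Suc r)..X r}" for y using that by auto
  have [measurable]: "f \<in> borel_measurable borel" using f by (rule borel_measurable_continuous_onI)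
  show ?thesis
  proof (rule Bochner_Integration.integrable_bound)
    show "integrable lborel (\<lambda>y. C * cut_weight n \<kappa> X r y)" using integrable_cut_weight[OF X r \<kappa>] by simp
    show "AE y in lborel. norm (f y * cut_weight n \<kappa> X r y) \<le> norm (C * cut_weight n \<kappa> X r y)"
    proof (rule AE_I2)
      fix y show "norm (f y * cut_weight n \<kappa> X r y) \<le> norm (C * cut_weight n \<kappa> X r y)"
        using C[of y] by (cases "y \<in> {X (Suc r)..X r}") (auto simp: abs_mult cut_weight_def intro!: mult_right_mono)
    qed
  qed simp
qed

text \<open>Up to sign the integrand is the derivative of the product of all
  \<open>\<bar>exp (2 y) - exp (2 X s)\<bar> powr \<kappa> s\<close>, which vanishes at both ends of the interval.\<close>

lemma integral_cut_weight_exact: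
  assumes X: "X \<in> chamber (Suc n)" and r: "r \<in> {1..n}" and \<kappa>: "\<And>s. s \<in> {1..Suc n} \<Longrightarrow> \<kappa> s > 0"
  shows "(\<integral>y. (\<Sum>s=1..Suc n. \<kappa> s * (\<Prod>t\<in>{1..Suc n} - {s}. exp (2 * y) - exp (2 * X t))) * cut_weight n \<kappa> X r y \<partial>lborel) = 0"
proof -
  define S where "S = {1..Suc n}"
  define a b where "a = X (Suc r)" and "b = X r"
  have ab: "a < b" using chamberD[OF X, of r "Suc r"] r by (simp add: a_def b_def)
  have rS: "r \<in> S" "Suc r \<in> S" using r by (auto simp: S_def)
  \<comment> \<open>The signs of the differences are constant inside the interval. With them the
    absolute values become differentiable products, and \<open>\<sigma>p\<close> is the constant
    sign in front of the derivative.\<close>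
  define \<sigma> :: "nat \<Rightarrow> real" where "\<sigma> s = (if s \<le> r then -1 else 1)" for s
  define \<sigma>p where "\<sigma>p = (\<Prod>s\<in>S. \<sigma> s)"
  have esinh: "\<sigma>p * \<sigma>p = 1" unfolding \<sigma>p_def prod.distrib[symmetric] by (intro prod.neutral) (auto simp: \<sigma>_def)
  define e where "e s y = exp (2 * y) - exp (2 * X s)" for s y
  define p where "p y = (\<Sum>s\<in>S. \<kappa> s * (\<Prod>t\<in>S - {s}. e t y))" for y
  define F where "F y = (\<Prod>s\<in>S. \<bar>e s y\<bar> powr \<kappa> s)" for y
  have sgn: "0 < \<sigma> s * e s y" if "s \<in> S" "y \<in> {a<..<b}" for s y
  proof (cases "s \<le> r")
    case True
    have "X r \<le> X s" using True chamberD[OF X, of s r] that r by (cases "s = r") (auto simp: S_def)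
    then show ?thesis using that True by (simp add: \<sigma>_def e_def b_def)
  next
    case False
    have "X s \<le> X (Suc r)" using False chamberD[OF X, of "Suc r" s] that r by (cases "s = Suc r") (auto simp: S_def)
    then show ?thesis using that False by (simp add: \<sigma>_def e_def a_def)
  qed
  have ab': "\<bar>e s y\<bar> = \<sigma> s * e s y" if "s \<in> S" "y \<in> {a<..<b}" for s y
    using sgn[OF that] by (auto simp: \<sigma>_def split: if_splits)
  have HI: "((\<lambda>y. 2 * \<sigma>p * (p y * node_weight n \<kappa> X y)) has_integral (F b - F a)) {a..b}"
  proof (rule fundamental_theorem_of_calculus_interior)
    show "a \<le> b" using ab by simp
    show "continuous_on {a..b} F" unfolding F_def e_def
      using \<kappa> by (intro continuous_intros continuous_on_powr') (auto simp: S_def)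
  next
    fix y assume y: "y \<in> {a<..<b}"
    define G where "G z = (\<Prod>s\<in>S. (\<sigma> s * e s z) powr \<kappa> s)" for z
    have "(G has_field_derivative (\<Prod>s\<in>S. (\<sigma> s * e s y) powr \<kappa> s) *
       (\<Sum>s\<in>S. (\<kappa> s * (2 * exp (2 * y)) / e s y * (\<sigma> s * e s y) powr \<kappa> s) / (\<sigma> s * e s y) powr \<kappa> s)) (at y)"
      unfolding G_def
    proof (rule has_field_derivative_prod')
      fix s assume s: "s \<in> S"
      note p = sgn[OF s y]
      show "(\<sigma> s * e s y) powr \<kappa> s \<noteq> 0" using p by (auto simp: zero_less_mult_iff)
      have "((\<lambda>u. \<sigma> s * e s u) has_field_derivative \<sigma> s * (2 * exp (2 * y))) (at y)"
        unfolding e_def by (auto intro!: derivative_eq_intros)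
      from DERIV_powr[OF this p DERIV_const, of "\<kappa> s"]
      show "((\<lambda>u. (\<sigma> s * e s u) powr \<kappa> s) has_field_derivative
        \<kappa> s * (2 * exp (2 * y)) / e s y * (\<sigma> s * e s y) powr \<kappa> s) (at y)"
        using p by (auto simp: field_simps \<sigma>_def split: if_splits)
    qed
    also have "(\<Sum>s\<in>S. (\<kappa> s * (2 * exp (2 * y)) / e s y * (\<sigma> s * e s y) powr \<kappa> s) / (\<sigma> s * e s y) powr \<kappa> s)
      = (\<Sum>s\<in>S. \<kappa> s * (2 * exp (2 * y)) / e s y)"
    proof (intro sum.cong refl nonzero_mult_div_cancel_right)
      show "(\<sigma> s * e s y) powr \<kappa> s \<noteq> 0" if "s \<in> S" for s
        using sgn[OF that y] by (auto simp: zero_less_mult_iff)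
    qed
    also have "(\<Prod>s\<in>S. (\<sigma> s * e s y) powr \<kappa> s) = (\<Prod>s\<in>S. (\<sigma> s * e s y) powr (\<kappa> s - 1)) * (\<sigma>p * (\<Prod>s\<in>S. e s y))"
      unfolding \<sigma>p_def prod.distrib[symmetric]
    proof (intro prod.cong refl)
      fix s assume "s \<in> S"
      from sgn[OF this y] show "(\<sigma> s * e s y) powr \<kappa> s = (\<sigma> s * e s y) powr (\<kappa> s - 1) * (\<sigma> s * e s y)"
        by (simp add: powr_diff)
    qed
    also have "(\<Prod>s\<in>S. (\<sigma> s * e s y) powr (\<kappa> s - 1)) * (\<sigma>p * (\<Prod>s\<in>S. e s y)) * (\<Sum>s\<in>S. \<kappa> s * (2 * exp (2 * y)) / e s y) =
       2 * \<sigma>p * (p y * node_weight n \<kappa> X y)"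
    proof -
      have "(\<Prod>s\<in>S. e s y) * (\<Sum>s\<in>S. \<kappa> s * (2 * exp (2 * y)) / e s y) = 2 * exp (2 * y) * p y"
        unfolding p_def sum_distrib_left
      proof (intro sum.cong refl)
        fix s assume s: "s \<in> S"
        have "(\<Prod>s\<in>S. e s y) = e s y * (\<Prod>t\<in>S - {s}. e t y)" using s by (intro prod.remove) (auto simp: S_def)
        moreover have "e s y \<noteq> 0" using sgn[OF s y] by auto
        ultimately show "(\<Prod>s\<in>S. e s y) * (\<kappa> s * (2 * exp (2 * y)) / e s y) = 2 * exp (2 * y) * (\<kappa> s * (\<Prod>t\<in>S - {s}. e t y))"
          by simp
      qed
      moreover have "node_weight n \<kappa> X y = exp (2 * y) * (\<Prod>s\<in>S. (\<sigma> s * e s y) powr (\<kappa> s - 1))"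
        unfolding node_weight_def S_def[symmetric] using ab'[OF _ y] by (simp add: e_def)
      ultimately show ?thesis by (simp add: mult_ac)
    qed
    finally have "(G has_field_derivative 2 * \<sigma>p * (p y * node_weight n \<kappa> X y)) (at y)" .
    then have "(F has_field_derivative 2 * \<sigma>p * (p y * node_weight n \<kappa> X y)) (at y)"
    proof (rule has_field_derivative_transform_within_open[of _ _ _ "{a<..<b}"])
      show "G z = F z" if "z \<in> {a<..<b}" for z
        unfolding G_def F_def using ab'[OF _ that] by simp
    qed (use y in auto)
    then show "(F has_vector_derivative 2 * \<sigma>p * (p y * node_weight n \<kappa> X y)) (at y)"
      by (simp add: has_real_derivative_iff_has_vector_derivative)
  qed
  have "F b = 0" unfolding F_def using rS(1) by (intro prod_zero bexI[of _ r]) (auto simp: S_def e_def b_def)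
  moreover have "F a = 0" unfolding F_def using rS(2) by (intro prod_zero bexI[of _ "Suc r"]) (auto simp: S_def e_def a_def)
  ultimately have HI0: "((\<lambda>y. 2 * \<sigma>p * (p y * node_weight n \<kappa> X y)) has_integral 0) {a..b}" using HI by simp
  have cont: "continuous_on UNIV p" unfolding p_def e_def by (intro continuous_intros)
  have int: "integrable lborel (\<lambda>y. p y * cut_weight n \<kappa> X r y)"
    using rS by (intro integrable_cut_weight_mult[OF X r _ _ cont] \<kappa>) (auto simp: S_def)
  have si: "set_integrable lborel {a..b} (\<lambda>y. 2 * \<sigma>p * (p y * node_weight n \<kappa> X y))"
  proof -
    have "(\<lambda>y. indicat_real {a..b} y *\<^sub>R (2 * \<sigma>p * (p y * node_weight n \<kappa> X y))) = (\<lambda>y. 2 * \<sigma>p * (p y * cut_weight n \<kappa> X r y))"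
      by (auto simp: cut_weight_def a_def b_def fun_eq_iff)
    then show ?thesis unfolding set_integrable_def using int by simp
  qed
  have "(LINT y:{a..b}|lborel. 2 * \<sigma>p * (p y * node_weight n \<kappa> X y)) = integral {a..b} (\<lambda>y. 2 * \<sigma>p * (p y * node_weight n \<kappa> X y))"
    by (rule set_borel_integral_eq_integral(2)[OF si])
  also have "\<dots> = 0" using HI0 by (rule integral_unique)
  finally have "(\<integral>y. 2 * \<sigma>p * (p y * cut_weight n \<kappa> X r y) \<partial>lborel) = 0"
    unfolding set_lebesgue_integral_def by (simp add: cut_weight_def a_def b_def mult_ac)
  moreover have "\<sigma>p \<noteq> 0" using esinh by auto
  ultimately have "(\<integral>y. p y * cut_weight n \<kappa> X r y \<partial>lborel) = 0" by simp
  then show ?thesis by (simp add: p_def e_def S_def)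
qed

section \<open>Topology and measure on finite products\<close>

lemma compact_PiE_nat:
  fixes A :: "nat set" and K :: "nat \<Rightarrow> real set"
  assumes "\<And>i. i \<in> A \<Longrightarrow> compact (K i)"
  shows "compact (PiE A K)"
proof -
  \<comment> \<open>Extensional functions form a full product with the compact factor
    \<open>{undefined}\<close> outside \<open>A\<close>, to which Tychonoff's theorem
    applies.\<close>
  have "PiE A K = PiE UNIV (\<lambda>i. if i \<in> A then K i else {undefined})"
    by (auto simp: PiE_iff extensional_def split: if_splits)
  moreover have "compactin (product_topology (\<lambda>i. euclidean) UNIV) (PiE UNIV (\<lambda>i. if i \<in> A then K i else {undefined}))"
    unfolding compactin_PiE using assms by (auto simp: compactin_euclidean_iff)
  ultimately show ?thesis by (simp add: euclidean_product_topology compactin_euclidean_iff)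
qed

lemma continuous_on_component [continuous_intros]: "continuous_on S (\<lambda>X::nat \<Rightarrow> real. X i)"
  by (rule continuous_on_subset[OF continuous_on_product_coordinates]) auto

text \<open>Continuity is used in the product topology on all of
  \<open>nat \<Rightarrow> real\<close>, integration on finitely many coordinates. The link is that
  the other coordinates are constantly \<open>undefined\<close> on the space of the finite
  product.\<close>

lemma measurable_PiM_borel: "(\<lambda>Y. Y) \<in> Pi\<^sub>M {1..n::nat} (\<lambda>_. lborel) \<rightarrow>\<^sub>M (borel :: (nat \<Rightarrow> real) measure)"
proof -
  have "(\<lambda>Y. Y) \<in> Pi\<^sub>M {1..n} (\<lambda>_. lborel) \<rightarrow>\<^sub>M Pi\<^sub>M (UNIV :: nat set) (\<lambda>_. borel :: real measure)"
  proof (rule measurable_PiM_single')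
    fix i :: nat
    show "(\<lambda>Y. Y i) \<in> Pi\<^sub>M {1..n} (\<lambda>_. lborel) \<rightarrow>\<^sub>M (borel :: real measure)"
    proof (cases "i \<in> {1..n}")
      case True
      then show ?thesis using measurable_component_singleton[OF True, of "\<lambda>_. lborel :: real measure"] by simp
    next
      case False
      have "(\<lambda>Y. Y i) \<in> Pi\<^sub>M {1..n} (\<lambda>_. lborel) \<rightarrow>\<^sub>M (borel :: real measure) \<longleftrightarrow>
        (\<lambda>Y. undefined) \<in> Pi\<^sub>M {1..n} (\<lambda>_. lborel :: real measure) \<rightarrow>\<^sub>M (borel :: real measure)"
        using False by (intro measurable_cong) (auto simp: space_PiM PiE_iff extensional_def)
      then show ?thesis by simp
    qed
  qed auto
  then show ?thesis
    by (subst measurable_cong_sets[OF refl sets_PiM_equal_borel[symmetric]])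
qed

lemma borel_measurable_PiM:
  "F \<in> borel_measurable (borel :: (nat \<Rightarrow> real) measure) \<Longrightarrow> F \<in> borel_measurable (Pi\<^sub>M {1..n::nat} (\<lambda>_. lborel))"
  using measurable_compose[OF measurable_PiM_borel] by simp

lemma PiM_component_borel: "f \<in> borel_measurable borel \<Longrightarrow> i \<in> {1..n} \<Longrightarrow>
    (\<lambda>Y. f (Y i) :: real) \<in> borel_measurable (Pi\<^sub>M {1..n::nat} (\<lambda>_. lborel :: real measure))"
  by (rule measurable_compose[OF measurable_component_singleton]) auto

definition box_measure :: "nat \<Rightarrow> (nat \<Rightarrow> real) measure" where "box_measure n = Pi\<^sub>M {1..n} (\<lambda>_. lborel)"

lemma not_interlacing:
  assumes "Y \<in> space (box_measure n)" "Y \<notin> interlacing n X"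
  obtains r where "r \<in> {1..n}" "Y r \<notin> {X (Suc r)..X r}"
proof -
  have "\<exists>r\<in>{1..n}. Y r \<notin> {X (Suc r)..X r}"
  proof (rule ccontr)
    assume "\<not> ?thesis"
    then have "Y \<in> interlacing n X"
      using assms(1) by (auto simp: box_measure_def interlacing_def space_PiM PiE_iff)
    with assms(2) show False ..
  qed
  then show thesis using that by blast
qed

lemma prod_cut_weight_eq_0:
  assumes "Y \<in> space (box_measure n)" "Y \<notin> interlacing n X"
  shows "(\<Prod>r=1..n. cut_weight n \<kappa> X r (Y r)) = 0"
proof -
  obtain r where "r \<in> {1..n}" "Y r \<notin> {X (Suc r)..X r}"
    using not_interlacing[OF assms] .
  then show ?thesis by (intro prod_zero bexI[of _ r]) (auto simp: cut_weight_def)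
qed

lemma interlacing_compact: "compact (interlacing n X)"
  unfolding interlacing_def by (intro compact_PiE_nat) auto

definition pos_params :: "nat \<Rightarrow> (nat \<Rightarrow> real) \<Rightarrow> bool" where
  "pos_params n \<kappa> \<longleftrightarrow> (\<forall>s\<in>{1..Suc n}. 0 < \<kappa> s)"

text \<open>The closed set \<open>C\<close> allows integrands that are continuous on the closed
  chamber only, as the hypergeometric function of the lower rank is.\<close>

lemma integrable_prod_gen:
  fixes F :: "(nat \<Rightarrow> real) \<Rightarrow> real" and g :: "nat \<Rightarrow> real \<Rightarrow> real"
  assumes C: "closed C" "interlacing n X \<subseteq> C" "continuous_on C F"
    and g: "\<And>r. r \<in> {1..n} \<Longrightarrow> integrable lborel (g r)"
      "\<And>r y. r \<in> {1..n} \<Longrightarrow> y \<notin> {X (Suc r)..X r} \<Longrightarrow> g r y = 0"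
  shows "integrable (box_measure n) (\<lambda>Y. F Y * (\<Prod>r=1..n. g r (Y r)))"
proof -
  interpret product_sigma_finite "\<lambda>_::nat. lborel :: real measure" by (rule product_sigma_finite_lborel)
  have "compact (F ` interlacing n X)"
    by (intro compact_continuous_image interlacing_compact continuous_on_subset[OF C(3) C(2)])
  then have "bounded (F ` interlacing n X)" by (rule compact_imp_bounded)
  then obtain B where "\<forall>v\<in>F ` interlacing n X. norm v \<le> B" unfolding bounded_iff by blast
  then have B: "\<bar>F Y\<bar> \<le> B" if "Y \<in> interlacing n X" for Y using that by auto
  have z: "(\<Prod>r=1..n. g r (Y r)) = 0" if Y: "Y \<in> space (box_measure n)" "Y \<notin> interlacing n X" for Y
  proof -
    obtain r where "r \<in> {1..n}" "Y r \<notin> {X (Suc r)..X r}"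
      using not_interlacing[OF Y] .
    then show ?thesis using g(2)[of r "Y r"] by (intro prod_zero bexI[of _ r]) auto
  qed
  have gm: "(\<lambda>Y. \<Prod>r=1..n. g r (Y r)) \<in> borel_measurable (box_measure n)"
    unfolding box_measure_def using g(1) by (intro borel_measurable_prod PiM_component_borel) auto
  have Cb: "C \<in> sets borel" using C(1) by auto
  have "(\<lambda>Y. indicat_real C Y *\<^sub>R F Y) \<in> borel_measurable (box_measure n)"
    unfolding box_measure_def by (intro borel_measurable_PiM borel_measurable_continuous_on_indicator Cb C(3))
  then have "(\<lambda>Y. (indicat_real C Y *\<^sub>R F Y) * (\<Prod>r=1..n. g r (Y r))) \<in> borel_measurable (box_measure n)"
    using gm by (rule borel_measurable_times)
  moreover have "(\<lambda>Y. F Y * (\<Prod>r=1..n. g r (Y r))) \<in> borel_measurable (box_measure n) \<longleftrightarrow>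
      (\<lambda>Y. (indicat_real C Y *\<^sub>R F Y) * (\<Prod>r=1..n. g r (Y r))) \<in> borel_measurable (box_measure n)"
  proof (rule measurable_cong)
    fix Y assume "Y \<in> space (box_measure n)"
    then show "F Y * (\<Prod>r=1..n. g r (Y r)) = (indicat_real C Y *\<^sub>R F Y) * (\<Prod>r=1..n. g r (Y r))"
      using z[of Y] C(2) by (cases "Y \<in> interlacing n X") auto
  qed
  ultimately have meas: "(\<lambda>Y. F Y * (\<Prod>r=1..n. g r (Y r))) \<in> borel_measurable (box_measure n)" by simp
  show ?thesis
  proof (rule Bochner_Integration.integrable_bound[OF _ meas])
    show "integrable (box_measure n) (\<lambda>Y. B * (\<Prod>r=1..n. \<bar>g r (Y r)\<bar>))"
      unfolding box_measure_def using g(1) by (intro integrable_mult_right product_integrable_prod) auto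
    show "AE Y in box_measure n. norm (F Y * (\<Prod>r=1..n. g r (Y r))) \<le> norm (B * (\<Prod>r=1..n. \<bar>g r (Y r)\<bar>))"
    proof (rule AE_I2)
      fix Y assume Y: "Y \<in> space (box_measure n)"
      show "norm (F Y * (\<Prod>r=1..n. g r (Y r))) \<le> norm (B * (\<Prod>r=1..n. \<bar>g r (Y r)\<bar>))"
      proof (cases "Y \<in> interlacing n X")
        case True
        from B[OF this] show ?thesis by (auto simp: abs_mult abs_prod intro!: mult_right_mono prod_nonneg)
      next
        case False
        show ?thesis by (simp only: z[OF Y False] mult_zero_right norm_zero norm_ge_zero)
      qed
    qed
  qed
qed

lemma integrable_prod_cut_weight:
  assumes X: "X \<in> chamber (Suc n)" and \<kappa>: "pos_params n \<kappa>"
    and C: "closed C" "interlacing n X \<subseteq> C" "continuous_on C F"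
  shows "integrable (box_measure n) (\<lambda>Y. F Y * (\<Prod>r=1..n. cut_weight n \<kappa> X r (Y r)))"
proof (rule integrable_prod_gen[OF C])
  show "integrable lborel (cut_weight n \<kappa> X r)" if "r \<in> {1..n}" for r
    using \<kappa> that by (intro integrable_cut_weight[OF X that]) (auto simp: pos_params_def)
qed (auto simp: cut_weight_def)

section \<open>The Dixon integral and its moments\<close>

definition exp_vand :: "nat \<Rightarrow> (nat \<Rightarrow> real) \<Rightarrow> real" where "exp_vand n Y = vand {1..n} (\<lambda>i. exp (2 * Y i))"

text \<open>With \<open>u = exp (2 * y)\<close> and \<open>v = exp (2 * x)\<close> this is
  \<open>2 ^ n\<close> times smaller than the integral over interlacing \<open>u\<close> of
  \<open>F\<close> against the Vandermonde product of \<open>u\<close> times all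
  \<open>\<bar>u r - v s\<bar> powr (\<kappa> s - 1)\<close>. The exponents depend on the node
  because they are raised one at a time.\<close>

definition dixon :: "nat \<Rightarrow> (nat \<Rightarrow> real) \<Rightarrow> (nat \<Rightarrow> real) \<Rightarrow> ((nat \<Rightarrow> real) \<Rightarrow> real) \<Rightarrow> real" where
  "dixon n \<kappa> X F = (\<integral>Y. F Y * (exp_vand n Y * (\<Prod>r=1..n. cut_weight n \<kappa> X r (Y r))) \<partial>box_measure n)"

lemma continuous_on_vand [continuous_intros]:
  "(\<And>i. i \<in> A \<Longrightarrow> continuous_on S (\<lambda>x. u x i)) \<Longrightarrow> continuous_on S (\<lambda>x. vand A (u x))"
  unfolding vand_def by (intro continuous_intros) auto

lemma continuous_on_exp_vand [continuous_intros]: "continuous_on S (exp_vand n)"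
  unfolding exp_vand_def[abs_def] by (intro continuous_intros)

lemma integrable_dixon:
  assumes X: "X \<in> chamber (Suc n)" and \<kappa>: "pos_params n \<kappa>"
    and C: "closed C" "interlacing n X \<subseteq> C" "continuous_on C F"
  shows "integrable (box_measure n) (\<lambda>Y. F Y * (exp_vand n Y * (\<Prod>r=1..n. cut_weight n \<kappa> X r (Y r))))"
  using integrable_prod_cut_weight[OF X \<kappa> C(1,2), of "\<lambda>Y. F Y * exp_vand n Y"] C(3)
  by (simp add: mult.assoc continuous_on_mult continuous_on_exp_vand)

lemma weight_nonneg:
  assumes "X \<in> chamber (Suc n)" "Y \<in> space (box_measure n)"
  shows "0 \<le> exp_vand n Y * (\<Prod>r=1..n. cut_weight n \<kappa> X r (Y r))"
proof (cases "Y \<in> interlacing n X")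
  case True
  have "0 \<le> exp_vand n Y" unfolding exp_vand_def vand_def
    using interlacingD(4)[OF assms(1) True] by (intro prod_nonneg) auto
  then show ?thesis by (intro mult_nonneg_nonneg prod_nonneg) (auto simp: cut_weight_nonneg)
next
  case False
  show ?thesis by (simp only: prod_cut_weight_eq_0[OF assms(2) False] mult_zero_right)
qed

text \<open>Replacing the integrand at index \<open>r\<close> by one with integral zero kills the whole integral,
  by Fubini in that coordinate.\<close>

lemma integral_coord_factor:
  fixes f h :: "(nat \<Rightarrow> real) \<Rightarrow> real" and \<theta> :: "real \<Rightarrow> real"
  assumes r: "r \<in> {1..n}" and int: "integrable (box_measure n) f"
    and f: "\<And>x y. f (x(r := y)) = h x * \<theta> y"
  shows "integral\<^sup>L (box_measure n) f = (\<integral>x. h x \<partial>Pi\<^sub>M ({1..n} - {r}) (\<lambda>_. lborel :: real measure)) * (\<integral>y. \<theta> y \<partial>lborel)"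
proof -
  interpret product_sigma_finite "\<lambda>_::nat. lborel :: real measure" by (rule product_sigma_finite_lborel)
  have ins: "insert r ({1..n} - {r}) = {1..n}" using r by auto
  have "integral\<^sup>L (Pi\<^sub>M (insert r ({1..n} - {r})) (\<lambda>_. lborel)) f =
    (\<integral>x. (\<integral>y. f (x(r := y)) \<partial>lborel) \<partial>Pi\<^sub>M ({1..n} - {r}) (\<lambda>_. lborel))"
    using int by (intro product_integral_insert) (simp_all only: ins box_measure_def, simp_all)
  then show ?thesis unfolding ins by (simp add: box_measure_def f)
qed

lemma vand_cong: "(\<And>i. i \<in> A \<Longrightarrow> u i = v i) \<Longrightarrow> vand A u = vand A v"
  unfolding vand_def by (intro prod.cong) auto

text \<open>If two of the points coincide then the weight vanishes, so the interpolation identity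
  may be used under the integral.\<close>

lemma prod_cut_weight_inj:
  assumes X: "X \<in> chamber (Suc n)" and Y: "Y \<in> space (box_measure n)"
    and nz: "(\<Prod>r=1..n. cut_weight n \<kappa> X r (Y r)) \<noteq> 0"
  shows "inj_on (\<lambda>i. exp (2 * Y i)) {1..n}" "Y \<in> open_box n X"
proof -
  have YI: "Y \<in> interlacing n X" using prod_cut_weight_eq_0[OF Y] nz by blast
  have b: "X (Suc j) < Y j \<and> Y j < X j" if j: "j \<in> {1..n}" for j
  proof -
    have "cut_weight n \<kappa> X j (Y j) \<noteq> 0" using nz j by auto
    then have 1: "Y j \<in> {X (Suc j)..X j}" and 2: "node_weight n \<kappa> X (Y j) \<noteq> 0" by (auto simp: cut_weight_def indicator_def split: if_splits)
    have "\<bar>exp (2 * Y j) - exp (2 * X s)\<bar> powr (\<kappa> s - 1) \<noteq> 0" if s: "s \<in> {1..Suc n}" for s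
    proof
      assume "\<bar>exp (2 * Y j) - exp (2 * X s)\<bar> powr (\<kappa> s - 1) = 0"
      then have "(\<Prod>s=1..Suc n. \<bar>exp (2 * Y j) - exp (2 * X s)\<bar> powr (\<kappa> s - 1)) = 0"
        using s by (intro prod_zero bexI[of _ s]) auto
      then show False using 2 unfolding node_weight_def by simp
    qed
    note ne = this
    have "Y j \<noteq> X j" using ne[of j] j by auto
    moreover have "Y j \<noteq> X (Suc j)" using ne[of "Suc j"] j by auto
    ultimately show ?thesis using 1 unfolding atLeastAtMost_iff by linarith
  qed
  then show YO: "Y \<in> open_box n X" using YI by (simp add: open_box_def)
  note D = open_boxD(3)[OF X YO]
  show "inj_on (\<lambda>i. exp (2 * Y i)) {1..n}"
  proof (rule inj_onI)
    fix i j assume "i \<in> {1..n}" "j \<in> {1..n}" "exp (2 * Y i) = exp (2 * Y j)"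
    then show "i = j" using D[of i j] D[of j i] by (cases i j rule: linorder_cases) auto
  qed
qed

definition bump :: "(nat \<Rightarrow> real) \<Rightarrow> nat \<Rightarrow> nat \<Rightarrow> real" where "bump \<kappa> c = \<kappa>(c := \<kappa> c + 1)"

definition node_dist :: "nat \<Rightarrow> (nat \<Rightarrow> real) \<Rightarrow> nat \<Rightarrow> (nat \<Rightarrow> real) \<Rightarrow> real" where
  "node_dist n X c Y = (\<Prod>r=1..n. \<bar>exp (2 * Y r) - exp (2 * X c)\<bar>)"

text \<open>The quotient \<open>node_dist n X c Y / node_diff n X c\<close> is the Dirichlet weight
  at the node \<open>c\<close>.\<close>

definition node_diff :: "nat \<Rightarrow> (nat \<Rightarrow> real) \<Rightarrow> nat \<Rightarrow> real" where
  "node_diff n X c = (\<Prod>t\<in>{1..Suc n} - {c}. \<bar>exp (2 * X c) - exp (2 * X t)\<bar>)"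

lemma pos_params_bump: "pos_params n \<kappa> \<Longrightarrow> pos_params n (bump \<kappa> c)"
  by (auto simp: pos_params_def bump_def add_pos_pos)

lemma cut_weight_bump:
  assumes "c \<in> {1..Suc n}"
  shows "cut_weight n (bump \<kappa> c) X r y = \<bar>exp (2 * y) - exp (2 * X c)\<bar> * cut_weight n \<kappa> X r y"
proof -
  have pw: "\<bar>t\<bar> powr (\<kappa> c + 1 - 1) = \<bar>t\<bar> * \<bar>t\<bar> powr (\<kappa> c - 1)" for t :: real
    by (cases "t = 0") (auto simp: powr_diff)
  have "(\<Prod>s=1..Suc n. \<bar>exp (2 * y) - exp (2 * X s)\<bar> powr (bump \<kappa> c s - 1)) =
     \<bar>exp (2 * y) - exp (2 * X c)\<bar> powr (bump \<kappa> c c - 1) * (\<Prod>s\<in>{1..Suc n} - {c}. \<bar>exp (2 * y) - exp (2 * X s)\<bar> powr (bump \<kappa> c s - 1))"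
    using assms by (intro prod.remove) auto
  also have "(\<Prod>s\<in>{1..Suc n} - {c}. \<bar>exp (2 * y) - exp (2 * X s)\<bar> powr (bump \<kappa> c s - 1)) =
     (\<Prod>s\<in>{1..Suc n} - {c}. \<bar>exp (2 * y) - exp (2 * X s)\<bar> powr (\<kappa> s - 1))"
    by (intro prod.cong) (auto simp: bump_def)
  also have "\<bar>exp (2 * y) - exp (2 * X c)\<bar> powr (bump \<kappa> c c - 1) =
    \<bar>exp (2 * y) - exp (2 * X c)\<bar> * \<bar>exp (2 * y) - exp (2 * X c)\<bar> powr (\<kappa> c - 1)"
    unfolding bump_def fun_upd_same by (rule pw)
  finally have "(\<Prod>s=1..Suc n. \<bar>exp (2 * y) - exp (2 * X s)\<bar> powr (bump \<kappa> c s - 1)) =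
     \<bar>exp (2 * y) - exp (2 * X c)\<bar> * (\<Prod>s=1..Suc n. \<bar>exp (2 * y) - exp (2 * X s)\<bar> powr (\<kappa> s - 1))"
    using assms prod.remove[of "{1..Suc n}" c "\<lambda>s. \<bar>exp (2 * y) - exp (2 * X s)\<bar> powr (\<kappa> s - 1)"]
    by (simp only: finite_atLeastAtMost mult.assoc)
  then show ?thesis unfolding cut_weight_def node_weight_def by (simp only: mult_ac)
qed

lemma dixon_bump:
  assumes "c \<in> {1..Suc n}"
  shows "dixon n (bump \<kappa> c) X F = dixon n \<kappa> X (\<lambda>Y. node_dist n X c Y * F Y)"
  unfolding dixon_def cut_weight_bump[OF assms] prod.distrib node_dist_def by (simp only: mult_ac)

lemma prod_sgn:
  fixes f :: "'a \<Rightarrow> real"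
  assumes "finite A" shows "prod f A = (-1) ^ card {i\<in>A. f i < 0} * (\<Prod>i\<in>A. \<bar>f i\<bar>)"
proof -
  have "prod f A = (\<Prod>i\<in>A. (if f i < 0 then -1 else 1) * \<bar>f i\<bar>)" by (intro prod.cong) auto
  also have "\<dots> = (\<Prod>i\<in>A. if f i < 0 then -1 else 1) * (\<Prod>i\<in>A. \<bar>f i\<bar>)" by (rule prod.distrib)
  also have "(\<Prod>i\<in>A. if f i < 0 then -1 else (1::real)) = (-1) ^ card {i\<in>A. f i < 0}"
    using assms by (simp add: prod.If_cases Int_def)
  finally show ?thesis .
qed

lemma node_diff_sgn:
  assumes X: "X \<in> chamber (Suc n)" and c: "c \<in> {1..Suc n}"
  shows "(\<Prod>t\<in>{1..Suc n} - {c}. exp (2 * X c) - exp (2 * X t)) = (-1) ^ (c - 1) * node_diff n X c" "0 < node_diff n X c"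
proof -
  have "{t \<in> {1..Suc n} - {c}. exp (2 * X c) - exp (2 * X t) < 0} = {1..<c}"
  proof (intro set_eqI iffI)
    fix t assume "t \<in> {t \<in> {1..Suc n} - {c}. exp (2 * X c) - exp (2 * X t) < 0}"
    then show "t \<in> {1..<c}" using chamberD[OF X, of c t] c by (cases "t < c") auto
  next
    fix t assume "t \<in> {1..<c}"
    then show "t \<in> {t \<in> {1..Suc n} - {c}. exp (2 * X c) - exp (2 * X t) < 0}"
      using chamberD[OF X, of t c] c by auto
  qed
  then show "(\<Prod>t\<in>{1..Suc n} - {c}. exp (2 * X c) - exp (2 * X t)) = (-1) ^ (c - 1) * node_diff n X c"
    using prod_sgn[of "{1..Suc n} - {c}" "\<lambda>t. exp (2 * X c) - exp (2 * X t)"] by (simp add: node_diff_def)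
  have "X c \<noteq> X t" if "t \<in> {1..Suc n} - {c}" for t
    using chamberD[OF X, of c t] chamberD[OF X, of t c] c that by (cases "t < c") auto
  then show "0 < node_diff n X c" unfolding node_diff_def by (intro prod_pos) auto
qed

text \<open>By interlacing exactly \<open>c - 1\<close> of the points lie above the node
  \<open>c\<close>, as many as there are nodes above it. The sign is therefore that of
  \<open>node_diff_sgn\<close>, and the weights are positive.\<close>

lemma node_dist_sgn:
  assumes X: "X \<in> chamber (Suc n)" and c: "c \<in> {1..Suc n}" and Y: "Y \<in> open_box n X"
  shows "(\<Prod>r=1..n. exp (2 * X c) - exp (2 * Y r)) = (-1) ^ (c - 1) * node_dist n X c Y" "0 < node_dist n X c Y"
proof -
  note D = open_boxD[OF X Y]
  have "{t \<in> {1..n}. exp (2 * X c) - exp (2 * Y t) < 0} = {1..<c}"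
  proof (intro set_eqI iffI)
    fix t assume "t \<in> {t \<in> {1..n}. exp (2 * X c) - exp (2 * Y t) < 0}"
    then show "t \<in> {1..<c}" using D(1)[of c t] c by (cases "t < c") auto
  next
    fix t assume "t \<in> {1..<c}"
    then show "t \<in> {t \<in> {1..n}. exp (2 * X c) - exp (2 * Y t) < 0}"
      using D(2)[of t c] c by auto
  qed
  then show "(\<Prod>r=1..n. exp (2 * X c) - exp (2 * Y r)) = (-1) ^ (c - 1) * node_dist n X c Y"
    using prod_sgn[of "{1..n}" "\<lambda>t. exp (2 * X c) - exp (2 * Y t)"] by (simp add: node_dist_def abs_minus_commute)
  have "X c \<noteq> Y t" if "t \<in> {1..n}" for t
    using D(1)[of c t] D(2)[of t c] c that by (cases "t < c") auto
  then show "0 < node_dist n X c Y" unfolding node_dist_def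
  proof (intro prod_pos)
    fix r assume "r \<in> {1..n}"
    then have "X c \<noteq> Y r" using \<open>\<And>t. t \<in> {1..n} \<Longrightarrow> X c \<noteq> Y t\<close> by blast
    then show "0 < \<bar>exp (2 * Y r) - exp (2 * X c)\<bar>" by auto
  qed
qed

lemma integrable_dixon_UNIV:
  assumes "X \<in> chamber (Suc n)" "pos_params n \<kappa>" "continuous_on UNIV F"
  shows "integrable (box_measure n) (\<lambda>Y. F Y * (exp_vand n Y * (\<Prod>r=1..n. cut_weight n \<kappa> X r (Y r))))"
  using assms by (intro integrable_dixon[of _ _ _ UNIV]) auto

lemma dixon_pos:
  assumes X: "X \<in> chamber (Suc n)" and \<kappa>: "pos_params n \<kappa>"
  shows "0 < dixon n \<kappa> X (\<lambda>_. 1)"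
proof -
  interpret product_sigma_finite "\<lambda>_::nat. lborel :: real measure" by (rule product_sigma_finite_lborel)
  define f where "f Y = exp_vand n Y * (\<Prod>r=1..n. cut_weight n \<kappa> X r (Y r))" for Y
  have int: "integrable (box_measure n) f"
    using integrable_dixon_UNIV[OF X \<kappa>, of "\<lambda>_. 1"] by (simp add: f_def[abs_def])
  have nn: "0 \<le> f Y" if "Y \<in> space (box_measure n)" for Y using weight_nonneg[OF X that] by (simp add: f_def)
  have J: "dixon n \<kappa> X (\<lambda>_. 1) = integral\<^sup>L (box_measure n) f" by (simp add: dixon_def f_def[abs_def])
  have "0 \<le> integral\<^sup>L (box_measure n) f" using nn by (intro integral_nonneg_AE AE_I2)
  moreover have "integral\<^sup>L (box_measure n) f \<noteq> 0"
  proof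
    assume "integral\<^sup>L (box_measure n) f = 0"
    then have ae: "AE Y in box_measure n. f Y = 0" using integral_nonneg_eq_0_iff_AE[OF int AE_I2[OF nn]] by simp
    define B where "B = PiE {1..n} (\<lambda>j. {X (Suc j)<..<X j})"
    have B: "B \<in> sets (box_measure n)" unfolding B_def box_measure_def by (intro sets_PiM_I_finite) auto
    have "AE Y in box_measure n. Y \<notin> B"
    proof (rule AE_mp[OF ae AE_I2], rule impI)
      fix Y assume Y: "Y \<in> space (box_measure n)" and f0: "f Y = 0"
      show "Y \<notin> B"
      proof
        assume YB: "Y \<in> B"
        then have b: "X (Suc j) < Y j \<and> Y j < X j" if "j \<in> {1..n}" for j
          using PiE_mem[of Y "{1..n}" "\<lambda>j. {X (Suc j)<..<X j}" j] that unfolding B_def by auto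
        have YO: "Y \<in> open_box n X"
          using b YB unfolding open_box_def interlacing_def B_def by (auto simp: PiE_iff less_imp_le)
        note D = open_boxD[OF X YO]
        have "0 < exp_vand n Y" unfolding exp_vand_def vand_def using D(3) by (intro prod_pos) auto
        moreover have "0 < cut_weight n \<kappa> X r (Y r)" if r: "r \<in> {1..n}" for r
        proof -
          have "Y r \<noteq> X s" if "s \<in> {1..Suc n}" for s
            using D(1)[of s r] D(2)[of r s] that r by (cases "s \<le> r") auto
          then have "0 < (\<Prod>s=1..Suc n. \<bar>exp (2 * Y r) - exp (2 * X s)\<bar> powr (\<kappa> s - 1))"
            by (intro prod_pos) auto
          then show ?thesis using b[OF r] unfolding cut_weight_def node_weight_def by simp
        qed
        ultimately have "0 < f Y" unfolding f_def by (intro mult_pos_pos prod_pos) auto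
        with f0 show False by simp
      qed
    qed
    then have "emeasure (box_measure n) B = 0" using B by (subst (asm) AE_iff_measurable[OF B]) (auto dest: sets.sets_into_space)
    moreover have "emeasure (box_measure n) B = (\<Prod>j=1..n. emeasure lborel {X (Suc j)<..<X j})"
      unfolding box_measure_def B_def by (rule emeasure_PiM) auto
    ultimately obtain j where "j \<in> {1..n}" "emeasure lborel {X (Suc j)<..<X j} = 0" by (auto simp: prod_zero_iff)
    then show False using chamberD[OF X, of j "Suc j"] by simp
  qed
  ultimately show ?thesis using J by simp
qed

lemma dixon_bound:
  assumes X: "X \<in> chamber (Suc n)" and \<kappa>: "pos_params n \<kappa>"
    and C: "closed C" "interlacing n X \<subseteq> C" "continuous_on C F"
    and B: "\<And>Y. Y \<in> interlacing n X \<Longrightarrow> \<bar>F Y\<bar> \<le> B"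
  shows "\<bar>dixon n \<kappa> X F\<bar> \<le> B * dixon n \<kappa> X (\<lambda>_. 1)"
proof -
  note I1 = integrable_dixon[OF X \<kappa> C]
  note I2 = integrable_dixon_UNIV[OF X \<kappa>, of "\<lambda>_. 1"]
  have "\<bar>dixon n \<kappa> X F\<bar> \<le> (\<integral>Y. \<bar>F Y * (exp_vand n Y * (\<Prod>r=1..n. cut_weight n \<kappa> X r (Y r)))\<bar> \<partial>box_measure n)"
    unfolding dixon_def by (rule integral_abs_bound)
  also have "\<dots> \<le> (\<integral>Y. B * (1 * (exp_vand n Y * (\<Prod>r=1..n. cut_weight n \<kappa> X r (Y r)))) \<partial>box_measure n)"
  proof (rule integral_mono)
    show "integrable (box_measure n) (\<lambda>Y. \<bar>F Y * (exp_vand n Y * (\<Prod>r=1..n. cut_weight n \<kappa> X r (Y r)))\<bar>)" using I1 by (rule integrable_abs)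
    show "integrable (box_measure n) (\<lambda>Y. B * (1 * (exp_vand n Y * (\<Prod>r=1..n. cut_weight n \<kappa> X r (Y r)))))"
      using I2 by (intro integrable_mult_right) auto
    fix Y assume Y: "Y \<in> space (box_measure n)"
    show "\<bar>F Y * (exp_vand n Y * (\<Prod>r=1..n. cut_weight n \<kappa> X r (Y r)))\<bar> \<le> B * (1 * (exp_vand n Y * (\<Prod>r=1..n. cut_weight n \<kappa> X r (Y r))))"
    proof (cases "Y \<in> interlacing n X")
      case True
      show ?thesis using B[OF True] weight_nonneg[OF X Y, of \<kappa>] unfolding abs_mult[of "F Y"] by (simp add: mult_right_mono)
    next
      case False
      show ?thesis by (simp only: prod_cut_weight_eq_0[OF Y False] mult_zero_right abs_zero)
    qed
  qed
  also have "\<dots> = B * dixon n \<kappa> X (\<lambda>_. 1)" unfolding dixon_def by (rule integral_mult_right_zero)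
  finally show ?thesis .
qed

lemma dixon_add:
  assumes "X \<in> chamber (Suc n)" "pos_params n \<kappa>" "continuous_on UNIV F" "continuous_on UNIV G"
  shows "dixon n \<kappa> X (\<lambda>Y. F Y + G Y) = dixon n \<kappa> X F + dixon n \<kappa> X G"
  unfolding dixon_def distrib_right using assms by (intro Bochner_Integration.integral_add integrable_dixon_UNIV)

lemma dixon_cmult: "dixon n \<kappa> X (\<lambda>Y. c * F Y) = c * dixon n \<kappa> X F"
  unfolding dixon_def mult.assoc by simp

lemma dixon_sum:
  assumes "X \<in> chamber (Suc n)" "pos_params n \<kappa>" "\<And>i. i \<in> I \<Longrightarrow> continuous_on UNIV (F i)"
  shows "dixon n \<kappa> X (\<lambda>Y. \<Sum>i\<in>I. F i Y) = (\<Sum>i\<in>I. dixon n \<kappa> X (F i))"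
  unfolding dixon_def sum_distrib_right using assms by (intro Bochner_Integration.integral_sum integrable_dixon_UNIV)

lemma dixon_cong:
  assumes X: "X \<in> chamber (Suc n)" and "\<And>Y. Y \<in> open_box n X \<Longrightarrow> F Y = G Y"
  shows "dixon n \<kappa> X F = dixon n \<kappa> X G"
  unfolding dixon_def
proof (rule Bochner_Integration.integral_cong[OF refl])
  fix Y assume Y: "Y \<in> space (box_measure n)"
  show "F Y * (exp_vand n Y * (\<Prod>r=1..n. cut_weight n \<kappa> X r (Y r))) = G Y * (exp_vand n Y * (\<Prod>r=1..n. cut_weight n \<kappa> X r (Y r)))"
    using prod_cut_weight_inj(2)[OF X Y, of \<kappa>] assms(2)[of Y] by (cases "(\<Prod>r=1..n. cut_weight n \<kappa> X r (Y r)) = 0") simp_all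
qed

text \<open>The moments of the barycentric weights of the interpolation nodes; the identity expresses that
  these weights follow a Dirichlet law with parameters \<open>\<kappa>\<close>.\<close>

lemma dixon_shift:
  assumes X: "X \<in> chamber (Suc n)" and \<kappa>: "pos_params n \<kappa>" and c: "c \<in> {1..Suc n}" and n: "n \<ge> 1"
  shows "(\<Sum>s=1..Suc n. \<kappa> s) * dixon n (bump \<kappa> c) X (\<lambda>_. 1) = \<kappa> c * node_diff n X c * dixon n \<kappa> X (\<lambda>_. 1)"
proof -
  define S where "S = {1..Suc n}"
  define A where "A = {1..n}"
  define V where "V s = exp (2 * X s)" for s
  define U where "U Y = (\<lambda>i. exp (2 * Y i))" for Y :: "nat \<Rightarrow> real"
  have fin: "finite S" "finite A" "A \<noteq> {}" "card A = n" "c \<in> S" "card S = Suc n" using n c by (auto simp: S_def A_def)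
  define l where "l s = (\<Prod>t\<in>S - {s}. [:- V t, 1:])" for s
  have dl: "degree (l s) = n" "coeff (l s) n = 1" if "s \<in> S" for s
  proof -
    have "degree (l s) = card (S - {s})" unfolding l_def by (subst degree_prod_eq_sum_degree) auto
    then show d: "degree (l s) = n" using that fin by simp
    have "lead_coeff (l s) = 1" unfolding l_def by (simp add: lead_coeff_prod)
    then show "coeff (l s) n = 1" using d by simp
  qed
  \<comment> \<open>The polynomial whose integral against \<open>cut_weight\<close> vanishes on
    every interval. Its leading coefficient is the sum of all \<open>\<kappa> s\<close>, and at the
    node \<open>c\<close> only the summand of \<open>c\<close> survives.\<close>
  define p where "p = (\<Sum>s\<in>S. smult (\<kappa> s) (l s))"
  have dp: "degree p \<le> card A" unfolding p_def fin(4)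
    using fin dl by (intro degree_sum_le) (auto intro: order_trans[OF degree_smult_le])
  have cp: "coeff p n = (\<Sum>s\<in>S. \<kappa> s)" unfolding p_def by (simp add: coeff_sum dl)
  have pp: "poly p x = (\<Sum>s\<in>S. \<kappa> s * (\<Prod>t\<in>S - {s}. x - V t))" for x
    by (simp add: p_def l_def poly_sum poly_prod)
  have pc: "poly p (V c) = \<kappa> c * (\<Prod>t\<in>S - {c}. V c - V t)"
  proof -
    have "poly p (V c) = (\<Sum>s\<in>{c}. \<kappa> s * (\<Prod>t\<in>S - {s}. V c - V t))"
      unfolding pp using fin by (intro sum.mono_neutral_right) (auto intro!: prod_zero)
    then show ?thesis by simp
  qed
  define bp where "bp Y = (\<Prod>q\<in>A. cut_weight n \<kappa> X q (Y q))" for Y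
  \<comment> \<open>The summands of \<open>lagrange_vand\<close> at \<open>V c\<close>, times the
    weight. Each integrates to 0 over its own coordinate, whereas their sum is a combination of 1
    and \<open>node_dist n X c Y\<close>; the latter comes from the correction term, as
    \<open>p\<close> has degree \<open>card A\<close>.\<close>
  define T where "T r Y = (-1) ^ card {i\<in>A. i < r} * poly p (U Y r) * vand (A - {r}) (U Y) * (\<Prod>q\<in>A - {r}. V c - U Y q) * bp Y" for r Y
  have Tint: "integrable (box_measure n) (T r)" for r
    unfolding T_def bp_def A_def U_def
    by (rule integrable_prod_cut_weight[OF X \<kappa>, of UNIV]) (auto intro!: continuous_intros)
  have T0: "integral\<^sup>L (box_measure n) (T r) = 0" if r: "r \<in> A" for r
  proof -
    define h where "h x = (-1) ^ card {i\<in>A. i < r} * vand (A - {r}) (U x) * (\<Prod>q\<in>A - {r}. V c - U x q) * (\<Prod>q\<in>A - {r}. cut_weight n \<kappa> X q (x q))" for x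
    define \<theta> where "\<theta> y = poly p (exp (2 * y)) * cut_weight n \<kappa> X r y" for y
    have "integral\<^sup>L (box_measure n) (T r) = (\<integral>x. h x \<partial>Pi\<^sub>M ({1..n} - {r}) (\<lambda>_. lborel :: real measure)) * (\<integral>y. \<theta> y \<partial>lborel)"
    proof (rule integral_coord_factor)
      show "r \<in> {1..n}" using r by (simp add: A_def)
      show "T r (x(r := y)) = h x * \<theta> y" for x y
      proof -
        have "bp (x(r := y)) = cut_weight n \<kappa> X r y * (\<Prod>q\<in>A - {r}. cut_weight n \<kappa> X q (x q))"
          unfolding bp_def using prod.remove[OF fin(2) r, of "\<lambda>q. cut_weight n \<kappa> X q ((x(r := y)) q)"] by simp
        moreover have "vand (A - {r}) (U (x(r := y))) = vand (A - {r}) (U x)"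
          by (rule vand_cong) (auto simp: U_def)
        moreover have "(\<Prod>q\<in>A - {r}. V c - U (x(r := y)) q) = (\<Prod>q\<in>A - {r}. V c - U x q)"
          by (intro prod.cong) (auto simp: U_def)
        moreover have "U (x(r := y)) r = exp (2 * y)" by (simp add: U_def)
        ultimately show ?thesis unfolding T_def h_def \<theta>_def by (simp only: mult_ac)
      qed
    qed (rule Tint)
    also have "(\<integral>y. \<theta> y \<partial>lborel) = 0"
    proof -
      have rr: "r \<in> {1..n}" using r by (simp add: A_def)
      show ?thesis unfolding \<theta>_def pp S_def V_def
        by (rule integral_cut_weight_exact[OF X rr]) (use \<kappa> in \<open>auto simp: pos_params_def\<close>)
    qed
    finally show ?thesis by simp
  qed
  have "(\<integral>Y. (\<Sum>r\<in>A. T r Y) \<partial>box_measure n) = (\<Sum>r\<in>A. integral\<^sup>L (box_measure n) (T r))"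
    by (rule Bochner_Integration.integral_sum) (rule Tint)
  also have "\<dots> = 0" using T0 by simp
  finally have 0: "(\<integral>Y. (\<Sum>r\<in>A. T r Y) \<partial>box_measure n) = 0" .
  define K where "K = (\<Sum>s=1..Suc n. \<kappa> s)"
  define \<epsilon> :: real where "\<epsilon> = (-1) ^ (c - 1)"
  have eps: "\<epsilon> * \<epsilon> = 1" by (simp add: \<epsilon>_def flip: power_add mult_2)
  have pt: "(\<Sum>r\<in>A. T r Y) = (\<epsilon> * (\<kappa> c * node_diff n X c) + (- \<epsilon> * K) * node_dist n X c Y) * (exp_vand n Y * bp Y)" if Y: "Y \<in> space (box_measure n)" for Y
  proof (cases "bp Y = 0")
    case True
    then show ?thesis by (simp add: T_def)
  next
    case False
    then have nz: "(\<Prod>r=1..n. cut_weight n \<kappa> X r (Y r)) \<noteq> 0" by (simp add: bp_def A_def)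
    have inj: "inj_on (U Y) A" using prod_cut_weight_inj(1)[OF X Y nz] by (simp add: U_def A_def)
    have YO: "Y \<in> open_box n X" by (rule prod_cut_weight_inj(2)[OF X Y nz])
    have "(\<Sum>r\<in>A. T r Y) = (poly p (V c) - coeff p (card A) * (\<Prod>q\<in>A. V c - U Y q)) * vand A (U Y) * bp Y"
      unfolding lagrange_vand[OF fin(2,3) inj dp, symmetric] T_def sum_distrib_right by simp
    also have "poly p (V c) = \<epsilon> * (\<kappa> c * node_diff n X c)"
      unfolding pc unfolding V_def S_def node_diff_sgn(1)[OF X c] \<epsilon>_def by simp
    also have "(\<Prod>q\<in>A. V c - U Y q) = \<epsilon> * node_dist n X c Y"
      using node_dist_sgn(1)[OF X c YO] by (simp add: V_def U_def A_def \<epsilon>_def)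
    also have "coeff p (card A) = K" by (simp add: fin(4) cp K_def S_def)
    also have "vand A (U Y) = exp_vand n Y" by (simp add: exp_vand_def A_def U_def)
    finally show ?thesis by (simp add: algebra_simps)
  qed
  have "0 = (\<integral>Y. (\<Sum>r\<in>A. T r Y) \<partial>box_measure n)" using 0 by simp
  also have "\<dots> = dixon n \<kappa> X (\<lambda>Y. \<epsilon> * (\<kappa> c * node_diff n X c) * 1 + (- \<epsilon> * K) * node_dist n X c Y)"
    unfolding dixon_def
  proof (rule Bochner_Integration.integral_cong[OF refl])
    fix Y assume "Y \<in> space (box_measure n)"
    from pt[OF this] show "(\<Sum>r\<in>A. T r Y) =
      (\<epsilon> * (\<kappa> c * node_diff n X c) * 1 + - \<epsilon> * K * node_dist n X c Y) * (exp_vand n Y * (\<Prod>r=1..n. cut_weight n \<kappa> X r (Y r)))"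
      by (simp only: bp_def A_def mult_1_right)
  qed
  also have "\<dots> = dixon n \<kappa> X (\<lambda>Y. \<epsilon> * (\<kappa> c * node_diff n X c) * 1) + dixon n \<kappa> X (\<lambda>Y. (- \<epsilon> * K) * node_dist n X c Y)"
    by (rule dixon_add[OF X \<kappa>]) (auto simp: node_dist_def intro!: continuous_intros)
  also have "\<dots> = \<epsilon> * (\<kappa> c * node_diff n X c) * dixon n \<kappa> X (\<lambda>_. 1) + (- \<epsilon> * K) * dixon n \<kappa> X (node_dist n X c)"
    by (simp only: dixon_cmult)
  also have "dixon n \<kappa> X (node_dist n X c) = dixon n (bump \<kappa> c) X (\<lambda>_. 1)"
    using dixon_bump[OF c, of \<kappa> X "\<lambda>_. 1"] by simp
  finally have "\<epsilon> * (\<epsilon> * (\<kappa> c * node_diff n X c) * dixon n \<kappa> X (\<lambda>_. 1) + (- \<epsilon> * K) * dixon n (bump \<kappa> c) X (\<lambda>_. 1)) = 0" by simp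
  then have "(\<epsilon> * \<epsilon>) * (\<kappa> c * node_diff n X c * dixon n \<kappa> X (\<lambda>_. 1) - K * dixon n (bump \<kappa> c) X (\<lambda>_. 1)) = 0"
    by (simp add: algebra_simps)
  then show ?thesis by (simp add: eps K_def)
qed

section \<open>The total mass when all exponents are one\<close>

lemma vand_pos_roots: "vand {1..n} u = (\<Prod>\<alpha>\<in>pos_roots n. u (fst \<alpha>) - u (snd \<alpha>))"
  unfolding vand_def by (intro prod.cong) (auto simp: pos_roots_def)

lemma vand_Suc: "vand {1..Suc n} u = vand {1..n} u * (\<Prod>i=1..n. u i - u (Suc n))"
  unfolding vand_pos_roots prod_pos_roots_Suc by simp

lemma vand_pos: "X \<in> chamber N \<Longrightarrow> 0 < vand {1..N} (\<lambda>i. exp (2 * X i))"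
  unfolding vand_pos_roots using chamberD by (intro prod_pos) (force simp: pos_roots_def)

lemma integral_cut_weight_one:
  assumes X: "X \<in> chamber (Suc n)" and r: "r \<in> {1..n}"
    and P: "\<And>u. (P has_field_derivative poly p u) (at u)"
  shows "(\<integral>y. poly p (exp (2 * y)) * cut_weight n (\<lambda>_. 1) X r y \<partial>lborel) = (P (exp (2 * X r)) - P (exp (2 * X (Suc r)))) / 2"
proof -
  define a b where "a = X (Suc r)" and "b = X r"
  have ab: "a < b" using chamberD[OF X, of r "Suc r"] r by (simp add: a_def b_def)
  have contP: "continuous_on UNIV P" using P by (intro DERIV_continuous_on) auto
  define f where "f y = poly p (exp (2 * y)) * node_weight n (\<lambda>_. 1) X y" for y
  have HI: "(f has_integral (P (exp (2 * b)) / 2 - P (exp (2 * a)) / 2)) {a..b}"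
  proof (rule fundamental_theorem_of_calculus_interior)
    show "a \<le> b" using ab by simp
    show "continuous_on {a..b} (\<lambda>y. P (exp (2 * y)) / 2)"
      by (intro continuous_intros continuous_on_compose2[OF contP]) auto
    fix y assume y: "y \<in> {a<..<b}"
    have "y \<noteq> X s" if "s \<in> {1..Suc n}" for s
      using chamberD[OF X, of s r] chamberD[OF X, of "Suc r" s] that r y
      by (cases "s < r"; cases "s = r"; cases "s = Suc r") (auto simp: a_def b_def)
    then have "(\<Prod>s=1..Suc n. \<bar>exp (2 * y) - exp (2 * X s)\<bar> powr (1 - 1)) = 1"
      by (intro prod.neutral) auto
    then have f: "f y = poly p (exp (2 * y)) * exp (2 * y)" by (simp add: f_def node_weight_def)
    have "((\<lambda>y. P (exp (2 * y)) / 2) has_field_derivative poly p (exp (2 * y)) * (exp (2 * y) * 2) / 2) (at y)"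
      by (intro DERIV_cdivide DERIV_chain2[OF P]) (auto intro!: derivative_eq_intros)
    then show "((\<lambda>y. P (exp (2 * y)) / 2) has_vector_derivative f y) (at y)"
      by (simp add: f has_real_derivative_iff_has_vector_derivative)
  qed
  have "continuous_on UNIV (\<lambda>y::real. poly p (exp (2 * y)))" by (intro continuous_intros)
  from integrable_cut_weight_mult[OF X r _ _ this, of "\<lambda>_. 1"]
  have int: "integrable lborel (\<lambda>y. poly p (exp (2 * y)) * cut_weight n (\<lambda>_. 1) X r y)" by simp
  have e: "indicat_real {a..b} y *\<^sub>R f y = poly p (exp (2 * y)) * cut_weight n (\<lambda>_. 1) X r y" for y
    by (simp add: f_def cut_weight_def a_def b_def)
  have si: "set_integrable lborel {a..b} f" unfolding set_integrable_def e by (rule int)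
  have "(LINT y:{a..b}|lborel. f y) = integral {a..b} f" by (rule set_borel_integral_eq_integral(2)[OF si])
  also have "\<dots> = P (exp (2 * b)) / 2 - P (exp (2 * a)) / 2" using HI by (rule integral_unique)
  finally show ?thesis unfolding set_lebesgue_integral_def e by (simp add: a_def b_def diff_divide_distrib)
qed

text \<open>The additional node contributes \<open>t powr 0\<close>, which is 1 only for nonzero
  \<open>t\<close>; it lies strictly below every interval of index at most \<open>n\<close>.\<close>

lemma cut_weight_one_Suc:
  assumes X: "X \<in> chamber (Suc (Suc n))" and q: "q \<in> {1..n}"
  shows "cut_weight (Suc n) (\<lambda>_. 1) X q y = cut_weight n (\<lambda>_. 1) X q y"
proof (cases "y \<in> {X (Suc q)..X q}")
  case True
  have "X (Suc (Suc n)) < X (Suc q)" using chamberD[OF X, of "Suc q" "Suc (Suc n)"] q by auto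
  then have "y \<noteq> X (Suc (Suc n))" using True by auto
  then show ?thesis by (simp add: cut_weight_def node_weight_def)
qed (simp add: cut_weight_def)

text \<open>Integrate the derivative of \<open>P\<close>, the monic polynomial with the first
  \<open>N\<close> nodes as roots. On the interval \<open>r\<close> this gives half the difference
  of \<open>P\<close> at the two ends, which is 0 unless \<open>r = N\<close>; the last interval
  yields the product of differences to the last node, and the other coordinates form the integral of
  the lower rank.\<close>

lemma dixon_one_Suc:
  assumes X: "X \<in> chamber (Suc (Suc n))"
  shows "2 * real (Suc n) * dixon (Suc n) (\<lambda>_. 1) X (\<lambda>_. 1) =
    (\<Prod>t=1..Suc n. exp (2 * X t) - exp (2 * X (Suc (Suc n)))) * dixon n (\<lambda>_. 1) X (\<lambda>_. 1)"
proof -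
  define N where "N = Suc n"
  define A where "A = {1..N}"
  define V where "V s = exp (2 * X s)" for s
  define U where "U Y = (\<lambda>i. exp (2 * Y i))" for Y :: "nat \<Rightarrow> real"
  have XN: "X \<in> chamber (Suc N)" using X by (simp add: N_def)
  have fin: "finite A" "A \<noteq> {}" "card A = N" "N \<in> A" "A - {N} = {1..n}" by (auto simp: A_def N_def)
  have \<kappa>: "pos_params N (\<lambda>_. 1)" by (simp add: pos_params_def)
  define l where "l s = (\<Prod>t\<in>A - {s}. [:- V t, 1:])" for s
  have dl: "degree (l s) = n" "coeff (l s) n = 1" if "s \<in> A" for s
  proof -
    have "degree (l s) = card (A - {s})" unfolding l_def by (subst degree_prod_eq_sum_degree) auto
    then show d: "degree (l s) = n" using that fin by (simp add: N_def)
    have "lead_coeff (l s) = 1" unfolding l_def by (simp add: lead_coeff_prod)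
    then show "coeff (l s) n = 1" using d by simp
  qed
  define p where "p = (\<Sum>s\<in>A. l s)"
  have dp: "degree p \<le> n" unfolding p_def using fin dl by (intro degree_sum_le) auto
  have cp: "coeff p n = N" unfolding p_def using fin by (simp add: coeff_sum dl)
  have pp: "poly p x = (\<Sum>s\<in>A. \<Prod>t\<in>A - {s}. x - V t)" for x
    by (simp add: p_def l_def poly_sum poly_prod)
  define c where "c = V (Suc N)"
  \<comment> \<open>The additional factor vanishes at \<open>c\<close>, and at \<open>U Y r\<close>
    it completes the product over \<open>A - {r}\<close> to the common factor \<open>- Q\<close>.
    Dividing by it removes the dependence on \<open>c\<close> from the interpolation
    identity.\<close>
  define pt where "pt = [:- c, 1:] * p"
  have dpt: "degree pt \<le> card A" unfolding pt_def fin(3) N_def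
    using dp by (intro order_trans[OF degree_mult_le]) simp
  have cpt: "coeff pt N = N"
  proof -
    have "coeff p N = 0" using dp by (intro coeff_eq_0) (simp add: N_def)
    then show ?thesis by (simp add: pt_def N_def cp)
  qed
  define P where "P u = (\<Prod>t\<in>A. u - V t)" for u
  have P: "(P has_field_derivative poly p u) (at u)" for u
  proof -
    have "((\<lambda>u. \<Prod>t\<in>A. u - V t) has_field_derivative (\<Sum>s\<in>A. 1 * (\<Prod>t\<in>A - {s}. u - V t))) (at u)"
      by (intro has_field_derivative_prod) (auto intro!: derivative_eq_intros)
    then show ?thesis by (simp add: P_def[abs_def] pp)
  qed
  define bp where "bp Y = (\<Prod>q\<in>A. cut_weight N (\<lambda>_. 1) X q (Y q))" for Y
  define T where "T r Y = (-1) ^ card {i\<in>A. i < r} * poly p (U Y r) * vand (A - {r}) (U Y) * bp Y" for r Y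
  have Tint: "integrable (box_measure N) (T r)" for r
    unfolding T_def bp_def A_def U_def
    by (rule integrable_prod_cut_weight[OF XN \<kappa>, of UNIV]) (auto intro!: continuous_intros)
  define h where "h r x = (-1) ^ card {i\<in>A. i < r} * (vand (A - {r}) (U x) * (\<Prod>q\<in>A - {r}. cut_weight N (\<lambda>_. 1) X q (x q)))" for r x
  have T1: "integral\<^sup>L (box_measure N) (T r) = (\<integral>x. h r x \<partial>Pi\<^sub>M ({1..N} - {r}) (\<lambda>_. lborel :: real measure)) * ((P (V r) - P (V (Suc r))) / 2)"
    if r: "r \<in> A" for r
  proof -
    have rr: "r \<in> {1..N}" using r by (simp add: A_def)
    define \<theta> where "\<theta> y = poly p (exp (2 * y)) * cut_weight N (\<lambda>_. 1) X r y" for y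
    have "integral\<^sup>L (box_measure N) (T r) = (\<integral>x. h r x \<partial>Pi\<^sub>M ({1..N} - {r}) (\<lambda>_. lborel :: real measure)) * (\<integral>y. \<theta> y \<partial>lborel)"
    proof (rule integral_coord_factor[OF rr Tint])
      show "T r (x(r := y)) = h r x * \<theta> y" for x y
      proof -
        have "bp (x(r := y)) = cut_weight N (\<lambda>_. 1) X r y * (\<Prod>q\<in>A - {r}. cut_weight N (\<lambda>_. 1) X q (x q))"
          unfolding bp_def using prod.remove[OF fin(1) r, of "\<lambda>q. cut_weight N (\<lambda>_. 1) X q ((x(r := y)) q)"] by simp
        moreover have "vand (A - {r}) (U (x(r := y))) = vand (A - {r}) (U x)"
          by (rule vand_cong) (auto simp: U_def)
        moreover have "U (x(r := y)) r = exp (2 * y)" by (simp add: U_def)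
        ultimately show ?thesis unfolding T_def h_def \<theta>_def by (simp only: mult_ac)
      qed
    qed
    then show ?thesis unfolding \<theta>_def integral_cut_weight_one[OF XN rr P] by (simp add: V_def)
  qed
  have P0: "P (V t) = 0" if "t \<in> A" for t
    unfolding P_def using that fin by (intro prod_zero) auto
  have T0: "integral\<^sup>L (box_measure N) (T r) = 0" if r: "r \<in> A - {N}" for r
  proof -
    have "r \<in> A" "Suc r \<in> A" using r by (auto simp: A_def)
    then show ?thesis using T1[of r] P0 by simp
  qed
  define D where "D = (\<Prod>t\<in>A. V t - c)"
  have PD: "P c = (-1) ^ N * D"
  proof -
    have "P c = (\<Prod>t\<in>A. (-1) * (V t - c))" unfolding P_def by (intro prod.cong) auto
    also have "\<dots> = (-1) ^ N * D" unfolding prod.distrib D_def by (simp add: fin)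
    finally show ?thesis .
  qed
  have H: "(\<integral>x. h N x \<partial>Pi\<^sub>M ({1..N} - {N}) (\<lambda>_. lborel :: real measure)) = (-1) ^ n * dixon n (\<lambda>_. 1) X (\<lambda>_. 1)"
  proof -
    have "{i \<in> A. i < N} = {1..n}" by (auto simp: A_def N_def)
    then have "h N x = (-1) ^ n * (1 * (exp_vand n x * (\<Prod>r=1..n. cut_weight n (\<lambda>_. 1) X r (x r))))" for x
      unfolding h_def fin(5) exp_vand_def U_def
      by (simp add: N_def cut_weight_one_Suc[OF X])
    moreover have "Pi\<^sub>M ({1..N} - {N}) (\<lambda>_. lborel :: real measure) = box_measure n"
      using fin(5) by (simp add: box_measure_def A_def)
    ultimately show ?thesis by (simp add: dixon_def)
  qed
  have TN: "integral\<^sup>L (box_measure N) (T N) = D * dixon n (\<lambda>_. 1) X (\<lambda>_. 1) / 2"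
  proof -
    have "integral\<^sup>L (box_measure N) (T N) = ((-1) ^ n * dixon n (\<lambda>_. 1) X (\<lambda>_. 1)) * ((0 - (-1) ^ N * D) / 2)"
      unfolding T1[OF fin(4)] H P0[OF fin(4)] PD[symmetric] c_def ..
    also have "\<dots> = ((-1) ^ n * (-1) ^ n) * (dixon n (\<lambda>_. 1) X (\<lambda>_. 1) * D / 2)" by (simp add: N_def)
    also have "(-1::real) ^ n * (-1) ^ n = 1" by (simp flip: power_add mult_2)
    finally show ?thesis by simp
  qed
  have "(\<integral>Y. (\<Sum>r\<in>A. T r Y) \<partial>box_measure N) = (\<Sum>r\<in>A. integral\<^sup>L (box_measure N) (T r))"
    by (rule Bochner_Integration.integral_sum) (rule Tint)
  also have "\<dots> = integral\<^sup>L (box_measure N) (T N) + (\<Sum>r\<in>A - {N}. integral\<^sup>L (box_measure N) (T r))"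
    using fin by (intro sum.remove) auto
  also have "\<dots> = D * dixon n (\<lambda>_. 1) X (\<lambda>_. 1) / 2" using T0 TN by simp
  finally have 1: "(\<integral>Y. (\<Sum>r\<in>A. T r Y) \<partial>box_measure N) = D * dixon n (\<lambda>_. 1) X (\<lambda>_. 1) / 2" .
  have pt: "(\<Sum>r\<in>A. T r Y) = real N * (exp_vand N Y * bp Y)" if Y: "Y \<in> space (box_measure N)" for Y
  proof (cases "bp Y = 0")
    case True
    then show ?thesis by (simp add: T_def)
  next
    case False
    then have nz: "(\<Prod>r=1..N. cut_weight N (\<lambda>_. 1) X r (Y r)) \<noteq> 0" by (simp add: bp_def A_def)
    have inj: "inj_on (U Y) A" using prod_cut_weight_inj(1)[OF XN Y nz] by (simp add: U_def A_def)
    have YO: "Y \<in> open_box N X" by (rule prod_cut_weight_inj(2)[OF XN Y nz])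
    define Q where "Q = (\<Prod>q\<in>A. c - U Y q)"
    have "c \<noteq> U Y q" if "q \<in> A" for q
      using open_boxD(2)[OF XN YO, of q "Suc N"] that by (auto simp: c_def V_def U_def A_def)
    then have Q: "Q \<noteq> 0" unfolding Q_def using fin by auto
    have Qr: "(U Y r - c) * (\<Prod>q\<in>A - {r}. c - U Y q) = - Q" if "r \<in> A" for r
      unfolding Q_def prod.remove[OF fin(1) that, of "\<lambda>q. c - U Y q"] by (simp add: algebra_simps)
    have "(\<Sum>r\<in>A. (-1) ^ card {i\<in>A. i < r} * poly pt (U Y r) * vand (A - {r}) (U Y) * (\<Prod>q\<in>A - {r}. c - U Y q)) =
      (poly pt c - coeff pt (card A) * (\<Prod>q\<in>A. c - U Y q)) * vand A (U Y)"
      by (rule lagrange_vand[OF fin(1,2) inj dpt])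
    also have "\<dots> = - Q * (real N * vand A (U Y))"
      by (simp add: pt_def[symmetric] fin(3) cpt Q_def) (simp add: pt_def)
    also have "(\<Sum>r\<in>A. (-1) ^ card {i\<in>A. i < r} * poly pt (U Y r) * vand (A - {r}) (U Y) * (\<Prod>q\<in>A - {r}. c - U Y q)) =
      (\<Sum>r\<in>A. - Q * ((-1) ^ card {i\<in>A. i < r} * poly p (U Y r) * vand (A - {r}) (U Y)))"
    proof (intro sum.cong refl)
      fix r assume "r \<in> A"
      have "poly pt (U Y r) = (U Y r - c) * poly p (U Y r)" by (simp add: pt_def algebra_simps)
      then show "(-1) ^ card {i\<in>A. i < r} * poly pt (U Y r) * vand (A - {r}) (U Y) * (\<Prod>q\<in>A - {r}. c - U Y q) =
        - Q * ((-1) ^ card {i\<in>A. i < r} * poly p (U Y r) * vand (A - {r}) (U Y))"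
        unfolding Qr[OF \<open>r \<in> A\<close>, symmetric] by (simp only: mult_ac)
    qed
    also have "\<dots> = - Q * (\<Sum>r\<in>A. (-1) ^ card {i\<in>A. i < r} * poly p (U Y r) * vand (A - {r}) (U Y))"
      by (rule sum_distrib_left[symmetric])
    finally have "(\<Sum>r\<in>A. (-1) ^ card {i\<in>A. i < r} * poly p (U Y r) * vand (A - {r}) (U Y)) = real N * vand A (U Y)"
      using Q by simp
    then show ?thesis unfolding T_def sum_distrib_right[symmetric] by (simp add: exp_vand_def A_def U_def)
  qed
  have "(\<integral>Y. (\<Sum>r\<in>A. T r Y) \<partial>box_measure N) = (\<integral>Y. real N * (1 * (exp_vand N Y * (\<Prod>r=1..N. cut_weight N (\<lambda>_. 1) X r (Y r)))) \<partial>box_measure N)"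
  proof (rule Bochner_Integration.integral_cong[OF refl])
    fix Y assume "Y \<in> space (box_measure N)"
    from pt[OF this] show "(\<Sum>r\<in>A. T r Y) = real N * (1 * (exp_vand N Y * (\<Prod>r=1..N. cut_weight N (\<lambda>_. 1) X r (Y r))))"
      by (simp only: bp_def A_def mult_1_left)
  qed
  also have "\<dots> = real N * dixon N (\<lambda>_. 1) X (\<lambda>_. 1)" unfolding dixon_def by (rule integral_mult_right_zero)
  finally have "2 * real N * dixon N (\<lambda>_. 1) X (\<lambda>_. 1) = D * dixon n (\<lambda>_. 1) X (\<lambda>_. 1)" using 1 by simp
  then show ?thesis by (simp add: N_def D_def A_def V_def c_def)
qed

lemma dixon_one: "\<exists>C>0. \<forall>X\<in>chamber (Suc n). dixon n (\<lambda>_. 1) X (\<lambda>_. 1) = C * vand {1..Suc n} (\<lambda>i. exp (2 * X i))"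
proof (induction n)
  case 0
  have "vand {1..Suc 0} u = 1" for u :: "nat \<Rightarrow> real" unfolding vand_pos_roots by simp
  moreover have "dixon 0 (\<lambda>_. 1) X (\<lambda>_. 1) = 1" for X
    by (simp add: dixon_def exp_vand_def vand_def box_measure_def PiM_empty lebesgue_integral_count_space_finite)
  ultimately show ?case by (intro exI[of _ 1]) simp
next
  case (Suc n)
  then obtain C where C: "C > 0" "\<And>X. X \<in> chamber (Suc n) \<Longrightarrow> dixon n (\<lambda>_. 1) X (\<lambda>_. 1) = C * vand {1..Suc n} (\<lambda>i. exp (2 * X i))"
    by blast
  show ?case
  proof (intro exI[of _ "C / (2 * real (Suc n))"] conjI ballI)
    show "0 < C / (2 * real (Suc n))" using C(1) by simp
    fix X assume X: "X \<in> chamber (Suc (Suc n))"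
    then have X': "X \<in> chamber (Suc n)" by (auto simp: chamber_def)
    define J where "J = dixon (Suc n) (\<lambda>_. 1) X (\<lambda>_. 1)"
    have "2 * real (Suc n) * J = C * vand {1..Suc (Suc n)} (\<lambda>i. exp (2 * X i))"
      unfolding J_def dixon_one_Suc[OF X] C(2)[OF X'] vand_Suc[of "Suc n"] by (simp only: mult_ac)
    then have "J = C * vand {1..Suc (Suc n)} (\<lambda>i. exp (2 * X i)) / (2 * real (Suc n))"
      by (simp add: field_simps)
    then show "dixon (Suc n) (\<lambda>_. 1) X (\<lambda>_. 1) = C / (2 * real (Suc n)) * vand {1..Suc (Suc n)} (\<lambda>i. exp (2 * X i))"
      by (simp add: J_def)
  qed
qed

section \<open>From exponent one to arbitrary exponents\<close>

definition node_dist_prod :: "nat \<Rightarrow> (nat \<Rightarrow> real) \<Rightarrow> (nat \<Rightarrow> real) \<Rightarrow> real" where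
  "node_dist_prod n X Y = (\<Prod>s=1..Suc n. node_dist n X s Y)"

definition node_diff_prod :: "nat \<Rightarrow> (nat \<Rightarrow> real) \<Rightarrow> real" where "node_diff_prod n X = (\<Prod>s=1..Suc n. node_diff n X s)"

text \<open>The product of all Dirichlet weights. Raising every exponent by \<open>\<theta>\<close>
  multiplies the density by \<open>node_dist_prod n X Y powr \<theta>\<close>, so the total mass
  changes by a power of \<open>node_diff_prod n X\<close> times the mean of
  \<open>node_ratio n X Y powr \<theta>\<close>.\<close>

definition node_ratio :: "nat \<Rightarrow> (nat \<Rightarrow> real) \<Rightarrow> (nat \<Rightarrow> real) \<Rightarrow> real" where "node_ratio n X Y = node_dist_prod n X Y / node_diff_prod n X"

lemma node_dist_prod_nonneg: "0 \<le> node_dist_prod n X Y" by (simp add: node_dist_prod_def node_dist_def prod_nonneg)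

lemma node_diff_prod_pos: "X \<in> chamber (Suc n) \<Longrightarrow> 0 < node_diff_prod n X"
  unfolding node_diff_prod_def by (intro prod_pos node_diff_sgn) auto

lemma continuous_on_node_dist_prod [continuous_intros]: "continuous_on S (node_dist_prod n X)"
  unfolding node_dist_prod_def[abs_def] node_dist_def by (intro continuous_intros)

lemma dixon_theta:
  assumes X: "X \<in> chamber (Suc n)"
  shows "dixon n (\<lambda>_. a + \<theta>) X (\<lambda>_. 1) = node_diff_prod n X powr \<theta> * dixon n (\<lambda>_. a) X (\<lambda>Y. node_ratio n X Y powr \<theta>)"
proof -
  have cut_weight: "cut_weight n (\<lambda>_. a + \<theta>) X r y = (\<Prod>s=1..Suc n. \<bar>exp (2 * y) - exp (2 * X s)\<bar>) powr \<theta> * cut_weight n (\<lambda>_. a) X r y" for r y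
  proof -
    have "(\<Prod>s=1..Suc n. \<bar>exp (2 * y) - exp (2 * X s)\<bar> powr (a + \<theta> - 1)) =
      (\<Prod>s=1..Suc n. \<bar>exp (2 * y) - exp (2 * X s)\<bar> powr \<theta> * \<bar>exp (2 * y) - exp (2 * X s)\<bar> powr (a - 1))"
      unfolding powr_add[symmetric] by (simp add: algebra_simps)
    also have "\<dots> = (\<Prod>s=1..Suc n. \<bar>exp (2 * y) - exp (2 * X s)\<bar>) powr \<theta> * (\<Prod>s=1..Suc n. \<bar>exp (2 * y) - exp (2 * X s)\<bar> powr (a - 1))"
      unfolding prod.distrib by (subst prod_powr_distrib) auto
    finally show ?thesis unfolding cut_weight_def node_weight_def by (simp only: mult_ac)
  qed
  have pr: "(\<Prod>r=1..n. (\<Prod>s=1..Suc n. \<bar>exp (2 * Y r) - exp (2 * X s)\<bar>) powr \<theta>) = node_dist_prod n X Y powr \<theta>" for Y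
  proof -
    have "(\<Prod>r=1..n. \<Prod>s=1..Suc n. \<bar>exp (2 * Y r) - exp (2 * X s)\<bar>) = node_dist_prod n X Y"
      unfolding node_dist_prod_def node_dist_def by (rule prod.swap)
    then show ?thesis by (subst prod_powr_distrib[symmetric]) (auto intro!: prod_nonneg)
  qed
  have "dixon n (\<lambda>_. a + \<theta>) X (\<lambda>_. 1) = dixon n (\<lambda>_. a) X (\<lambda>Y. node_dist_prod n X Y powr \<theta>)"
    unfolding dixon_def cut_weight prod.distrib pr by (simp only: mult_ac mult_1_left)
  also have "\<dots> = dixon n (\<lambda>_. a) X (\<lambda>Y. node_diff_prod n X powr \<theta> * node_ratio n X Y powr \<theta>)"
    using node_diff_prod_pos[OF X] node_dist_prod_nonneg[of n X] by (simp add: node_ratio_def powr_divide)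
  finally show ?thesis by (simp only: dixon_cmult)
qed

lemma dixon_kappa_cong: "(\<And>s. s \<in> {1..Suc n} \<Longrightarrow> \<kappa> s = \<kappa>' s) \<Longrightarrow> dixon n \<kappa> X F = dixon n \<kappa>' X F"
  unfolding dixon_def cut_weight_def node_weight_def by simp

text \<open>The exponents are raised one node after another; \<open>kj j\<close> has the first
  \<open>j\<close> of them raised. Each use of \<open>dixon_shift\<close> contributes one
  \<open>node_diff\<close> and a constant not depending on \<open>X\<close>.\<close>

lemma dixon_plus_one:
  assumes n: "n \<ge> 1" and a: "a > 0"
  shows "\<exists>C>0. \<forall>X\<in>chamber (Suc n). dixon n (\<lambda>_. a + 1) X (\<lambda>_. 1) = C * node_diff_prod n X * dixon n (\<lambda>_. a) X (\<lambda>_. 1)"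
proof -
  define kj where "kj j = (\<lambda>s. if 1 \<le> s \<and> s \<le> j then a + 1 else a)" for j :: nat
  have pos_params: "pos_params n (kj j)" for j using a by (simp add: pos_params_def kj_def)
  have "\<exists>C>0. \<forall>X\<in>chamber (Suc n). dixon n (kj j) X (\<lambda>_. 1) = C * (\<Prod>s=1..j. node_diff n X s) * dixon n (\<lambda>_. a) X (\<lambda>_. 1)"
    if "j \<le> Suc n" for j
    using that
  proof (induction j)
    case 0
    have "kj 0 = (\<lambda>_. a)" by (auto simp: kj_def)
    then show ?case by (intro exI[of _ 1]) simp
  next
    case (Suc j)
    then obtain C where C: "C > 0" "\<And>X. X \<in> chamber (Suc n) \<Longrightarrow> dixon n (kj j) X (\<lambda>_. 1) = C * (\<Prod>s=1..j. node_diff n X s) * dixon n (\<lambda>_. a) X (\<lambda>_. 1)"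
      by fastforce
    define K where "K = (\<Sum>s=1..Suc n. kj j s)"
    have K: "K > 0" unfolding K_def using pos_params[of j] by (intro sum_pos) (auto simp: pos_params_def)
    have u: "kj (Suc j) = bump (kj j) (Suc j)" by (auto simp: kj_def bump_def fun_eq_iff)
    have c: "Suc j \<in> {1..Suc n}" using Suc.prems by auto
    show ?case
    proof (intro exI[of _ "C * (a / K)"] conjI ballI)
      show "0 < C * (a / K)" using C(1) K a by simp
      fix X assume X: "X \<in> chamber (Suc n)"
      have "K * dixon n (kj (Suc j)) X (\<lambda>_. 1) = kj j (Suc j) * node_diff n X (Suc j) * dixon n (kj j) X (\<lambda>_. 1)"
        unfolding K_def u by (rule dixon_shift[OF X pos_params c n])
      then have "dixon n (kj (Suc j)) X (\<lambda>_. 1) = a / K * node_diff n X (Suc j) * dixon n (kj j) X (\<lambda>_. 1)"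
        using K by (simp add: kj_def field_simps)
      then show "dixon n (kj (Suc j)) X (\<lambda>_. 1) = C * (a / K) * (\<Prod>s=1..Suc j. node_diff n X s) * dixon n (\<lambda>_. a) X (\<lambda>_. 1)"
        unfolding C(2)[OF X] by simp
    qed
  qed
  from this[of "Suc n"] obtain C where C: "C > 0"
    "\<And>X. X \<in> chamber (Suc n) \<Longrightarrow> dixon n (kj (Suc n)) X (\<lambda>_. 1) = C * node_diff_prod n X * dixon n (\<lambda>_. a) X (\<lambda>_. 1)"
    unfolding node_diff_prod_def by blast
  moreover have "dixon n (kj (Suc n)) X F = dixon n (\<lambda>_. a + 1) X F" for X F
    by (rule dixon_kappa_cong) (auto simp: kj_def)
  ultimately show ?thesis by auto
qed

lemma dixon_plus_nat:
  assumes n: "n \<ge> 1" and a: "a > 0"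
  shows "\<exists>C>0. \<forall>X\<in>chamber (Suc n). dixon n (\<lambda>_. a + real m) X (\<lambda>_. 1) = C * node_diff_prod n X ^ m * dixon n (\<lambda>_. a) X (\<lambda>_. 1)"
proof (induction m)
  case 0
  show ?case by (intro exI[of _ 1]) simp
next
  case (Suc m)
  then obtain C where C: "C > 0" "\<And>X. X \<in> chamber (Suc n) \<Longrightarrow> dixon n (\<lambda>_. a + real m) X (\<lambda>_. 1) = C * node_diff_prod n X ^ m * dixon n (\<lambda>_. a) X (\<lambda>_. 1)"
    by blast
  obtain C' where C': "C' > 0" "\<And>X. X \<in> chamber (Suc n) \<Longrightarrow> dixon n (\<lambda>_. a + real m + 1) X (\<lambda>_. 1) = C' * node_diff_prod n X * dixon n (\<lambda>_. a + real m) X (\<lambda>_. 1)"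
    using dixon_plus_one[OF n, of "a + real m"] a by auto
  show ?case
  proof (intro exI[of _ "C' * C"] conjI ballI)
    show "0 < C' * C" using C C' by simp
    fix X assume X: "X \<in> chamber (Suc n)"
    have e: "a + real (Suc m) = a + real m + 1" by simp
    show "dixon n (\<lambda>_. a + real (Suc m)) X (\<lambda>_. 1) = C' * C * node_diff_prod n X ^ Suc m * dixon n (\<lambda>_. a) X (\<lambda>_. 1)"
      unfolding e C'(2)[OF X] C(2)[OF X] by simp
  qed
qed

lemma node_dist_le_node_diff:
  assumes X: "X \<in> chamber (Suc n)" and Y: "Y \<in> interlacing n X" and s: "s \<in> {1..Suc n}"
  shows "node_dist n X s Y \<le> node_diff n X s"
proof -
  note D = interlacingD[OF X Y]
  \<comment> \<open>\<open>X (f r)\<close> is the endpoint of the interval of \<open>Y r\<close>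
    that is farther from \<open>X s\<close>; this pairs the points with the nodes other than
    \<open>s\<close>.\<close>
  define f where "f r = (if r < s then r else Suc r)" for r
  have "bij_betw f {1..n} ({1..Suc n} - {s})"
  proof (rule bij_betw_imageI)
    show "inj_on f {1..n}" by (auto simp: inj_on_def f_def split: if_splits)
    have "t \<in> f ` {1..n}" if "t \<in> {1..Suc n} - {s}" for t
    proof (cases "t < s")
      case True
      then show ?thesis using that s by (intro image_eqI[of _ _ t]) (auto simp: f_def)
    next
      case False
      then show ?thesis using that s by (intro image_eqI[of _ _ "t - 1"]) (auto simp: f_def)
    qed
    moreover have "f ` {1..n} \<subseteq> {1..Suc n} - {s}" by (auto simp: f_def)
    ultimately show "f ` {1..n} = {1..Suc n} - {s}" by blast
  qed
  then have "node_diff n X s = (\<Prod>r=1..n. \<bar>exp (2 * X s) - exp (2 * X (f r))\<bar>)"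
    unfolding node_diff_def by (rule prod.reindex_bij_betw[symmetric])
  moreover have "node_dist n X s Y \<le> (\<Prod>r=1..n. \<bar>exp (2 * X s) - exp (2 * X (f r))\<bar>)"
    unfolding node_dist_def
  proof (intro prod_mono conjI abs_ge_zero)
    fix r assume r: "r \<in> {1..n}"
    show "\<bar>exp (2 * Y r) - exp (2 * X s)\<bar> \<le> \<bar>exp (2 * X s) - exp (2 * X (f r))\<bar>"
    proof (cases "r < s")
      case True
      have "X s \<le> Y r" "Y r \<le> X r" using D(3)[of r s] D(1)[of r] True r s by auto
      then have "exp (2 * X s) \<le> exp (2 * Y r)" "exp (2 * Y r) \<le> exp (2 * X r)" by auto
      then show ?thesis using True by (simp add: f_def)
    next
      case False
      have "Y r \<le> X s" "X (Suc r) \<le> Y r" using D(2)[of s r] D(1)[of r] False r s by auto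
      then have "exp (2 * Y r) \<le> exp (2 * X s)" "exp (2 * X (Suc r)) \<le> exp (2 * Y r)" by auto
      then show ?thesis using False by (simp add: f_def)
    qed
  qed
  ultimately show ?thesis by simp
qed

lemma node_ratio_bounds:
  assumes X: "X \<in> chamber (Suc n)" and Y: "Y \<in> interlacing n X"
  shows "0 \<le> node_ratio n X Y" "node_ratio n X Y \<le> 1"
proof -
  show "0 \<le> node_ratio n X Y" using node_dist_prod_nonneg node_diff_prod_pos[OF X] by (simp add: node_ratio_def)
  have "node_dist_prod n X Y \<le> node_diff_prod n X" unfolding node_dist_prod_def node_diff_prod_def
    using node_dist_le_node_diff[OF X Y] by (intro prod_mono) (auto simp: node_dist_def prod_nonneg)
  then show "node_ratio n X Y \<le> 1" using node_diff_prod_pos[OF X] by (simp add: node_ratio_def)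
qed

lemma dixon_node_ratio_power:
  assumes n: "n \<ge> 1" and a: "a > 0"
  shows "\<exists>C. \<forall>X\<in>chamber (Suc n). dixon n (\<lambda>_. a) X (\<lambda>Y. node_ratio n X Y ^ m) = C * dixon n (\<lambda>_. a) X (\<lambda>_. 1)"
proof -
  obtain C where C: "\<And>X. X \<in> chamber (Suc n) \<Longrightarrow> dixon n (\<lambda>_. a + real m) X (\<lambda>_. 1) = C * node_diff_prod n X ^ m * dixon n (\<lambda>_. a) X (\<lambda>_. 1)"
    using dixon_plus_nat[OF n a] by blast
  show ?thesis
  proof (intro exI[of _ C] ballI)
    fix X assume X: "X \<in> chamber (Suc n)"
    have "node_diff_prod n X ^ m * dixon n (\<lambda>_. a) X (\<lambda>Y. node_ratio n X Y ^ m) = node_diff_prod n X powr real m * dixon n (\<lambda>_. a) X (\<lambda>Y. node_ratio n X Y powr real m)"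
    proof -
      \<comment> \<open>For \<open>m = 0\<close> the two powers differ at 0, so the comparison is
        made on the open box, where \<open>node_ratio\<close> is positive.\<close>
      have "dixon n (\<lambda>_. a) X (\<lambda>Y. node_ratio n X Y ^ m) = dixon n (\<lambda>_. a) X (\<lambda>Y. node_ratio n X Y powr real m)"
      proof (rule dixon_cong[OF X])
        fix Y assume Y: "Y \<in> open_box n X"
        have "0 < node_dist_prod n X Y" unfolding node_dist_prod_def using node_dist_sgn(2)[OF X _ Y] by (intro prod_pos) auto
        then have "0 < node_ratio n X Y" using node_diff_prod_pos[OF X] by (simp add: node_ratio_def)
        then show "node_ratio n X Y ^ m = node_ratio n X Y powr real m" by (simp add: powr_realpow)
      qed
      then show ?thesis using node_diff_prod_pos[OF X] by (simp add: powr_realpow)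
    qed
    also have "\<dots> = C * node_diff_prod n X ^ m * dixon n (\<lambda>_. a) X (\<lambda>_. 1)"
      using dixon_theta[OF X, of a "real m"] C[OF X] by simp
    finally show "dixon n (\<lambda>_. a) X (\<lambda>Y. node_ratio n X Y ^ m) = C * dixon n (\<lambda>_. a) X (\<lambda>_. 1)"
      using node_diff_prod_pos[OF X] by (simp add: field_simps)
  qed
qed

text \<open>By Weierstrass approximation the moments determine all expectations of functions of \<open>node_ratio\<close>.\<close>

lemma dixon_node_ratio_powr:
  assumes n: "n \<ge> 1" and a: "a > 0" and \<theta>: "\<theta> > 0"
    and X: "X \<in> chamber (Suc n)" and X': "X' \<in> chamber (Suc n)"
  shows "dixon n (\<lambda>_. a) X (\<lambda>Y. node_ratio n X Y powr \<theta>) / dixon n (\<lambda>_. a) X (\<lambda>_. 1) =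
     dixon n (\<lambda>_. a) X' (\<lambda>Y. node_ratio n X' Y powr \<theta>) / dixon n (\<lambda>_. a) X' (\<lambda>_. 1)"
proof -
  define E where "E X F = dixon n (\<lambda>_. a) X F / dixon n (\<lambda>_. a) X (\<lambda>_. 1)" for X F
  obtain C where C: "\<And>m X. X \<in> chamber (Suc n) \<Longrightarrow> dixon n (\<lambda>_. a) X (\<lambda>Y. node_ratio n X Y ^ m) = C m * dixon n (\<lambda>_. a) X (\<lambda>_. 1)"
    using dixon_node_ratio_power[OF n a] by metis
  have pw: "pos_params n (\<lambda>_. a)" using a by (simp add: pos_params_def)
  \<comment> \<open>The constant is chosen before \<open>X\<close>: a polynomial approximates the
    power on the interval from 0 to 1, which contains all values of \<open>node_ratio\<close>, and
    the means of polynomials in it do not depend on \<open>X\<close>.\<close>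
  have approx: "\<exists>c. \<forall>X\<in>chamber (Suc n). \<bar>E X (\<lambda>Y. node_ratio n X Y powr \<theta>) - c\<bar> \<le> e" if e: "e > 0" for e
  proof -
    have "continuous_on {0..1} (\<lambda>x::real. x powr \<theta>)" using \<theta> by (intro continuous_on_powr' continuous_intros) auto
    from Stone_Weierstrass_real_polynomial_function[OF compact_Icc this e]
    obtain g where g: "real_polynomial_function g" "\<And>x. x \<in> {0..1} \<Longrightarrow> \<bar>x powr \<theta> - g x\<bar> < e" by blast
    then obtain \<alpha> N where g': "g = (\<lambda>x. \<Sum>i\<le>N. \<alpha> i * x ^ i)" unfolding real_polynomial_function_iff_sum by blast
    show ?thesis
    proof (intro exI[of _ "\<Sum>i\<le>N. \<alpha> i * C i"] ballI)
      fix X assume X: "X \<in> chamber (Suc n)"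
      have ct: "continuous_on UNIV (node_ratio n X)" unfolding node_ratio_def[abs_def]
        using node_diff_prod_pos[OF X] by (intro continuous_intros) auto
      have tn: "0 \<le> node_ratio n X Y" for Y using node_dist_prod_nonneg[of n X Y] node_diff_prod_pos[OF X] by (simp add: node_ratio_def)
      have cth: "continuous_on UNIV (\<lambda>Y. node_ratio n X Y powr \<theta>)"
        using ct \<theta> tn by (intro continuous_on_powr' continuous_intros) auto
      have cg: "continuous_on UNIV (\<lambda>Y. - 1 * g (node_ratio n X Y))" unfolding g' using ct by (intro continuous_intros)
      define Z where "Z = dixon n (\<lambda>_. a) X (\<lambda>_. 1)"
      have Z: "Z > 0" unfolding Z_def by (rule dixon_pos[OF X pw])
      have "dixon n (\<lambda>_. a) X (\<lambda>Y. g (node_ratio n X Y)) = (\<Sum>i\<le>N. dixon n (\<lambda>_. a) X (\<lambda>Y. \<alpha> i * node_ratio n X Y ^ i))"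
        unfolding g' using ct by (intro dixon_sum[OF X pw] continuous_intros)
      also have "\<dots> = (\<Sum>i\<le>N. \<alpha> i * C i) * Z"
        unfolding dixon_cmult C[OF X] Z_def sum_distrib_right by (simp add: mult_ac)
      finally have Jg: "dixon n (\<lambda>_. a) X (\<lambda>Y. g (node_ratio n X Y)) = (\<Sum>i\<le>N. \<alpha> i * C i) * Z" .
      have "dixon n (\<lambda>_. a) X (\<lambda>Y. node_ratio n X Y powr \<theta> + - 1 * g (node_ratio n X Y)) = dixon n (\<lambda>_. a) X (\<lambda>Y. node_ratio n X Y powr \<theta>) + - 1 * dixon n (\<lambda>_. a) X (\<lambda>Y. g (node_ratio n X Y))"
        unfolding dixon_add[OF X pw cth cg] dixon_cmult ..
      moreover have "\<bar>dixon n (\<lambda>_. a) X (\<lambda>Y. node_ratio n X Y powr \<theta> + - 1 * g (node_ratio n X Y))\<bar> \<le> e * Z"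
        unfolding Z_def
      proof (rule dixon_bound[OF X pw, of UNIV])
        show "continuous_on UNIV (\<lambda>Y. node_ratio n X Y powr \<theta> + - 1 * g (node_ratio n X Y))"
          using cth cg by (rule continuous_on_add)
        fix Y assume "Y \<in> interlacing n X"
        then show "\<bar>node_ratio n X Y powr \<theta> + - 1 * g (node_ratio n X Y)\<bar> \<le> e"
          using g(2)[of "node_ratio n X Y"] node_ratio_bounds[OF X] by auto
      qed auto
      ultimately have "\<bar>dixon n (\<lambda>_. a) X (\<lambda>Y. node_ratio n X Y powr \<theta>) - (\<Sum>i\<le>N. \<alpha> i * C i) * Z\<bar> \<le> e * Z"
        by (simp add: Jg)
      moreover have "E X (\<lambda>Y. node_ratio n X Y powr \<theta>) - (\<Sum>i\<le>N. \<alpha> i * C i) =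
        (dixon n (\<lambda>_. a) X (\<lambda>Y. node_ratio n X Y powr \<theta>) - (\<Sum>i\<le>N. \<alpha> i * C i) * Z) / Z"
        using Z by (simp add: E_def Z_def[symmetric] diff_divide_distrib)
      ultimately show "\<bar>E X (\<lambda>Y. node_ratio n X Y powr \<theta>) - (\<Sum>i\<le>N. \<alpha> i * C i)\<bar> \<le> e"
        using Z by (simp only: abs_divide abs_of_pos pos_divide_le_eq)
    qed
  qed
  have "\<bar>E X (\<lambda>Y. node_ratio n X Y powr \<theta>) - E X' (\<lambda>Y. node_ratio n X' Y powr \<theta>)\<bar> \<le> e" if "e > 0" for e
  proof -
    have "e / 2 > 0" using that by simp
    from approx[OF this] obtain c where c: "\<And>X. X \<in> chamber (Suc n) \<Longrightarrow> \<bar>E X (\<lambda>Y. node_ratio n X Y powr \<theta>) - c\<bar> \<le> e / 2"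
      by blast
    from c[OF X] c[OF X'] show ?thesis by linarith
  qed
  then have "\<bar>E X (\<lambda>Y. node_ratio n X Y powr \<theta>) - E X' (\<lambda>Y. node_ratio n X' Y powr \<theta>)\<bar> \<le> 0"
    by (rule field_le_epsilon) simp
  then show ?thesis by (simp add: E_def)
qed

lemma ex_chamber: "chamber N \<noteq> {}"
proof -
  have "(\<lambda>i. - real i) \<in> chamber N" by (auto simp: chamber_def)
  then show ?thesis by blast
qed

lemma dixon_plus_theta:
  assumes n: "n \<ge> 1" and a: "a > 0" and \<theta>: "\<theta> > 0"
  shows "\<exists>C>0. \<forall>X\<in>chamber (Suc n). dixon n (\<lambda>_. a + \<theta>) X (\<lambda>_. 1) = C * node_diff_prod n X powr \<theta> * dixon n (\<lambda>_. a) X (\<lambda>_. 1)"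
proof -
  obtain X0 where X0: "X0 \<in> chamber (Suc n)" using ex_chamber by blast
  define C where "C = dixon n (\<lambda>_. a) X0 (\<lambda>Y. node_ratio n X0 Y powr \<theta>) / dixon n (\<lambda>_. a) X0 (\<lambda>_. 1)"
  have Z: "0 < dixon n (\<lambda>_. a) X (\<lambda>_. 1)" "0 < dixon n (\<lambda>_. a + \<theta>) X (\<lambda>_. 1)" if "X \<in> chamber (Suc n)" for X
    using a \<theta> by (auto intro!: dixon_pos[OF that] simp: pos_params_def)
  have eq: "dixon n (\<lambda>_. a + \<theta>) X (\<lambda>_. 1) = C * node_diff_prod n X powr \<theta> * dixon n (\<lambda>_. a) X (\<lambda>_. 1)" if X: "X \<in> chamber (Suc n)" for X
  proof -
    have "dixon n (\<lambda>_. a) X (\<lambda>Y. node_ratio n X Y powr \<theta>) = C * dixon n (\<lambda>_. a) X (\<lambda>_. 1)"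
      using dixon_node_ratio_powr[OF n a \<theta> X X0] Z(1)[OF X] by (simp add: C_def field_simps)
    then show ?thesis unfolding dixon_theta[OF X] by simp
  qed
  have "C > 0"
  proof -
    have "0 < C * node_diff_prod n X0 powr \<theta> * dixon n (\<lambda>_. a) X0 (\<lambda>_. 1)" using Z(2)[OF X0] eq[OF X0] by simp
    then show ?thesis using Z(1)[OF X0] node_diff_prod_pos[OF X0] by (auto simp: zero_less_mult_iff)
  qed
  with eq show ?thesis by blast
qed

lemma node_diff_prod_eq:
  assumes X: "X \<in> chamber (Suc n)"
  shows "node_diff_prod n X = (vand {1..Suc n} (\<lambda>i. exp (2 * X i)))\<^sup>2"
proof -
  define S where "S = {1..Suc n}"
  define g where "g \<alpha> = \<bar>exp (2 * X (fst \<alpha>)) - exp (2 * X (snd \<alpha>))\<bar>" for \<alpha>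
  have S: "finite S" by (simp add: S_def)
  have 1: "vand S (\<lambda>i. exp (2 * X i)) = (\<Prod>\<alpha>\<in>{\<alpha>\<in>S \<times> S. fst \<alpha> < snd \<alpha>}. g \<alpha>)"
    unfolding vand_def g_def using chamberD[OF X] by (intro prod.cong refl) (force simp: S_def)
  have "node_diff_prod n X = (\<Prod>\<alpha>\<in>(SIGMA s:S. S - {s}). g \<alpha>)"
    unfolding node_diff_prod_def node_diff_def S_def[symmetric] using S by (subst prod.Sigma) (auto simp: g_def case_prod_beta')
  also have "(SIGMA s:S. S - {s}) = {\<alpha>\<in>S \<times> S. fst \<alpha> < snd \<alpha>} \<union> prod.swap ` {\<alpha>\<in>S \<times> S. fst \<alpha> < snd \<alpha>}"
    by (auto simp: image_iff prod.swap_def)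
  also have "(\<Prod>\<alpha>\<in>\<dots>. g \<alpha>) = (\<Prod>\<alpha>\<in>{\<alpha>\<in>S \<times> S. fst \<alpha> < snd \<alpha>}. g \<alpha>) * (\<Prod>\<alpha>\<in>prod.swap ` {\<alpha>\<in>S \<times> S. fst \<alpha> < snd \<alpha>}. g \<alpha>)"
    using S by (intro prod.union_disjoint) auto
  also have "(\<Prod>\<alpha>\<in>prod.swap ` {\<alpha>\<in>S \<times> S. fst \<alpha> < snd \<alpha>}. g \<alpha>) = (\<Prod>\<alpha>\<in>{\<alpha>\<in>S \<times> S. fst \<alpha> < snd \<alpha>}. g (prod.swap \<alpha>))"
    by (subst prod.reindex) (auto simp: inj_on_def)
  also have "\<dots> = (\<Prod>\<alpha>\<in>{\<alpha>\<in>S \<times> S. fst \<alpha> < snd \<alpha>}. g \<alpha>)"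
    by (intro prod.cong refl) (simp add: g_def abs_minus_commute)
  finally show ?thesis unfolding S_def[symmetric] 1 power2_eq_square .
qed

text \<open>The Dixon--Anderson integral, up to the value of the constant.\<close>

lemma dixon_const:
  assumes n: "n \<ge> 1" and k: "k > 0"
  shows "\<exists>C>0. \<forall>X\<in>chamber (Suc n). dixon n (\<lambda>_. k) X (\<lambda>_. 1) = C * vand {1..Suc n} (\<lambda>i. exp (2 * X i)) powr (2 * k - 1)"
proof -
  obtain C1 where C1: "C1 > 0" "\<And>X. X \<in> chamber (Suc n) \<Longrightarrow> dixon n (\<lambda>_. 1) X (\<lambda>_. 1) = C1 * vand {1..Suc n} (\<lambda>i. exp (2 * X i))"
    using dixon_one by blast
  have PGp: "node_diff_prod n X powr \<theta> = vand {1..Suc n} (\<lambda>i. exp (2 * X i)) powr (2 * \<theta>)" if X: "X \<in> chamber (Suc n)" for X \<theta>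
    unfolding node_diff_prod_eq[OF X] using vand_pos[OF X] by (simp add: powr_powr flip: powr_numeral)
  \<comment> \<open>\<open>dixon_plus_theta\<close> only increases exponents: for
    \<open>k > 1\<close> it leads from 1 to \<open>k\<close>, for \<open>k < 1\<close> from
    \<open>k\<close> to 1, and the latter relation is solved for the mass at
    \<open>k\<close>.\<close>
  consider "k = 1" | "k > 1" | "k < 1" by linarith
  then show ?thesis
  proof cases
    case 1
    have "v powr (2 * k - 1) = v" if "v > 0" for v using that 1 by simp
    with C1 vand_pos 1 show ?thesis by (intro exI[of _ C1]) metis
  next
    case 2
    then have "k - 1 > 0" by simp
    from dixon_plus_theta[OF n zero_less_one this] obtain C where C: "C > 0"
      "\<And>X. X \<in> chamber (Suc n) \<Longrightarrow> dixon n (\<lambda>_. k) X (\<lambda>_. 1) = C * node_diff_prod n X powr (k - 1) * dixon n (\<lambda>_. 1) X (\<lambda>_. 1)" by auto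
    show ?thesis
    proof (intro exI[of _ "C * C1"] conjI ballI)
      show "0 < C * C1" using C C1 by simp
      fix X assume X: "X \<in> chamber (Suc n)"
      define v where "v = vand {1..Suc n} (\<lambda>i. exp (2 * X i))"
      have v: "v > 0" unfolding v_def by (rule vand_pos[OF X])
      have "v powr (2 * (k - 1)) * v powr 1 = v powr (2 * k - 1)" unfolding powr_add[symmetric] by simp
      then have "v powr (2 * (k - 1)) * v = v powr (2 * k - 1)" using v by simp
      then show "dixon n (\<lambda>_. k) X (\<lambda>_. 1) = C * C1 * v powr (2 * k - 1)"
        unfolding C(2)[OF X] C1(2)[OF X] PGp[OF X] v_def[symmetric] by (simp only: mult_ac)
    qed
  next
    case 3
    then have "1 - k > 0" by simp
    from dixon_plus_theta[OF n k this] obtain C where C: "C > 0"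
      "\<And>X. X \<in> chamber (Suc n) \<Longrightarrow> dixon n (\<lambda>_. 1) X (\<lambda>_. 1) = C * node_diff_prod n X powr (1 - k) * dixon n (\<lambda>_. k) X (\<lambda>_. 1)" by auto
    show ?thesis
    proof (intro exI[of _ "C1 / C"] conjI ballI)
      show "0 < C1 / C" using C C1 by simp
      fix X assume X: "X \<in> chamber (Suc n)"
      define v where "v = vand {1..Suc n} (\<lambda>i. exp (2 * X i))"
      define J where "J = dixon n (\<lambda>_. k) X (\<lambda>_. 1)"
      have v: "v > 0" unfolding v_def by (rule vand_pos[OF X])
      have "C1 * v = C * v powr (2 * (1 - k)) * J"
        using C(2)[OF X] unfolding C1(2)[OF X] PGp[OF X] v_def J_def .
      then have "C1 / C * v * v powr (- (2 * (1 - k))) = J * (v powr (2 * (1 - k)) * v powr (- (2 * (1 - k))))"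
        using C(1) by (simp add: field_simps)
      also have "v powr (2 * (1 - k)) * v powr (- (2 * (1 - k))) = 1"
        unfolding powr_add[symmetric] using v by simp
      finally have "J = C1 / C * (v powr 1 * v powr (- (2 * (1 - k))))" using v by simp
      also have "v powr 1 * v powr (- (2 * (1 - k))) = v powr (2 * k - 1)" unfolding powr_add[symmetric] by simp
      finally show "dixon n (\<lambda>_. k) X (\<lambda>_. 1) = C1 / C * v powr (2 * k - 1)" by (simp add: J_def)
    qed
  qed
qed

section \<open>Limits at the walls\<close>

definition dixon_mean :: "nat \<Rightarrow> (nat \<Rightarrow> real) \<Rightarrow> (nat \<Rightarrow> real) \<Rightarrow> ((nat \<Rightarrow> real) \<Rightarrow> real) \<Rightarrow> real" where
  "dixon_mean n \<kappa> X F = dixon n \<kappa> X F / dixon n \<kappa> X (\<lambda>_. 1)"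

definition char_prod :: "nat \<Rightarrow> real \<Rightarrow> (nat \<Rightarrow> real) \<Rightarrow> real" where
  "char_prod n z Y = (\<Prod>r=1..n. z - exp (2 * Y r))"

lemma continuous_on_char_prod [continuous_intros]: "continuous_on S (char_prod n z)"
  unfolding char_prod_def[abs_def] by (intro continuous_intros)

text \<open>Interpolation of degree \<open>n\<close> at \<open>n + 1\<close> nodes, hence without
  correction term; the signs of the values at the nodes cancel those of the denominators.\<close>

lemma char_prod_interpolation:
  assumes X: "X \<in> chamber (Suc n)" and Y: "Y \<in> open_box n X"
  shows "char_prod n z Y = (\<Sum>s=1..Suc n. (\<Prod>t\<in>{1..Suc n} - {s}. z - exp (2 * X t)) / node_diff n X s * node_dist n X s Y)"
proof -
  define S where "S = {1..Suc n}"
  define V where "V s = exp (2 * X s)" for s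
  define p where "p = (\<Prod>r=1..n. [:- exp (2 * Y r), 1:])"
  have S: "finite S" "S \<noteq> {}" "card S = Suc n" by (auto simp: S_def)
  have inj: "inj_on V S"
  proof (rule inj_onI)
    fix i j assume "i \<in> S" "j \<in> S" "V i = V j"
    then show "i = j" using chamberD[OF X, of i j] chamberD[OF X, of j i]
      by (cases i j rule: linorder_cases) (auto simp: S_def V_def)
  qed
  have dp: "degree p = n" unfolding p_def by (subst degree_prod_eq_sum_degree) auto
  then have c0: "coeff p (card S) = 0" by (intro coeff_eq_0) (simp add: S)
  have pz: "poly p x = (\<Prod>r=1..n. x - exp (2 * Y r))" for x by (simp add: p_def poly_prod)
  have "char_prod n z Y = poly p z" by (simp add: char_prod_def pz)
  also have "\<dots> = (\<Sum>s\<in>S. poly p (V s) * (\<Prod>t\<in>S - {s}. (z - V t) / (V s - V t)))"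
    using lagrange_interpolation[OF S(1,2) inj, of p z] dp c0 S by simp
  also have "\<dots> = (\<Sum>s\<in>S. (\<Prod>t\<in>S - {s}. z - V t) / node_diff n X s * node_dist n X s Y)"
  proof (intro sum.cong refl)
    fix s assume s: "s \<in> S"
    then have s': "s \<in> {1..Suc n}" by (simp add: S_def)
    have 1: "poly p (V s) = (-1) ^ (s - 1) * node_dist n X s Y"
      unfolding pz V_def by (rule node_dist_sgn(1)[OF X s' Y])
    have 2: "(\<Prod>t\<in>S - {s}. V s - V t) = (-1) ^ (s - 1) * node_diff n X s"
      unfolding V_def S_def by (rule node_diff_sgn(1)[OF X s'])
    show "poly p (V s) * (\<Prod>t\<in>S - {s}. (z - V t) / (V s - V t)) = (\<Prod>t\<in>S - {s}. z - V t) / node_diff n X s * node_dist n X s Y"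
      unfolding prod_dividef 1 2 using node_diff_sgn(2)[OF X s'] by simp
  qed
  finally show ?thesis by (simp add: S_def V_def)
qed

text \<open>The interpolation has denominators \<open>node_diff\<close>, which vanish at the walls.
  By \<open>dixon_shift\<close> the total mass for \<open>bump \<kappa> s\<close> contains the same
  factor, so it cancels: the coefficients that remain are polynomials in
  \<open>exp (2 * X t)\<close>, at the price of means for other parameters.\<close>

lemma dixon_mean_char_prod:
  assumes n: "n \<ge> 1" and X: "X \<in> chamber (Suc n)" and \<kappa>: "pos_params n \<kappa>" and F: "continuous_on UNIV F"
  shows "dixon_mean n \<kappa> X (\<lambda>Y. char_prod n z Y * F Y) =
    (\<Sum>s=1..Suc n. (\<Prod>t\<in>{1..Suc n} - {s}. z - exp (2 * X t)) * (\<kappa> s / (\<Sum>s=1..Suc n. \<kappa> s)) * dixon_mean n (bump \<kappa> s) X F)"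
proof -
  define K where "K = (\<Sum>s=1..Suc n. \<kappa> s)"
  have K: "K > 0" unfolding K_def using \<kappa> by (intro sum_pos) (auto simp: pos_params_def)
  define Z where "Z = dixon n \<kappa> X (\<lambda>_. 1)"
  have Z: "Z > 0" unfolding Z_def by (rule dixon_pos[OF X \<kappa>])
  have "dixon n \<kappa> X (\<lambda>Y. char_prod n z Y * F Y) =
    dixon n \<kappa> X (\<lambda>Y. \<Sum>s=1..Suc n. (\<Prod>t\<in>{1..Suc n} - {s}. z - exp (2 * X t)) / node_diff n X s * (node_dist n X s Y * F Y))"
    by (rule dixon_cong[OF X]) (simp only: char_prod_interpolation[OF X] sum_distrib_right mult.assoc)
  also have "\<dots> = (\<Sum>s=1..Suc n. dixon n \<kappa> X (\<lambda>Y. (\<Prod>t\<in>{1..Suc n} - {s}. z - exp (2 * X t)) / node_diff n X s * (node_dist n X s Y * F Y)))"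
  proof (rule dixon_sum[OF X \<kappa>])
    show "continuous_on UNIV (\<lambda>Y. (\<Prod>t\<in>{1..Suc n} - {s}. z - exp (2 * X t)) / node_diff n X s * (node_dist n X s Y * F Y))" for s
      unfolding node_dist_def by (intro continuous_on_mult[OF continuous_on_const] continuous_on_mult[OF _ F] continuous_intros)
  qed
  also have "\<dots> = (\<Sum>s=1..Suc n. (\<Prod>t\<in>{1..Suc n} - {s}. z - exp (2 * X t)) * (\<kappa> s / K) * dixon_mean n (bump \<kappa> s) X F * Z)"
  proof (intro sum.cong refl)
    fix s assume s: "s \<in> {1..Suc n}"
    define Z' where "Z' = dixon n (bump \<kappa> s) X (\<lambda>_. 1)"
    have Z': "Z' > 0" unfolding Z'_def by (rule dixon_pos[OF X pos_params_bump[OF \<kappa>]])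
    have "K * Z' = \<kappa> s * node_diff n X s * Z" unfolding K_def Z'_def Z_def by (rule dixon_shift[OF X \<kappa> s n])
    then have zz: "Z' / node_diff n X s = \<kappa> s / K * Z" using K node_diff_sgn(2)[OF X s] by (simp add: field_simps)
    have "dixon n (bump \<kappa> s) X F = dixon_mean n (bump \<kappa> s) X F * Z'" using Z' by (simp add: dixon_mean_def Z'_def)
    then have "dixon n \<kappa> X (\<lambda>Y. (\<Prod>t\<in>{1..Suc n} - {s}. z - exp (2 * X t)) / node_diff n X s * (node_dist n X s Y * F Y)) =
      (\<Prod>t\<in>{1..Suc n} - {s}. z - exp (2 * X t)) * dixon_mean n (bump \<kappa> s) X F * (Z' / node_diff n X s)"
      unfolding dixon_cmult dixon_bump[OF s, symmetric] by simp
    then show "dixon n \<kappa> X (\<lambda>Y. (\<Prod>t\<in>{1..Suc n} - {s}. z - exp (2 * X t)) / node_diff n X s * (node_dist n X s Y * F Y)) =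
      (\<Prod>t\<in>{1..Suc n} - {s}. z - exp (2 * X t)) * (\<kappa> s / K) * dixon_mean n (bump \<kappa> s) X F * Z"
      unfolding zz by (simp only: mult_ac)
  qed
  finally have "dixon n \<kappa> X (\<lambda>Y. char_prod n z Y * F Y) =
    (\<Sum>s=1..Suc n. (\<Prod>t\<in>{1..Suc n} - {s}. z - exp (2 * X t)) * (\<kappa> s / K) * dixon_mean n (bump \<kappa> s) X F) * Z"
    by (simp only: sum_distrib_right)
  then show ?thesis using Z by (simp add: dixon_mean_def[of n \<kappa>] Z_def[symmetric] K_def)
qed

text \<open>In contrast to \<open>at X0 within chamber N\<close> the point \<open>X0\<close> is not
  removed. For \<open>X0\<close> inside the chamber convergence thus forces the limit to be the
  value, and on the walls both filters agree.\<close>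

definition chamber_filter :: "nat \<Rightarrow> (nat \<Rightarrow> real) \<Rightarrow> (nat \<Rightarrow> real) filter" where
  "chamber_filter N X0 = inf (nhds X0) (principal (chamber N))"

lemma eventually_chamber_filter_chamber: "eventually (\<lambda>X. X \<in> chamber N) (chamber_filter N X0)"
  unfolding chamber_filter_def eventually_inf_principal by simp

lemma tendsto_chamber_filter: "continuous_on UNIV f \<Longrightarrow> (f \<longlongrightarrow> f X0) (chamber_filter N X0)"
  unfolding chamber_filter_def by (rule tendsto_mono[OF inf_le1]) (auto simp: continuous_on_eq_continuous_at isCont_def tendsto_at_iff_tendsto_nhds)

lemma chamber_filter_nontrivial: "X0 \<in> closure (chamber N) \<Longrightarrow> chamber_filter N X0 \<noteq> bot"
  unfolding chamber_filter_def trivial_limit_def eventually_inf_principal closure_iff_nhds_not_empty eventually_nhds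
  by auto

text \<open>All positive parameters are required, not only constant ones, because multiplication by
  \<open>char_prod\<close> raises the parameter at a single node.\<close>

definition mean_converges :: "nat \<Rightarrow> (nat \<Rightarrow> real) \<Rightarrow> ((nat \<Rightarrow> real) \<Rightarrow> real) \<Rightarrow> bool" where
  "mean_converges n X0 F \<longleftrightarrow> continuous_on UNIV F \<and> (\<forall>\<kappa>. pos_params n \<kappa> \<longrightarrow> (\<exists>L. ((\<lambda>X. dixon_mean n \<kappa> X F) \<longlongrightarrow> L) (chamber_filter (Suc n) X0)))"

text \<open>Convergence of means is not obviously preserved by products, but multipliers are closed under them.\<close>

definition mean_multiplier :: "nat \<Rightarrow> (nat \<Rightarrow> real) \<Rightarrow> ((nat \<Rightarrow> real) \<Rightarrow> real) \<Rightarrow> bool" where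
  "mean_multiplier n X0 f \<longleftrightarrow> continuous_on UNIV f \<and> (\<forall>F. mean_converges n X0 F \<longrightarrow> mean_converges n X0 (\<lambda>Y. f Y * F Y))"

lemma mean_converges_1: "mean_converges n X0 (\<lambda>_. 1)"
  unfolding mean_converges_def
proof (intro conjI allI impI)
  fix \<kappa> assume \<kappa>: "pos_params n \<kappa>"
  have "eventually (\<lambda>X. dixon_mean n \<kappa> X (\<lambda>_. 1) = 1) (chamber_filter (Suc n) X0)"
    using eventually_chamber_filter_chamber
  proof eventually_elim
    case (elim X)
    from dixon_pos[OF this \<kappa>] show ?case by (simp add: dixon_mean_def)
  qed
  then show "\<exists>L. ((\<lambda>X. dixon_mean n \<kappa> X (\<lambda>_. 1)) \<longlongrightarrow> L) (chamber_filter (Suc n) X0)"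
    by (intro exI[of _ 1]) (rule tendsto_eventually)
qed simp

lemma mean_multiplier_mean_converges: "mean_multiplier n X0 f \<Longrightarrow> mean_converges n X0 f"
  unfolding mean_multiplier_def using mean_converges_1[of n X0] by fastforce

lemma mean_multiplier_const: "mean_multiplier n X0 (\<lambda>_. c)"
  unfolding mean_multiplier_def mean_converges_def
proof (intro conjI allI impI)
  fix F \<kappa> assume F: "continuous_on UNIV F \<and> (\<forall>\<kappa>. pos_params n \<kappa> \<longrightarrow> (\<exists>L. ((\<lambda>X. dixon_mean n \<kappa> X F) \<longlongrightarrow> L) (chamber_filter (Suc n) X0)))"
    and "pos_params n \<kappa>"
  then obtain L where "((\<lambda>X. dixon_mean n \<kappa> X F) \<longlongrightarrow> L) (chamber_filter (Suc n) X0)" by blast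
  then have "((\<lambda>X. c * dixon_mean n \<kappa> X F) \<longlongrightarrow> c * L) (chamber_filter (Suc n) X0)" by (intro tendsto_intros)
  then show "\<exists>L. ((\<lambda>X. dixon_mean n \<kappa> X (\<lambda>Y. c * F Y)) \<longlongrightarrow> L) (chamber_filter (Suc n) X0)"
    unfolding dixon_mean_def dixon_cmult by (intro exI[of _ "c * L"]) simp
qed (auto intro!: continuous_intros)

lemma mean_multiplier_add:
  assumes f: "mean_multiplier n X0 f" and g: "mean_multiplier n X0 g" shows "mean_multiplier n X0 (\<lambda>Y. f Y + g Y)"
  unfolding mean_multiplier_def
proof (intro conjI allI impI)
  show "continuous_on UNIV (\<lambda>Y. f Y + g Y)" using f g by (auto simp: mean_multiplier_def intro!: continuous_intros)
  fix F assume "mean_converges n X0 F"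
  then have fF: "mean_converges n X0 (\<lambda>Y. f Y * F Y)" and gF: "mean_converges n X0 (\<lambda>Y. g Y * F Y)" using f g by (auto simp: mean_multiplier_def)
  show "mean_converges n X0 (\<lambda>Y. (f Y + g Y) * F Y)"
    unfolding mean_converges_def
  proof (intro conjI allI impI)
    show "continuous_on UNIV (\<lambda>Y. (f Y + g Y) * F Y)"
      using fF gF by (auto simp: mean_converges_def distrib_right intro!: continuous_intros)
    fix \<kappa> assume \<kappa>: "pos_params n \<kappa>"
    obtain L1 where L1: "((\<lambda>X. dixon_mean n \<kappa> X (\<lambda>Y. f Y * F Y)) \<longlongrightarrow> L1) (chamber_filter (Suc n) X0)"
      using fF \<kappa> by (auto simp: mean_converges_def)
    obtain L2 where L2: "((\<lambda>X. dixon_mean n \<kappa> X (\<lambda>Y. g Y * F Y)) \<longlongrightarrow> L2) (chamber_filter (Suc n) X0)"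
      using gF \<kappa> by (auto simp: mean_converges_def)
    have "eventually (\<lambda>X. dixon_mean n \<kappa> X (\<lambda>Y. f Y * F Y) + dixon_mean n \<kappa> X (\<lambda>Y. g Y * F Y) = dixon_mean n \<kappa> X (\<lambda>Y. (f Y + g Y) * F Y)) (chamber_filter (Suc n) X0)"
      using eventually_chamber_filter_chamber
    proof eventually_elim
      case (elim X)
      have "dixon n \<kappa> X (\<lambda>Y. f Y * F Y + g Y * F Y) = dixon n \<kappa> X (\<lambda>Y. f Y * F Y) + dixon n \<kappa> X (\<lambda>Y. g Y * F Y)"
        using fF gF by (intro dixon_add[OF elim \<kappa>]) (auto simp: mean_converges_def)
      then show ?case by (simp add: dixon_mean_def distrib_right add_divide_distrib)
    qed
    from Lim_transform_eventually[OF tendsto_add[OF L1 L2] this]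
    show "\<exists>L. ((\<lambda>X. dixon_mean n \<kappa> X (\<lambda>Y. (f Y + g Y) * F Y)) \<longlongrightarrow> L) (chamber_filter (Suc n) X0)" by blast
  qed
qed

lemma mean_multiplier_mult:
  assumes f: "mean_multiplier n X0 f" and g: "mean_multiplier n X0 g" shows "mean_multiplier n X0 (\<lambda>Y. f Y * g Y)"
  using assms by (auto simp: mean_multiplier_def mult.assoc intro!: continuous_on_mult)

lemma mean_multiplier_char_prod:
  assumes n: "n \<ge> 1" shows "mean_multiplier n X0 (char_prod n z)"
  unfolding mean_multiplier_def
proof (intro conjI allI impI)
  show "continuous_on UNIV (char_prod n z)" by (rule continuous_on_char_prod)
  fix F assume F: "mean_converges n X0 F"
  then have cF: "continuous_on UNIV F" by (simp add: mean_converges_def)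
  show "mean_converges n X0 (\<lambda>Y. char_prod n z Y * F Y)"
    unfolding mean_converges_def
  proof (intro conjI allI impI)
    show "continuous_on UNIV (\<lambda>Y. char_prod n z Y * F Y)" by (intro continuous_on_mult continuous_on_char_prod cF)
    fix \<kappa> assume \<kappa>: "pos_params n \<kappa>"
    have "\<exists>L. ((\<lambda>X. dixon_mean n (bump \<kappa> s) X F) \<longlongrightarrow> L) (chamber_filter (Suc n) X0)" for s
      using F pos_params_bump[OF \<kappa>] by (simp add: mean_converges_def)
    then obtain L where L: "\<And>s. ((\<lambda>X. dixon_mean n (bump \<kappa> s) X F) \<longlongrightarrow> L s) (chamber_filter (Suc n) X0)" by metis
    define R where "R X = (\<Sum>s=1..Suc n. (\<Prod>t\<in>{1..Suc n} - {s}. z - exp (2 * X t)) * (\<kappa> s / (\<Sum>s=1..Suc n. \<kappa> s)) * dixon_mean n (bump \<kappa> s) X F)" for X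
    have X0: "((\<lambda>X. X t) \<longlongrightarrow> X0 t) (chamber_filter (Suc n) X0)" for t
      by (rule tendsto_chamber_filter[of "\<lambda>X. X t"]) (rule continuous_on_component)
    have "(R \<longlongrightarrow> (\<Sum>s=1..Suc n. (\<Prod>t\<in>{1..Suc n} - {s}. z - exp (2 * X0 t)) * (\<kappa> s / (\<Sum>s=1..Suc n. \<kappa> s)) * L s)) (chamber_filter (Suc n) X0)"
      unfolding R_def by (intro tendsto_sum tendsto_prod tendsto_mult tendsto_const tendsto_diff tendsto_exp X0 L)
    moreover have "eventually (\<lambda>X. R X = dixon_mean n \<kappa> X (\<lambda>Y. char_prod n z Y * F Y)) (chamber_filter (Suc n) X0)"
      using eventually_chamber_filter_chamber by eventually_elim (simp only: dixon_mean_char_prod[OF n _ \<kappa> cF] R_def)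
    ultimately show "\<exists>L. ((\<lambda>X. dixon_mean n \<kappa> X (\<lambda>Y. char_prod n z Y * F Y)) \<longlongrightarrow> L) (chamber_filter (Suc n) X0)"
      by (intro exI) (rule Lim_transform_eventually)
  qed
qed

text \<open>The approximate limits for the errors \<open>1 / real (Suc m)\<close> form a Cauchy
  sequence, since along a nontrivial filter two of them are close to a common value of
  \<open>h\<close>.\<close>

lemma tendsto_of_approx:
  fixes h :: "'a \<Rightarrow> real"
  assumes G: "G \<noteq> bot" and a: "\<And>e. e > 0 \<Longrightarrow> \<exists>L. eventually (\<lambda>x. \<bar>h x - L\<bar> \<le> e) G"
  shows "\<exists>L. (h \<longlongrightarrow> L) G"
proof -
  have "\<exists>L. eventually (\<lambda>x. \<bar>h x - L\<bar> \<le> 1 / real (Suc m)) G" for m by (rule a) simp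
  then obtain L where L: "\<And>m. eventually (\<lambda>x. \<bar>h x - L m\<bar> \<le> 1 / real (Suc m)) G" by metis
  have d: "\<bar>L m - L k\<bar> \<le> 1 / real (Suc m) + 1 / real (Suc k)" for m k
  proof -
    have "eventually (\<lambda>x. \<bar>L m - L k\<bar> \<le> 1 / real (Suc m) + 1 / real (Suc k)) G"
      using L[of m] L[of k] by eventually_elim linarith
    then show ?thesis using G by (simp add: eventually_const_iff)
  qed
  have inv: "\<exists>M. \<forall>m\<ge>M. 1 / real (Suc m) < e" if "e > 0" for e :: real
  proof -
    obtain M where "1 / real (Suc M) < e" using nat_approx_posE[OF \<open>e > 0\<close>] by blast
    moreover have "1 / real (Suc m) \<le> 1 / real (Suc M)" if "m \<ge> M" for m
      using that by (intro divide_left_mono) auto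
    ultimately show ?thesis by (intro exI[of _ M]) (meson le_less_trans)
  qed
  have "Cauchy L"
  proof (rule metric_CauchyI)
    fix e :: real assume "e > 0"
    then obtain M where M: "\<And>m. m \<ge> M \<Longrightarrow> 1 / real (Suc m) < e / 2" using inv[of "e / 2"] by auto
    show "\<exists>M. \<forall>m\<ge>M. \<forall>k\<ge>M. dist (L m) (L k) < e"
    proof (intro exI[of _ M] allI impI)
      fix m k assume "m \<ge> M" "k \<ge> M"
      from M[OF this(1)] M[OF this(2)] d[of m k] show "dist (L m) (L k) < e" by (simp add: dist_real_def)
    qed
  qed
  then obtain l where l: "L \<longlonglongrightarrow> l" using Cauchy_convergent_iff convergentD by blast
  show ?thesis
  proof (intro exI[of _ l] tendstoI)
    fix e :: real assume e: "e > 0"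
    then obtain M1 where M1: "\<And>m. m \<ge> M1 \<Longrightarrow> 1 / real (Suc m) < e / 2" using inv[of "e / 2"] by auto
    obtain M2 where M2: "\<And>m. m \<ge> M2 \<Longrightarrow> dist (L m) l < e / 2" using l e unfolding lim_sequentially by (meson half_gt_zero)
    define m where "m = max M1 M2"
    have m: "1 / real (Suc m) < e / 2" "dist (L m) l < e / 2" using M1[of m] M2[of m] by (auto simp: m_def)
    show "eventually (\<lambda>x. dist (h x) l < e) G"
      using L[of m]
    proof eventually_elim
      case (elim x)
      then show ?case using m unfolding dist_real_def by linarith
    qed
  qed
qed

text \<open>Equality for all \<open>z\<close> would be an equality of polynomials. Cancel the
  factors before the first coordinate at which the points differ; by the ordering, the larger of the
  two values there is a root of only one of the remaining polynomials.\<close>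

lemma char_prod_separates:
  assumes Y: "Y \<in> extensional {1..n}" "Y' \<in> extensional {1..n}" "Y \<noteq> Y'"
    and srt: "\<And>i j. 1 \<le> i \<Longrightarrow> i < j \<Longrightarrow> j \<le> n \<Longrightarrow> Y j \<le> Y i" "\<And>i j. 1 \<le> i \<Longrightarrow> i < j \<Longrightarrow> j \<le> n \<Longrightarrow> Y' j \<le> Y' i"
  shows "\<exists>z. char_prod n z Y \<noteq> char_prod n z Y'"
proof -
  have "\<exists>i. i \<in> {1..n} \<and> Y i \<noteq> Y' i"
  proof (rule ccontr)
    assume "\<not> ?thesis"
    then have "Y = Y'" by (intro extensionalityI[OF Y(1,2)]) auto
    with Y(3) show False ..
  qed
  then obtain i where i: "i \<in> {1..n}" "Y i \<noteq> Y' i" "\<And>j. j < i \<Longrightarrow> \<not> (j \<in> {1..n} \<and> Y j \<noteq> Y' j)"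
    using exists_least_iff[of "\<lambda>i. i \<in> {1..n} \<and> Y i \<noteq> Y' i"] by blast
  have main: "\<exists>z. char_prod n z Y \<noteq> char_prod n z Y'"
    if lt: "Y i < Y' i" and eq: "\<And>j. j \<in> {1..<i} \<Longrightarrow> Y j = Y' j"
      and srt: "\<And>i j. 1 \<le> i \<Longrightarrow> i < j \<Longrightarrow> j \<le> n \<Longrightarrow> Y j \<le> Y i" for Y Y' :: "nat \<Rightarrow> real"
  proof (rule ccontr)
    assume "\<not> ?thesis"
    then have eqz: "char_prod n z Y = char_prod n z Y'" for z by blast
    define P where "P A Y = (\<Prod>r\<in>A. [:- exp (2 * Y r), 1:])" for A :: "nat set" and Y :: "nat \<Rightarrow> real"
    have PQ: "poly (P {1..n} Y) z = char_prod n z Y" for z Y by (simp add: P_def poly_prod char_prod_def)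
    have split: "P {1..n} Y = P {1..<i} Y * P {i..n} Y" for Y
    proof -
      have "{1..n} = {1..<i} \<union> {i..n}" using i by auto
      then show ?thesis unfolding P_def by (simp only:) (subst prod.union_disjoint, auto)
    qed
    have "poly (P {1..n} Y) = poly (P {1..n} Y')" by (rule ext) (simp only: PQ eqz)
    then have "P {1..n} Y = P {1..n} Y'" by (simp only: poly_eq_poly_eq_iff)
    moreover have "P {1..<i} Y = P {1..<i} Y'" unfolding P_def using eq by (intro prod.cong) auto
    moreover have "P {1..<i} Y' \<noteq> 0" unfolding P_def by simp
    ultimately have "P {1..<i} Y' * P {i..n} Y = P {1..<i} Y' * P {i..n} Y'" by (simp only: split)
    then have "P {i..n} Y = P {i..n} Y'" using \<open>P {1..<i} Y' \<noteq> 0\<close> by (metis mult_left_cancel)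
    moreover have "poly (P {i..n} Y') (exp (2 * Y' i)) = 0"
      unfolding P_def poly_prod using i by (intro prod_zero bexI[of _ i]) auto
    moreover have "poly (P {i..n} Y) (exp (2 * Y' i)) \<noteq> 0"
    proof -
      have "Y r \<noteq> Y' i" if "r \<in> {i..n}" for r
        using srt[of i r] lt that i by (cases "r = i") auto
      then have ne: "exp (2 * Y' i) \<noteq> exp (2 * Y r)" if "r \<in> {i..n}" for r
        using that by (metis exp_inj_iff mult_cancel_left zero_neq_numeral)
      have "poly [:- exp (2 * Y r), 1:] (exp (2 * Y' i)) \<noteq> 0" if "r \<in> {i..n}" for r
        using ne[OF that] by simp
      then show ?thesis unfolding P_def poly_prod prod_zero_iff[OF finite_atLeastAtMost] by blast
    qed
    ultimately show False by simp
  qed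
  show ?thesis
  proof (cases "Y i < Y' i")
    case True
    show ?thesis by (rule main[where Y = Y and Y' = Y']) (use True i srt in auto)
  next
    case False
    then have "Y' i < Y i" using i by simp
    then have "\<exists>z. char_prod n z Y' \<noteq> char_prod n z Y"
      by (rule main[where Y = Y' and Y' = Y]) (use i srt in force)+
    then show ?thesis by metis
  qed
qed

lemma dixon_mean_limit:
  assumes n: "n \<ge> 1" and X0: "X0 \<in> closure (chamber (Suc n))" and \<kappa>: "pos_params n \<kappa>"
    and f: "continuous_on (closure (chamber n)) f"
  shows "\<exists>L. ((\<lambda>X. dixon_mean n \<kappa> X f) \<longlongrightarrow> L) (chamber_filter (Suc n) X0)"
proof (rule tendsto_of_approx[OF chamber_filter_nontrivial[OF X0]])
  fix e :: real assume e: "e > 0"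
  define a b where "a = X0 (Suc n) - 1" and "b = X0 1 + 1"
  define C where "C = closure (chamber n)"
  \<comment> \<open>One compact set containing \<open>interlacing n X\<close> for all chamber points
    \<open>X\<close> near \<open>X0\<close>; the margin 1 in \<open>a\<close> and \<open>b\<close>
    provides the room. The intersection with \<open>C\<close> is needed because
    \<open>char_prod\<close> does not see the order of the coordinates.\<close>
  define S where "S = PiE {1..n} (\<lambda>_. {a..b}) \<inter> C"
  have C: "closed C" "continuous_on C f" using f by (auto simp: C_def)
  have S: "compact S" unfolding S_def by (intro compact_Int_closed compact_PiE_nat C(1)) auto
  have SC: "S \<subseteq> C" by (auto simp: S_def)
  have "\<exists>g. mean_multiplier n X0 g \<and> (\<forall>Y\<in>S. \<bar>f Y - g Y\<bar> < e / 2)"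
  proof (rule Stone_Weierstrass_HOL[OF S])
    show "mean_multiplier n X0 (\<lambda>_. c)" for c by (rule mean_multiplier_const)
    show "continuous_on S g" if "mean_multiplier n X0 g" for g using that by (auto simp: mean_multiplier_def intro: continuous_on_subset)
    show "mean_multiplier n X0 (\<lambda>Y. g Y + h Y)" if "mean_multiplier n X0 g \<and> mean_multiplier n X0 h" for g h using that mean_multiplier_add by blast
    show "mean_multiplier n X0 (\<lambda>Y. g Y * h Y)" if "mean_multiplier n X0 g \<and> mean_multiplier n X0 h" for g h using that mean_multiplier_mult by blast
    show "\<exists>g. mean_multiplier n X0 g \<and> g Y \<noteq> g Y'" if Y: "Y \<in> S \<and> Y' \<in> S \<and> Y \<noteq> Y'" for Y Y'
    proof -
      have "\<exists>z. char_prod n z Y \<noteq> char_prod n z Y'"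
        using Y by (intro char_prod_separates) (auto simp: S_def C_def closure_chamber PiE_def)
      then show ?thesis using mean_multiplier_char_prod[OF n] by blast
    qed
    show "continuous_on S f" by (rule continuous_on_subset[OF C(2) SC])
    show "0 < e / 2" using e by simp
  qed
  then obtain g where g: "mean_multiplier n X0 g" "\<And>Y. Y \<in> S \<Longrightarrow> \<bar>f Y - g Y\<bar> < e / 2" by blast
  have cg: "continuous_on UNIV g" using g(1) by (simp add: mean_multiplier_def)
  obtain L where L: "((\<lambda>X. dixon_mean n \<kappa> X g) \<longlongrightarrow> L) (chamber_filter (Suc n) X0)"
    using mean_multiplier_mean_converges[OF g(1)] \<kappa> by (auto simp: mean_converges_def)
  have ev1: "eventually (\<lambda>X. \<bar>dixon_mean n \<kappa> X g - L\<bar> < e / 2) (chamber_filter (Suc n) X0)"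
    using tendstoD[OF L, of "e / 2"] e by (simp add: dist_real_def)
  have evt: "((\<lambda>X. X t) \<longlongrightarrow> X0 t) (chamber_filter (Suc n) X0)" for t
    by (rule tendsto_chamber_filter[of "\<lambda>X. X t"]) (rule continuous_on_component)
  have ev2: "eventually (\<lambda>X. X (Suc n) > a) (chamber_filter (Suc n) X0)" by (rule order_tendstoD(1)[OF evt]) (simp add: a_def)
  have ev3: "eventually (\<lambda>X. X 1 < b) (chamber_filter (Suc n) X0)" by (rule order_tendstoD(2)[OF evt]) (simp add: b_def)
  have "eventually (\<lambda>X. \<bar>dixon_mean n \<kappa> X f - L\<bar> \<le> e) (chamber_filter (Suc n) X0)"
    using eventually_chamber_filter_chamber ev1 ev2 ev3
  proof eventually_elim
    case (elim X)
    note X = elim(1)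
    have IC: "interlacing n X \<subseteq> C" using interlacing_closure_chamber[OF X] by (auto simp: C_def)
    have IS: "interlacing n X \<subseteq> S"
    proof
      fix Y assume Y: "Y \<in> interlacing n X"
      note D = interlacingD[OF X Y]
      have "Y \<in> PiE {1..n} (\<lambda>_. {a..b})"
      proof (rule PiE_I)
        fix j assume "j \<in> {1..n}"
        then show "Y j \<in> {a..b}" using D(2)[of 1 j] D(3)[of j "Suc n"] elim(3,4) by auto
      next
        fix j assume "j \<notin> {1..n}"
        with Y show "Y j = undefined" unfolding interlacing_def by (rule PiE_arb)
      qed
      then show "Y \<in> S" using IC Y by (auto simp: S_def)
    qed
    define Z where "Z = dixon n \<kappa> X (\<lambda>_. 1)"
    have Z: "Z > 0" unfolding Z_def by (rule dixon_pos[OF X \<kappa>])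
    have "dixon n \<kappa> X (\<lambda>Y. f Y - g Y) = dixon n \<kappa> X f - dixon n \<kappa> X g"
      unfolding dixon_def left_diff_distrib
      by (intro Bochner_Integration.integral_diff integrable_dixon[OF X \<kappa> C(1) IC C(2)] integrable_dixon_UNIV[OF X \<kappa> cg])
    moreover have "\<bar>dixon n \<kappa> X (\<lambda>Y. f Y - g Y)\<bar> \<le> e / 2 * Z" unfolding Z_def
    proof (rule dixon_bound[OF X \<kappa> C(1) IC])
      show "continuous_on C (\<lambda>Y. f Y - g Y)" by (intro continuous_on_diff C(2) continuous_on_subset[OF cg]) auto
      show "\<bar>f Y - g Y\<bar> \<le> e / 2" if "Y \<in> interlacing n X" for Y using g(2)[of Y] IS that by auto
    qed
    ultimately have "\<bar>dixon_mean n \<kappa> X f - dixon_mean n \<kappa> X g\<bar> \<le> e / 2"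
      unfolding dixon_mean_def Z_def[symmetric] diff_divide_distrib[symmetric]
      using Z by (simp only: abs_divide abs_of_pos pos_divide_le_eq)
    with elim(2) show ?case by linarith
  qed
  then show "\<exists>L. eventually (\<lambda>X. \<bar>dixon_mean n \<kappa> X f - L\<bar> \<le> e) (chamber_filter (Suc n) X0)" by blast
qed

text \<open>The monomials in \<open>exp (2 * x)\<close> and \<open>exp (2 * y)\<close> that arise from
  \<open>esinh (a - b) = (exp (2 * a) - exp (2 * b)) / (2 * exp (2 * a))\<close>.\<close>

definition kernel_X :: "real \<Rightarrow> nat \<Rightarrow> (nat \<Rightarrow> real) \<Rightarrow> real" where
  "kernel_X k n X = exp (- rho k (Suc n) X) * (\<Prod>\<alpha>\<in>pos_roots (Suc n). 1 / (2 * exp (2 * X (fst \<alpha>)))) powr (1 - 2 * k) *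
     ((\<Prod>r=1..n. 1 / (2 * exp (2 * X r))) * (\<Prod>\<alpha>\<in>pos_roots n. 1 / (2 * exp (2 * X (fst \<alpha>))))) powr (k - 1)"

definition kernel_Y :: "real \<Rightarrow> nat \<Rightarrow> (nat \<Rightarrow> real) \<Rightarrow> real" where
  "kernel_Y k n Y = exp (rho k n Y) * (\<Prod>\<alpha>\<in>pos_roots n. 1 / (2 * exp (2 * Y (fst \<alpha>)))) *
     (\<Prod>\<alpha>\<in>pos_roots (Suc n). 1 / (2 * exp (2 * Y (fst \<alpha>)))) powr (k - 1) * (\<Prod>r=1..n. 1 / exp (2 * Y r))"

lemma continuous_on_rho [continuous_intros]: "continuous_on S (rho k n)"
  unfolding rho_def[abs_def] root_val_def by (intro continuous_intros)

lemma continuous_on_kernel_X: "continuous_on UNIV (kernel_X k n)"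
  unfolding kernel_X_def[abs_def] by (intro continuous_intros continuous_on_powr) auto

lemma continuous_on_kernel_Y: "continuous_on UNIV (kernel_Y k n)"
  unfolding kernel_Y_def[abs_def] by (intro continuous_intros continuous_on_powr) auto

lemma esinh_exp: "esinh (a - b) = (exp (2 * a) - exp (2 * b)) * (1 / (2 * exp (2 * a)))"
  by (simp add: esinh_def field_simps exp_diff)

lemma esinh_prod_vand: "esinh_prod n X = vand {1..n} (\<lambda>i. exp (2 * X i)) * (\<Prod>\<alpha>\<in>pos_roots n. 1 / (2 * exp (2 * X (fst \<alpha>))))"
  unfolding esinh_prod_def root_val_def esinh_exp prod.distrib vand_pos_roots ..

lemma esinh_bracket_exp:
  assumes X: "X \<in> chamber (Suc n)" and Y: "Y \<in> interlacing n X"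
  shows "esinh_bracket n X Y = node_dist_prod n X Y *
     ((\<Prod>r=1..n. 1 / (2 * exp (2 * X r))) * (\<Prod>\<alpha>\<in>pos_roots n. 1 / (2 * exp (2 * X (fst \<alpha>))))) *
     (\<Prod>\<alpha>\<in>pos_roots (Suc n). 1 / (2 * exp (2 * Y (fst \<alpha>))))"
proof -
  note D = interlacingD[OF X Y]
  define d where "d a b = \<bar>exp (2 * a) - exp (2 * b)\<bar>" for a b :: real
  have "node_dist_prod n X Y = (\<Prod>r=1..n. \<Prod>s=1..Suc n. d (Y r) (X s))"
    unfolding node_dist_prod_def node_dist_def d_def by (rule prod.swap)
  also have "\<dots> = (\<Prod>r=1..n. (\<Prod>s=1..r. exp (2 * X s) - exp (2 * Y r)) * (\<Prod>s=r+1..n+1. exp (2 * Y r) - exp (2 * X s)))"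
  proof (intro prod.cong refl)
    fix r assume r: "r \<in> {1..n}"
    have "{1..Suc n} = {1..r} \<union> {r+1..n+1}" using r by auto
    then have "(\<Prod>s=1..Suc n. d (Y r) (X s)) = (\<Prod>s\<in>{1..r} \<union> {r+1..n+1}. d (Y r) (X s))" by (rule arg_cong)
    also have "\<dots> = (\<Prod>s=1..r. d (Y r) (X s)) * (\<Prod>s=r+1..n+1. d (Y r) (X s))"
      by (rule prod.union_disjoint) auto
    also have "(\<Prod>s=1..r. d (Y r) (X s)) = (\<Prod>s=1..r. exp (2 * X s) - exp (2 * Y r))"
      using D(2)[of _ r] r by (intro prod.cong refl) (auto simp: d_def)
    also have "(\<Prod>s=r+1..n+1. d (Y r) (X s)) = (\<Prod>s=r+1..n+1. exp (2 * Y r) - exp (2 * X s))"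
      using D(3)[of r] r by (intro prod.cong refl) (auto simp: d_def)
    finally show "(\<Prod>s=1..Suc n. d (Y r) (X s)) = (\<Prod>s=1..r. exp (2 * X s) - exp (2 * Y r)) * (\<Prod>s=r+1..n+1. exp (2 * Y r) - exp (2 * X s))" .
  qed
  finally have P: "node_dist_prod n X Y = \<dots>" .
  have dec: "(\<Prod>r=1..n. (\<Prod>s=1..r. exp (2 * X s) - exp (2 * Y r)) * (\<Prod>s=r+1..n+1. exp (2 * Y r) - exp (2 * X s))) =
    (\<Prod>r=1..n. exp (2 * X r) - exp (2 * Y r)) * (\<Prod>\<alpha>\<in>pos_roots n. exp (2 * X (fst \<alpha>)) - exp (2 * Y (snd \<alpha>))) *
     (\<Prod>\<alpha>\<in>pos_roots (Suc n). exp (2 * Y (fst \<alpha>)) - exp (2 * X (snd \<alpha>)))"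
    using bracket_decomp[of "\<lambda>a b. exp (2 * a) - exp (2 * b)" X Y n] by simp
  show ?thesis unfolding P unfolding dec unfolding esinh_bracket_def esinh_exp prod.distrib by (simp only: mult_ac)
qed

text \<open>Outside the Dixon density, all that degenerates at the walls is the power of the
  Vandermonde product of \<open>X\<close>; \<open>kernel_X\<close> and \<open>kernel_Y\<close> are
  continuous everywhere.\<close>

lemma kernel_weight:
  assumes X: "X \<in> chamber (Suc n)" and Y: "Y \<in> interlacing n X" and k: "k > 0"
  shows "kernel_S k n Y X * dprod n Y powr (2 * k) =
    kernel_X k n X * vand {1..Suc n} (\<lambda>i. exp (2 * X i)) powr (1 - 2 * k) *
    (kernel_Y k n Y * (exp_vand n Y * (\<Prod>r=1..n. cut_weight n (\<lambda>_. k) X r (Y r))))"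
proof -
  define A1 where "A1 = (\<Prod>\<alpha>\<in>pos_roots (Suc n). 1 / (2 * exp (2 * X (fst \<alpha>))))"
  define A2 where "A2 = (\<Prod>r=1..n. 1 / (2 * exp (2 * X r))) * (\<Prod>\<alpha>\<in>pos_roots n. 1 / (2 * exp (2 * X (fst \<alpha>))))"
  define B1 where "B1 = (\<Prod>\<alpha>\<in>pos_roots n. 1 / (2 * exp (2 * Y (fst \<alpha>))))"
  define B2 where "B2 = (\<Prod>\<alpha>\<in>pos_roots (Suc n). 1 / (2 * exp (2 * Y (fst \<alpha>))))"
  have pos: "A1 > 0" "A2 > 0" "B1 > 0" "B2 > 0"
    unfolding A1_def A2_def B1_def B2_def by (auto intro!: prod_pos mult_pos_pos)
  define v where "v = vand {1..Suc n} (\<lambda>i. exp (2 * X i))"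
  have v: "v > 0" unfolding v_def by (rule vand_pos[OF X])
  have s1: "esinh_prod (Suc n) X powr (1 - 2 * k) = v powr (1 - 2 * k) * A1 powr (1 - 2 * k)"
    unfolding esinh_prod_vand v_def[symmetric] A1_def[symmetric] using v pos by (simp add: powr_mult)
  have s2: "esinh_prod n Y = exp_vand n Y * B1" unfolding esinh_prod_vand B1_def exp_vand_def ..
  have s3: "esinh_bracket n X Y powr (k - 1) = node_dist_prod n X Y powr (k - 1) * A2 powr (k - 1) * B2 powr (k - 1)"
    unfolding esinh_bracket_exp[OF X Y] A2_def[symmetric] B2_def[symmetric] using pos node_dist_prod_nonneg[of n X Y] by (simp add: powr_mult)
  have bbp: "(\<Prod>r=1..n. cut_weight n (\<lambda>_. k) X r (Y r)) = (\<Prod>r=1..n. exp (2 * Y r)) * node_dist_prod n X Y powr (k - 1)"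
  proof -
    have "(\<Prod>r=1..n. cut_weight n (\<lambda>_. k) X r (Y r)) = (\<Prod>r=1..n. exp (2 * Y r) * (\<Prod>s=1..Suc n. \<bar>exp (2 * Y r) - exp (2 * X s)\<bar>) powr (k - 1))"
    proof (intro prod.cong refl)
      fix r assume "r \<in> {1..n}"
      then have "Y r \<in> {X (Suc r)..X r}" using interlacingD(1)[OF X Y] by auto
      then show "cut_weight n (\<lambda>_. k) X r (Y r) = exp (2 * Y r) * (\<Prod>s=1..Suc n. \<bar>exp (2 * Y r) - exp (2 * X s)\<bar>) powr (k - 1)"
        unfolding cut_weight_def node_weight_def by (subst prod_powr_distrib) auto
    qed
    also have "\<dots> = (\<Prod>r=1..n. exp (2 * Y r)) * (\<Prod>r=1..n. \<Prod>s=1..Suc n. \<bar>exp (2 * Y r) - exp (2 * X s)\<bar>) powr (k - 1)"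
    proof -
      have "(\<Prod>r=1..n. \<Prod>s=1..Suc n. \<bar>exp (2 * Y r) - exp (2 * X s)\<bar>) powr (k - 1) =
        (\<Prod>r=1..n. (\<Prod>s=1..Suc n. \<bar>exp (2 * Y r) - exp (2 * X s)\<bar>) powr (k - 1))"
        by (rule prod_powr_distrib)
      then show ?thesis unfolding prod.distrib by simp
    qed
    also have "(\<Prod>r=1..n. \<Prod>s=1..Suc n. \<bar>exp (2 * Y r) - exp (2 * X s)\<bar>) = node_dist_prod n X Y"
      unfolding node_dist_prod_def node_dist_def by (rule prod.swap)
    finally show ?thesis .
  qed
  \<comment> \<open>\<open>cut_weight\<close> contains the Jacobian \<open>exp (2 * y)\<close>,
    which the kernel lacks; the last factor of \<open>kernel_Y\<close> compensates for it.\<close>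
  have e1: "(\<Prod>r=1..n. 1 / exp (2 * Y r)) * (\<Prod>r=1..n. exp (2 * Y r)) = 1"
    unfolding prod.distrib[symmetric] by (intro prod.neutral) simp
  have e2: "exp (rho k n Y - rho k (Suc n) X) = exp (- rho k (Suc n) X) * exp (rho k n Y)" by (simp flip: exp_add)
  have "kernel_S k n Y X * dprod n Y powr (2 * k) =
    (exp (- rho k (Suc n) X) * A1 powr (1 - 2 * k) * A2 powr (k - 1)) * v powr (1 - 2 * k) *
    ((exp (rho k n Y) * B1 * B2 powr (k - 1) * 1) * (exp_vand n Y * node_dist_prod n X Y powr (k - 1)))"
    unfolding kernel_eq[OF X Y k] s1 s2 s3 e2 by (simp only: mult_ac mult_1_left)
  also have "\<dots> = (exp (- rho k (Suc n) X) * A1 powr (1 - 2 * k) * A2 powr (k - 1)) * v powr (1 - 2 * k) *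
    ((exp (rho k n Y) * B1 * B2 powr (k - 1) * ((\<Prod>r=1..n. 1 / exp (2 * Y r)) * (\<Prod>r=1..n. exp (2 * Y r)))) *
     (exp_vand n Y * node_dist_prod n X Y powr (k - 1)))"
    by (simp only: e1)
  also have "\<dots> = kernel_X k n X * v powr (1 - 2 * k) * (kernel_Y k n Y * (exp_vand n Y * ((\<Prod>r=1..n. exp (2 * Y r)) * node_dist_prod n X Y powr (k - 1))))"
    unfolding kernel_X_def kernel_Y_def A1_def A2_def B1_def B2_def by (simp only: mult_ac)
  finally show ?thesis unfolding bbp v_def .
qed

text \<open>By \<open>dixon_const\<close> the total mass is a constant times the Vandermonde product
  to the power \<open>2 * k - 1\<close>. It cancels the singular factor of
  \<open>kernel_weight\<close>, so the recursion becomes a continuous function of \<open>X\<close>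
  times a mean.\<close>

lemma step_limit:
  assumes n: "n \<ge> 1" and k: "k > 0" and X0: "X0 \<in> closure (chamber (Suc n))"
    and \<phi>: "continuous_on (closure (chamber n)) (\<phi> (\<lambda>j. l j - l (n + 1)))"
  shows "\<exists>L. (hypergeom_step k n \<phi> l \<longlongrightarrow> L) (chamber_filter (Suc n) X0)"
proof -
  define f where "f = \<phi> (\<lambda>j. l j - l (n + 1))"
  have \<kappa>: "pos_params n (\<lambda>_. k)" using k by (simp add: pos_params_def)
  obtain C where C: "C > 0" "\<And>X. X \<in> chamber (Suc n) \<Longrightarrow> dixon n (\<lambda>_. k) X (\<lambda>_. 1) = C * vand {1..Suc n} (\<lambda>i. exp (2 * X i)) powr (2 * k - 1)"
    using dixon_const[OF n k] by blast
  have "continuous_on (closure (chamber n)) (\<lambda>Y. f Y * kernel_Y k n Y)"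
    using \<phi> unfolding f_def by (intro continuous_on_mult continuous_on_subset[OF continuous_on_kernel_Y]) auto
  from dixon_mean_limit[OF n X0 \<kappa> this] obtain L where L: "((\<lambda>X. dixon_mean n (\<lambda>_. k) X (\<lambda>Y. f Y * kernel_Y k n Y)) \<longlongrightarrow> L) (chamber_filter (Suc n) X0)" by blast
  define c where "c X = Gamma (k * real (n + 1)) / Gamma k ^ (n + 1) * exp (l (n + 1) * (\<Sum>j=1..n+1. X j)) * kernel_X k n X * C" for X
  have "continuous_on UNIV c" unfolding c_def[abs_def] by (intro continuous_intros continuous_on_kernel_X)
  then have "(c \<longlongrightarrow> c X0) (chamber_filter (Suc n) X0)" by (rule tendsto_chamber_filter)
  from tendsto_mult[OF this L] have lim: "((\<lambda>X. c X * dixon_mean n (\<lambda>_. k) X (\<lambda>Y. f Y * kernel_Y k n Y)) \<longlongrightarrow> c X0 * L) (chamber_filter (Suc n) X0)" .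
  have "eventually (\<lambda>X. c X * dixon_mean n (\<lambda>_. k) X (\<lambda>Y. f Y * kernel_Y k n Y) = hypergeom_step k n \<phi> l X) (chamber_filter (Suc n) X0)"
    using eventually_chamber_filter_chamber
  proof eventually_elim
    case (elim X)
    define v where "v = vand {1..Suc n} (\<lambda>i. exp (2 * X i))"
    have v: "v > 0" unfolding v_def by (rule vand_pos[OF elim])
    have "(LINT Y:interlacing n X|Pi\<^sub>M {1..n} (\<lambda>_. lborel). f Y * kernel_S k n Y X * dprod n Y powr (2 * k)) =
      (\<integral>Y. (kernel_X k n X * v powr (1 - 2 * k)) * ((f Y * kernel_Y k n Y) * (exp_vand n Y * (\<Prod>r=1..n. cut_weight n (\<lambda>_. k) X r (Y r)))) \<partial>box_measure n)"
      unfolding set_lebesgue_integral_def box_measure_def[symmetric]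
    proof (rule Bochner_Integration.integral_cong[OF refl])
      fix Y assume Y: "Y \<in> space (box_measure n)"
      show "indicat_real (interlacing n X) Y *\<^sub>R (f Y * kernel_S k n Y X * dprod n Y powr (2 * k)) =
         (kernel_X k n X * v powr (1 - 2 * k)) * ((f Y * kernel_Y k n Y) * (exp_vand n Y * (\<Prod>r=1..n. cut_weight n (\<lambda>_. k) X r (Y r))))"
      proof (cases "Y \<in> interlacing n X")
        case True
        have "f Y * kernel_S k n Y X * dprod n Y powr (2 * k) = f Y * (kernel_S k n Y X * dprod n Y powr (2 * k))" by simp
        also have "\<dots> = (kernel_X k n X * v powr (1 - 2 * k)) * ((f Y * kernel_Y k n Y) * (exp_vand n Y * (\<Prod>r=1..n. cut_weight n (\<lambda>_. k) X r (Y r))))"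
          unfolding kernel_weight[OF elim True k] v_def by (simp only: mult_ac)
        finally show ?thesis using True by (simp only: indicator_simps scaleR_one)
      next
        case False
        show ?thesis by (simp only: indicator_simps False not_False_eq_True prod_cut_weight_eq_0[OF Y False] mult_zero_right scaleR_zero_left)
      qed
    qed
    also have "\<dots> = kernel_X k n X * v powr (1 - 2 * k) * dixon n (\<lambda>_. k) X (\<lambda>Y. f Y * kernel_Y k n Y)"
      unfolding dixon_def by (rule integral_mult_right_zero)
    also have "dixon n (\<lambda>_. k) X (\<lambda>Y. f Y * kernel_Y k n Y) = dixon_mean n (\<lambda>_. k) X (\<lambda>Y. f Y * kernel_Y k n Y) * (C * v powr (2 * k - 1))"
    proof -
      have Cv: "C * v powr (2 * k - 1) = dixon n (\<lambda>_. k) X (\<lambda>_. 1)" using C(2)[OF elim] by (simp add: v_def)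
      have "dixon n (\<lambda>_. k) X (\<lambda>_. 1) \<noteq> 0" using dixon_pos[OF elim \<kappa>] by simp
      then show ?thesis unfolding Cv dixon_mean_def by simp
    qed
    also have "kernel_X k n X * v powr (1 - 2 * k) * (dixon_mean n (\<lambda>_. k) X (\<lambda>Y. f Y * kernel_Y k n Y) * (C * v powr (2 * k - 1))) =
      (v powr (1 - 2 * k) * v powr (2 * k - 1)) * (kernel_X k n X * C * dixon_mean n (\<lambda>_. k) X (\<lambda>Y. f Y * kernel_Y k n Y))"
      by (simp only: mult_ac)
    also have "v powr (1 - 2 * k) * v powr (2 * k - 1) = 1" using v by (simp flip: powr_add)
    finally show ?case unfolding hypergeom_step_def f_def c_def by (simp only: mult_ac mult_1_left)
  qed
  from Lim_transform_eventually[OF lim this] show ?thesis by blast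
qed

section \<open>Continuity on the closed chamber\<close>

lemma hypergeom_tendsto:
  assumes n: "n \<ge> 1" and k: "k > 0" and X0: "X0 \<in> closure (chamber (Suc n))"
    and \<phi>: "\<And>l. continuous_on (closure (chamber n)) (hypergeom k (n - 1) l)"
  shows "(hypergeom k n l \<longlongrightarrow> hypergeom k n l X0) (chamber_filter (Suc n) X0)"
proof -
  obtain m where m: "n = Suc m" using n by (cases n) auto
  define h where "h = hypergeom_step k n (hypergeom k m) l"
  obtain L where L: "(h \<longlongrightarrow> L) (chamber_filter (Suc n) X0)"
    unfolding h_def using step_limit[OF n k X0, of "hypergeom k m" l] \<phi> m by auto
  have hyp: "hypergeom k n l X = h X" if "X \<in> chamber (Suc n)" for X
    using that by (simp add: m h_def)
  have "hypergeom k n l X0 = L"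
  proof (cases "X0 \<in> chamber (Suc n)")
    case True
    \<comment> \<open>Every set of the filter contains \<open>X0\<close>, so a limit other than the
      value could be separated from it. This is also what proves continuity inside the
      chamber.\<close>
    have "L = h X0"
    proof (rule ccontr)
      assume "L \<noteq> h X0"
      then obtain U where U: "open U" "L \<in> U" "h X0 \<notin> U" using t1_space[of L "h X0"] by blast
      from topological_tendstoD[OF L U(1,2)] have "eventually (\<lambda>X. X \<in> chamber (Suc n) \<longrightarrow> h X \<in> U) (nhds X0)"
        by (simp add: chamber_filter_def eventually_inf_principal)
      from eventually_nhds_x_imp_x[OF this] True U(3) show False by simp
    qed
    with hyp[OF True] show ?thesis by simp
  next
    case False
    \<comment> \<open>Off the chamber, removing \<open>X0\<close> from the neighbourhoods has no
      effect, so this is the limit in the definition of \<open>hypergeom\<close>.\<close>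
    have e: "at X0 within chamber (Suc n) = chamber_filter (Suc n) X0"
      unfolding at_within_def chamber_filter_def using False by simp
    have "hypergeom k n l X0 = Lim (at X0 within chamber (Suc n)) h"
      using False by (simp add: m h_def)
    also have "\<dots> = L" unfolding e by (rule tendsto_Lim[OF chamber_filter_nontrivial[OF X0] L])
    finally show ?thesis .
  qed
  moreover have "(hypergeom k n l \<longlongrightarrow> L) (chamber_filter (Suc n) X0)"
    using L by (rule Lim_transform_eventually) (use eventually_chamber_filter_chamber[of "Suc n" X0] hyp in \<open>auto elim: eventually_mono\<close>)
  ultimately show ?thesis by simp
qed

text \<open>Limits from inside also control points approached along the walls: such a value is
  itself a limit of values in the chamber, and these are within \<open>e / 2\<close> of
  \<open>f X0\<close>.\<close>

lemma continuous_on_closure_chamber_filter: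
  fixes f :: "(nat \<Rightarrow> real) \<Rightarrow> real"
  assumes "\<And>X0. X0 \<in> closure (chamber N) \<Longrightarrow> (f \<longlongrightarrow> f X0) (chamber_filter N X0)"
  shows "continuous_on (closure (chamber N)) f"
  unfolding continuous_on_def
proof (intro ballI tendstoI)
  fix X0 e assume X0: "X0 \<in> closure (chamber N)" and e: "(e::real) > 0"
  have "eventually (\<lambda>X. dist (f X) (f X0) < e / 2) (chamber_filter N X0)" using assms[OF X0] e by (intro tendstoD) auto
  then have "eventually (\<lambda>X. X \<in> chamber N \<longrightarrow> dist (f X) (f X0) < e / 2) (nhds X0)"
    by (simp add: chamber_filter_def eventually_inf_principal)
  then obtain S where S: "open S" "X0 \<in> S" "\<And>X. X \<in> S \<Longrightarrow> X \<in> chamber N \<Longrightarrow> dist (f X) (f X0) < e / 2"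
    unfolding eventually_nhds by blast
  have "dist (f X1) (f X0) < e" if X1: "X1 \<in> S" "X1 \<in> closure (chamber N)" for X1
  proof -
    have "eventually (\<lambda>X. X \<in> S) (nhds X1)" using S(1) X1(1) by (rule eventually_nhds_in_open)
    then have "eventually (\<lambda>X. X \<in> S) (chamber_filter N X1)" unfolding chamber_filter_def by (rule filter_leD[OF inf_le1])
    then have "eventually (\<lambda>X. dist (f X) (f X0) \<le> e / 2) (chamber_filter N X1)"
      using eventually_chamber_filter_chamber by eventually_elim (use S(3) in \<open>auto intro: less_imp_le\<close>)
    moreover have "((\<lambda>X. dist (f X) (f X0)) \<longlongrightarrow> dist (f X1) (f X0)) (chamber_filter N X1)"
      by (intro tendsto_dist tendsto_const assms X1)
    ultimately have "dist (f X1) (f X0) \<le> e / 2"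
      using chamber_filter_nontrivial[OF X1(2)] by (intro tendsto_upperbound)
    then show ?thesis using e by simp
  qed
  then show "eventually (\<lambda>X. dist (f X) (f X0) < e) (at X0 within closure (chamber N))"
    unfolding eventually_at_topological using S(1,2) by blast
qed

lemma bound_transfer:
  assumes X0: "X0 \<in> closure (chamber N)" and f: "(f \<longlongrightarrow> f X0) (chamber_filter N X0)" and g: "(g \<longlongrightarrow> g X0) (chamber_filter N X0)"
    and le: "\<And>X. X \<in> chamber N \<Longrightarrow> f X \<le> (g X :: real)"
  shows "f X0 \<le> g X0"
  by (rule tendsto_le[OF chamber_filter_nontrivial[OF X0] g f])
     (rule eventually_mono[OF eventually_chamber_filter_chamber], rule le)

lemma bound_B_tendsto:
  assumes X0: "X0 \<in> closure (chamber (Suc n))" and l: "l \<in> closure (chamber (Suc n))"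
  shows "(bound_B k n l \<longlongrightarrow> bound_B k n l X0) (chamber_filter (Suc n) X0)"
proof -
  have rv: "((\<lambda>X. root_val \<alpha> X) \<longlongrightarrow> root_val \<alpha> X0) (chamber_filter (Suc n) X0)" for \<alpha>
    by (rule tendsto_chamber_filter[of "root_val \<alpha>"]) (auto simp: root_val_def[abs_def] intro!: continuous_intros)
  have E: "((\<lambda>X. exp (pairing (n + 1) l X - rho k (n + 1) X)) \<longlongrightarrow> exp (pairing (n + 1) l X0 - rho k (n + 1) X0)) (chamber_filter (Suc n) X0)"
    by (rule tendsto_chamber_filter[of "\<lambda>X. exp (pairing (n + 1) l X - rho k (n + 1) X)"]) (auto simp: pairing_def intro!: continuous_intros)
  show ?thesis unfolding bound_B_def[abs_def]
  proof (intro tendsto_mult E tendsto_prod tendsto_divide tendsto_powr tendsto_add tendsto_const rv)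
    fix \<alpha> assume "\<alpha> \<in> pos_roots (n + 1)"
    then have p: "0 \<le> root_val \<alpha> X0" "0 \<le> root_val \<alpha> l"
      using closure_chamber_nonneg[OF X0] closure_chamber_nonneg[OF l] by auto
    then have q: "0 < 1 + root_val \<alpha> l * root_val \<alpha> X0" "0 < 1 + root_val \<alpha> l" "0 < 1 + root_val \<alpha> l * (1 + root_val \<alpha> X0)"
      by (auto intro!: add_pos_nonneg)
    then show "1 + root_val \<alpha> l * root_val \<alpha> X0 \<noteq> 0" "1 + root_val \<alpha> l \<noteq> 0" by auto
    show "(1 + root_val \<alpha> l * root_val \<alpha> X0) powr k \<noteq> 0" using q by simp
    show "(1 + root_val \<alpha> l * (1 + root_val \<alpha> X0)) / (1 + root_val \<alpha> l) \<noteq> 0" using q by auto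
  qed
qed

section \<open>The induction on the rank\<close>

lemma bound_B_reduced_integrand:
  assumes X: "X \<in> chamber (Suc (Suc p))" and Y: "Y \<in> interlacing (Suc p) X" and k: "k > 0"
  shows "exp (l (Suc (Suc p)) * (\<Sum>j=1..Suc (Suc p). X j)) *
     (bound_B k p (\<lambda>j. l j - l (Suc (Suc p))) Y * (kernel_S k (Suc p) Y X * dprod (Suc p) Y powr (2 * k))) =
     exp (pairing (Suc (Suc p)) l X - rho k (Suc (Suc p)) X) * reduced_integrand k (Suc p) l X Y"
proof -
  define n where "n = Suc p"
  define c where "c = l (Suc n)"
  \<comment> \<open>\<open>bound_B\<close> at \<open>Y\<close> contributes
    \<open>- rho k n Y\<close> and the kernel \<open>rho k n Y\<close>. Splitting \<open>l j\<close>
    into \<open>l j - c\<close> and \<open>c\<close> turns the linear terms into the pairing with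
    \<open>X\<close> minus the damping exponent.\<close>
  have e: "c * (\<Sum>j=1..Suc n. X j) + (pairing n (\<lambda>j. l j - c) Y - rho k n Y) + (rho k n Y - rho k (Suc n) X) =
    (pairing (Suc n) l X - rho k (Suc n) X) + (- (\<Sum>j=1..n. lam_diff n l j * (X j - Y j)))"
  proof -
    have "pairing (Suc n) l X = (\<Sum>j=1..n. l j * X j) + c * X (Suc n)" by (simp add: pairing_def c_def)
    moreover have "c * (\<Sum>j=1..Suc n. X j) = (\<Sum>j=1..n. c * X j) + c * X (Suc n)" by (simp add: sum_distrib_left algebra_simps)
    moreover have "(\<Sum>j=1..n. lam_diff n l j * (X j - Y j)) = (\<Sum>j=1..n. l j * X j) - (\<Sum>j=1..n. c * X j) - pairing n (\<lambda>j. l j - c) Y"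
      unfolding pairing_def sum_subtractf[symmetric] by (intro sum.cong refl) (simp add: lam_diff_def c_def algebra_simps)
    ultimately show ?thesis by simp
  qed
  have rv: "root_val \<alpha> (\<lambda>j. l j - c) = root_val \<alpha> l" for \<alpha> by (simp add: root_val_def)
  have Xn: "X \<in> chamber (Suc n)" "Y \<in> interlacing n X" using X Y by (simp_all add: n_def)
  have B: "bound_B k p (\<lambda>j. l j - c) Y = exp (pairing n (\<lambda>j. l j - c) Y - rho k n Y) * (\<Prod>\<alpha>\<in>pos_roots n. root_factor k (root_val \<alpha> l) (root_val \<alpha> Y))"
    unfolding bound_B_eq n_def[symmetric] rv ..
  have "exp (c * (\<Sum>j=1..Suc n. X j)) * (bound_B k p (\<lambda>j. l j - c) Y * (kernel_S k n Y X * dprod n Y powr (2 * k))) =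
    (exp (c * (\<Sum>j=1..Suc n. X j)) * exp (pairing n (\<lambda>j. l j - c) Y - rho k n Y) * exp (rho k n Y - rho k (Suc n) X)) *
    (esinh_prod (Suc n) X powr (1 - 2 * k) * (esinh_prod n Y * (\<Prod>\<alpha>\<in>pos_roots n. root_factor k (root_val \<alpha> l) (root_val \<alpha> Y))) * esinh_bracket n X Y powr (k - 1))"
    unfolding B kernel_eq[OF Xn k] by (simp only: mult_ac)
  also have "\<dots> = exp (pairing (Suc n) l X - rho k (Suc n) X) * reduced_integrand k n l X Y"
    unfolding exp_add[symmetric] e reduced_integrand_def unfolding exp_add by (simp only: mult_ac)
  finally show ?thesis by (simp only: n_def c_def)
qed

text \<open>Outside the closed chamber nothing is known about the function, so it is cut off by the
  indicator of that closed set, which contains the interlacing box.\<close>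

lemma measurable_on_box:
  assumes X: "X \<in> chamber (Suc n)" and \<phi>: "continuous_on (closure (chamber n)) \<phi>"
  shows "(\<lambda>Y. indicat_real (interlacing n X) Y * (\<phi> Y * (kernel_S k n Y X * dprod n Y powr (2 * k)))) \<in> borel_measurable (Pi\<^sub>M {1..n} (\<lambda>_. lborel))"
proof -
  define C where "C = closure (chamber n)"
  have C: "C \<in> sets borel" "continuous_on C \<phi>" using \<phi> by (auto simp: C_def)
  have [measurable]: "(\<lambda>Y. indicat_real C Y *\<^sub>R \<phi> Y) \<in> borel_measurable (Pi\<^sub>M {1..n} (\<lambda>_. lborel))"
    by (intro borel_measurable_PiM borel_measurable_continuous_on_indicator C)
  have comp [measurable]: "(\<lambda>Y. Y i) \<in> borel_measurable (Pi\<^sub>M {1..n} (\<lambda>_. lborel :: real measure))" for i :: nat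
    by (rule measurable_compose[OF measurable_PiM_borel])
       (intro borel_measurable_continuous_onI continuous_on_component)
  have [measurable]: "(\<lambda>Y. kernel_S k n Y X * dprod n Y powr (2 * k)) \<in> borel_measurable (Pi\<^sub>M {1..n} (\<lambda>_. lborel :: real measure))"
    unfolding kernel_S_def dprod_def root_val_def sinh_field_def by measurable
  have "(\<lambda>Y. indicat_real (interlacing n X) Y * (\<phi> Y * (kernel_S k n Y X * dprod n Y powr (2 * k)))) =
    (\<lambda>Y. indicat_real (interlacing n X) Y * ((indicat_real C Y *\<^sub>R \<phi> Y) * (kernel_S k n Y X * dprod n Y powr (2 * k))))"
    using interlacing_closure_chamber[OF X] by (auto simp: fun_eq_iff indicator_def C_def)
  then show ?thesis by (rule ssubst) measurable
qed

text \<open>Continuity at the lower rank makes the integrand measurable and the wall limits exist,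
  for every \<open>l\<close>; the bounds use it together with those of the lower rank. Hence both
  are carried through one induction.\<close>

lemma hypergeom_continuous_bounds:
  fixes n :: nat and k :: real
  assumes k: "k > 0"
  shows "(\<forall>l. continuous_on (closure (chamber (Suc n))) (hypergeom k n l)) \<and>
    (\<exists>C1 C2. C1 > 0 \<and> C2 > 0 \<and>
           (\<forall>X\<in>closure (chamber (Suc n)). \<forall>l\<in>closure (chamber (Suc n)).
              C1 * bound_B k n l X \<le> hypergeom k n l X \<and>
              hypergeom k n l X \<le> C2 * bound_B k n l X))"
proof (induction n)
  case 0
  have "hypergeom k 0 l = (\<lambda>X. exp (l 1 * X 1))" for l by (simp add: fun_eq_iff)
  moreover have "bound_B k 0 l X = exp (l 1 * X 1)" for l X
    by (simp add: bound_B_def pairing_def rho_def)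
  ultimately show ?case by (auto intro!: continuous_intros exI[of _ "1::real"])
next
  case (Suc p)
  define n where "n = Suc p"
  have n: "n \<ge> 1" by (simp add: n_def)
  from Suc obtain c1 c2 where c: "c1 > 0" "c2 > 0"
    and b: "\<And>Y l. Y \<in> closure (chamber n) \<Longrightarrow> l \<in> closure (chamber n) \<Longrightarrow>
      c1 * bound_B k p l Y \<le> hypergeom k p l Y \<and> hypergeom k p l Y \<le> c2 * bound_B k p l Y"
    unfolding n_def by blast
  have cont: "continuous_on (closure (chamber n)) (hypergeom k p l)" for l using Suc by (simp add: n_def)
  have cont': "continuous_on (closure (chamber n)) (hypergeom k (n - 1) l)" for l using cont by (simp add: n_def)
  have td: "(hypergeom k n l \<longlongrightarrow> hypergeom k n l X0) (chamber_filter (Suc n) X0)" if "X0 \<in> closure (chamber (Suc n))" for l X0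
    by (rule hypergeom_tendsto[OF n k that cont'])
  from step_bounds[OF k, of n] obtain C1 C2 where C: "C1 > 0" "C2 > 0" and SB:
    "\<forall>X\<in>chamber (Suc n). \<forall>l\<in>closure (chamber (Suc n)). \<forall>f\<in>borel_measurable (Pi\<^sub>M {1..n} (\<lambda>_. lborel)). \<forall>a1 a2.
       0 < a1 \<longrightarrow> 0 < a2 \<longrightarrow>
       (\<forall>Y\<in>interlacing n X. a1 * reduced_integrand k n l X Y \<le> f Y \<and> f Y \<le> a2 * reduced_integrand k n l X Y) \<longrightarrow>
       a1 * C1 * (esinh_prod (Suc n) X powr (- k) * psi_prod k (Suc n) l X) \<le> (LINT Y:interlacing n X|Pi\<^sub>M {1..n} (\<lambda>_. lborel). f Y) \<and>
       (LINT Y:interlacing n X|Pi\<^sub>M {1..n} (\<lambda>_. lborel). f Y) \<le> a2 * C2 * (esinh_prod (Suc n) X powr (- k) * psi_prod k (Suc n) l X)"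
    by (elim exE conjE) blast
  define \<gamma> where "\<gamma> = Gamma (k * real (n + 1)) / Gamma k ^ (n + 1)"
  have \<gamma>: "\<gamma> > 0" unfolding \<gamma>_def using k by (intro divide_pos_pos zero_less_power Gamma_real_pos) auto
  define B0 where "B0 = ((2::real) powr (2 * k + 1)) ^ card (pos_roots (Suc n))"
  have B0: "B0 > 0" by (simp add: B0_def)
  have open_bounds: "\<gamma> * c1 * C1 / B0 * bound_B k n l X \<le> hypergeom k n l X \<and> hypergeom k n l X \<le> \<gamma> * c2 * C2 * B0 * bound_B k n l X"
    if X: "X \<in> chamber (Suc n)" and l: "l \<in> closure (chamber (Suc n))" for X l
  proof -
    define l0 where "l0 = (\<lambda>j. l j - l (n + 1))"
    have l0: "l0 \<in> closure (chamber n)" using l unfolding closure_chamber l0_def by auto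
    define E where "E = exp (pairing (Suc n) l X - rho k (Suc n) X)"
    define ex where "ex = exp (l (n + 1) * (\<Sum>j=1..n+1. X j))"
    have E: "E > 0" "ex > 0" by (simp_all add: E_def ex_def)
    define kd where "kd Y = kernel_S k n Y X * dprod n Y powr (2 * k)" for Y
    \<comment> \<open>The prefactors bring the integrand between multiples of
      \<open>reduced_integrand\<close>. The indicator does not change the integral over the box, but
      makes \<open>f\<close> measurable on the whole space.\<close>
    define f where "f Y = ex / E * (indicat_real (interlacing n X) Y * (hypergeom k p l0 Y * kd Y))" for Y
    define T where "T = esinh_prod (Suc n) X powr (- k) * psi_prod k (Suc n) l X"
    have f_meas: "f \<in> borel_measurable (Pi\<^sub>M {1..n} (\<lambda>_. lborel))"
      unfolding f_def kd_def by (intro borel_measurable_times borel_measurable_const measurable_on_box[OF X cont])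
    have fb: "c1 * reduced_integrand k n l X Y \<le> f Y \<and> f Y \<le> c2 * reduced_integrand k n l X Y" if Y: "Y \<in> interlacing n X" for Y
    proof -
      have YC: "Y \<in> closure (chamber n)" by (rule interlacing_closure_chamber[OF X Y])
      have kd0: "0 \<le> kd Y" unfolding kd_def kernel_eq[OF X Y k]
        using esinh_bracket_nonneg[OF X Y] by (intro mult_nonneg_nonneg) auto
      have co: "ex / E * (bound_B k p l0 Y * kd Y) = reduced_integrand k n l X Y"
      proof -
        have "ex * (bound_B k p l0 Y * kd Y) = E * reduced_integrand k n l X Y"
          using bound_B_reduced_integrand[of X p Y k l] X Y k by (simp add: ex_def l0_def kd_def E_def n_def)
        then show ?thesis using E by (simp add: field_simps)
      qed
      have "c1 * reduced_integrand k n l X Y = ex / E * (c1 * bound_B k p l0 Y * kd Y)" unfolding co[symmetric] by (simp only: mult_ac)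
      also have "\<dots> \<le> ex / E * (hypergeom k p l0 Y * kd Y)"
        using b[OF YC l0] kd0 E by (intro mult_left_mono mult_right_mono) auto
      also have "\<dots> = f Y" using Y by (simp add: f_def)
      finally have 1: "c1 * reduced_integrand k n l X Y \<le> f Y" .
      have "f Y = ex / E * (hypergeom k p l0 Y * kd Y)" using Y by (simp add: f_def)
      also have "\<dots> \<le> ex / E * (c2 * bound_B k p l0 Y * kd Y)"
        using b[OF YC l0] kd0 E by (intro mult_left_mono mult_right_mono) auto
      also have "\<dots> = c2 * reduced_integrand k n l X Y" unfolding co[symmetric] by (simp only: mult_ac)
      finally show ?thesis using 1 by blast
    qed
    define I where "I = (LINT Y:interlacing n X|Pi\<^sub>M {1..n} (\<lambda>_. lborel). f Y)"
    have IB: "c1 * C1 * T \<le> I" "I \<le> c2 * C2 * T"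
      using SB X l c f_meas fb unfolding I_def T_def by blast+
    have hyp: "hypergeom k n l X = \<gamma> * (E * I)"
    proof -
      have "hypergeom k n l X = \<gamma> * ex * (LINT Y:interlacing n X|Pi\<^sub>M {1..n} (\<lambda>_. lborel). hypergeom k p l0 Y * kernel_S k n Y X * dprod n Y powr (2 * k))"
        using X by (simp add: n_def hypergeom_step_def \<gamma>_def ex_def l0_def)
      moreover have "I = ex / E * (LINT Y:interlacing n X|Pi\<^sub>M {1..n} (\<lambda>_. lborel). hypergeom k p l0 Y * kernel_S k n Y X * dprod n Y powr (2 * k))"
      proof -
        have "indicat_real (interlacing n X) Y *\<^sub>R f Y = ex / E * (indicat_real (interlacing n X) Y *\<^sub>R (hypergeom k p l0 Y * kernel_S k n Y X * dprod n Y powr (2 * k)))" for Y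
          by (simp add: f_def kd_def indicator_def)
        then show ?thesis unfolding I_def set_lebesgue_integral_def by simp
      qed
      ultimately show ?thesis using E by simp
    qed
    have BT: "bound_B k n l X \<le> B0 * (E * T)" "E * T \<le> B0 * bound_B k n l X"
      using bound_B_psi_prod[OF k X l] by (simp_all add: B0_def E_def T_def)
    have "\<gamma> * c1 * C1 / B0 * bound_B k n l X \<le> \<gamma> * c1 * C1 / B0 * (B0 * (E * T))"
      using BT(1) \<gamma> c C B0 by (intro mult_left_mono) auto
    also have "\<dots> = \<gamma> * (E * (c1 * C1 * T))" using B0 by simp
    also have "\<dots> \<le> \<gamma> * (E * I)" using IB(1) \<gamma> E by (intro mult_left_mono) auto
    finally have lo: "\<gamma> * c1 * C1 / B0 * bound_B k n l X \<le> hypergeom k n l X" by (simp only: hyp)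
    have "\<gamma> * (E * I) \<le> \<gamma> * (E * (c2 * C2 * T))" using IB(2) \<gamma> E by (intro mult_left_mono) auto
    also have "\<dots> = \<gamma> * c2 * C2 * (E * T)" by (simp only: mult_ac)
    also have "\<dots> \<le> \<gamma> * c2 * C2 * (B0 * bound_B k n l X)" using BT(2) \<gamma> c C by (intro mult_left_mono) auto
    finally have "hypergeom k n l X \<le> \<gamma> * c2 * C2 * B0 * bound_B k n l X" by (simp only: hyp mult.assoc)
    with lo show ?thesis by blast
  qed
  \<comment> \<open>On the walls both sides are limits along \<open>chamber_filter\<close>, so the
    inequalities pass over with the same constants.\<close>
  have bounds: "\<gamma> * c1 * C1 / B0 * bound_B k n l X \<le> hypergeom k n l X \<and> hypergeom k n l X \<le> \<gamma> * c2 * C2 * B0 * bound_B k n l X"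
    if X: "X \<in> closure (chamber (Suc n))" and l: "l \<in> closure (chamber (Suc n))" for X l
  proof
    show "\<gamma> * c1 * C1 / B0 * bound_B k n l X \<le> hypergeom k n l X"
    proof (rule bound_transfer[where f = "\<lambda>X. \<gamma> * c1 * C1 / B0 * bound_B k n l X", OF X _ td[OF X]])
      show "((\<lambda>X. \<gamma> * c1 * C1 / B0 * bound_B k n l X) \<longlongrightarrow> \<gamma> * c1 * C1 / B0 * bound_B k n l X) (chamber_filter (Suc n) X)"
        by (intro tendsto_mult tendsto_const bound_B_tendsto[OF X l])
    qed (use open_bounds[OF _ l] in blast)
    show "hypergeom k n l X \<le> \<gamma> * c2 * C2 * B0 * bound_B k n l X"
    proof (rule bound_transfer[where g = "\<lambda>X. \<gamma> * c2 * C2 * B0 * bound_B k n l X", OF X td[OF X]])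
      show "((\<lambda>X. \<gamma> * c2 * C2 * B0 * bound_B k n l X) \<longlongrightarrow> \<gamma> * c2 * C2 * B0 * bound_B k n l X) (chamber_filter (Suc n) X)"
        by (intro tendsto_mult tendsto_const bound_B_tendsto[OF X l])
    qed (use open_bounds[OF _ l] in blast)
  qed
  have "\<gamma> * c1 * C1 / B0 > 0" "\<gamma> * c2 * C2 * B0 > 0" using \<gamma> c C B0 by simp_all
  with bounds continuous_on_closure_chamber_filter[OF td] show ?case unfolding n_def by blast
qed

theorem theorem1p3:
  fixes n :: nat and k :: real
  assumes "n \<ge> 1" and "k > 0"
  shows "\<exists>C1 C2. C1 > 0 \<and> C2 > 0 \<and>
           (\<forall>X\<in>closure (chamber (n + 1)). \<forall>l\<in>closure (chamber (n + 1)).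
              C1 * bound_B k n l X \<le> hypergeom k n l X \<and>
              hypergeom k n l X \<le> C2 * bound_B k n l X)"
  using hypergeom_continuous_bounds[OF assms(2), of n] by simp

end
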